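(* Let $p(x)$ be a polynomial of degree $\ell$ that is non-negative and non-decreasing for $x\ge 0$. Let $C_{w_c,n}$ be the number of cycles of the commutator $\sigma\tau\sigma^{-1}\tau^{-1}$, where $(\sigma,\tau)$ is uniformly distributed on $S_n\times S_n$, and let $C_{\eta,n}$ be the number of cycles of $\eta$, where $\eta$ is uniformly distributed on $A_n$. Then, as $n\to\infty$, $$\mathbb{E}[p(C_{w_c,n})]=\mathbb{E}[p(C_{\eta,n})]+O\left(\frac{\log^{\ell}(n)}{n}\right).$$
   Context: $S_n$ and $A_n$ are the symmetric and alternating groups on $\{1,\dots,n\}$. Number of cycles means the number of cycles in the disjoint cycle decomposition, fixed points counted as cycles of length 1. The polynomial $p$ is fixed (the implied constant may depend on $p$). ($C_{w_c,n}$ is the number of vertices of the random square-tiled surface with $n$ squares whose horizontal and vertical gluings are given by $\sigma$ and $\tau$.) *)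

theory Defs
  imports
    "HOL-Probability.Probability"
    "HOL-Algebra.Sym_Groups"
    "HOL-Combinatorics.Orbits"
    "HOL-Computational_Algebra.Polynomial"
    "HOL-Library.Landau_Symbols"
begin

text \<open>
  Cycles are represented by their underlying sets. Fixed points in \<open>S\<close> count as cycles of
  length 1, since \<^prop>\<open>f x = x\<close> implies \<^prop>\<open>cyclic_on f {x}\<close>; the points outside \<open>S\<close>,
  which are fixed by every \<^prop>\<open>f permutes S\<close>, are excluded. The lemma
  \<open>num_cycles_eq_length\<close> below states that this is the number of factors in any
  decomposition of \<open>f\<close> into disjoint cycles that covers \<open>S\<close>.
\<close>

definition num_cycles :: "'a set \<Rightarrow> ('a \<Rightarrow> 'a) \<Rightarrow> nat" where
  "num_cycles S f = card {C. C \<subseteq> S \<and> cyclic_on f C}"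

lemma cyclic_on_cycle_of_list:
  assumes "distinct cs" "cs \<noteq> []"
  shows "cyclic_on (cycle_of_list cs) (set cs)"
proof -
  have hd_eq: "(cycle_of_list cs ^^ n) (hd cs) = cs ! (n mod length cs)" for n
  proof -
    have "(cycle_of_list cs ^^ n) (hd cs) = hd (map (cycle_of_list cs ^^ n) cs)"
      using assms(2) by (simp add: hd_map)
    also have "\<dots> = hd (rotate n cs)"
      using cyclic_rotation[OF assms(1)] by simp
    also have "\<dots> = cs ! (n mod length cs)"
      using assms(2) by (simp add: hd_rotate_conv_nth)
    finally show ?thesis .
  qed
  have "orbit (cycle_of_list cs) (hd cs) = {(cycle_of_list cs ^^ n) (hd cs) | n. True}"
    by (rule orbit_altdef_permutation[OF permutation_of_cycle])
  also have "\<dots> = set cs"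
  proof (intro equalityI subsetI)
    fix x assume "x \<in> set cs"
    then obtain i where "i < length cs" "x = cs ! i"
      by (auto simp: in_set_conv_nth)
    then have "x = (cycle_of_list cs ^^ i) (hd cs)"
      by (simp add: hd_eq)
    then show "x \<in> {(cycle_of_list cs ^^ n) (hd cs) | n. True}" by blast
  qed (use assms(2) in \<open>auto simp: hd_eq\<close>)
  finally show ?thesis
    using assms(2) unfolding cyclic_on_def by (metis hd_in_set)
qed

lemma num_cycles_eq_length:
  assumes "distinct (concat css)" "[] \<notin> set css" "set (concat css) = S"
    and "f = foldr (\<circ>) (map cycle_of_list css) id"
  shows "num_cycles S f = length css"
proof -
  define F where "F css = foldr (\<circ>) (map cycle_of_list css) id" for css :: "'a list list"
  have F_permutes: "F css permutes set (concat css)" for css :: "'a list list"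
  proof (induction css)
    case Nil
    show ?case by (simp add: F_def permutes_def)
  next
    case (Cons cs css)
    have "cycle_of_list cs permutes set (concat (cs # css))"
      "F css permutes set (concat (cs # css))"
      using cycle_permutes[of cs] Cons.IH by (auto elim!: permutes_subset)
    from permutes_compose[OF this(2,1)] show ?case by (simp add: F_def o_def)
  qed
  have "finite {C. C \<subseteq> set (concat css) \<and> cyclic_on (F css) C} \<and>
        card {C. C \<subseteq> set (concat css) \<and> cyclic_on (F css) C} = length css"
    using assms(1,2)
  proof (induction css)
    case Nil
    have "{C. C \<subseteq> set (concat []) \<and> cyclic_on (F []) C} = {}"
      by (auto simp: cyclic_on_def)
    then show ?case by (metis card.empty finite.emptyI list.size(3))
  next
    case (Cons cs css)
    let ?I = "set (concat css)"
    have F_Cons: "F (cs # css) = cycle_of_list cs \<circ> F css"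
      by (simp add: F_def o_def)
    have disj: "set cs \<inter> ?I = {}" and "distinct cs" "cs \<noteq> []"
      using Cons.prems by auto
    have eq1: "F (cs # css) x = cycle_of_list cs x" if "x \<in> set cs" for x
    proof -
      have "F css x = x" using that disj F_permutes[of css] by (intro permutes_not_in) auto
      then show ?thesis by (simp add: F_Cons)
    qed
    have eq2: "F (cs # css) x = F css x" if "x \<in> ?I" for x
    proof -
      have "F css x \<in> ?I" using permutes_in_image[OF F_permutes] that by blast
      then have "F css x \<notin> set cs" using disj by blast
      then show ?thesis by (simp add: F_Cons id_outside_supp)
    qed
    have cyc: "cyclic_on (F (cs # css)) (set cs)"
      using cyclic_on_cycle_of_list[OF \<open>distinct cs\<close> \<open>cs \<noteq> []\<close>] eq1
        cyclic_cong[of "set cs" "F (cs # css)" "cycle_of_list cs"] by auto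
    have "{C. C \<subseteq> set (concat (cs # css)) \<and> cyclic_on (F (cs # css)) C} =
          insert (set cs) {C. C \<subseteq> ?I \<and> cyclic_on (F css) C}"
    proof (intro equalityI subsetI)
      fix C assume "C \<in> {C. C \<subseteq> set (concat (cs # css)) \<and> cyclic_on (F (cs # css)) C}"
      then have C: "C \<subseteq> set cs \<union> ?I" "cyclic_on (F (cs # css)) C" by auto
      show "C \<in> insert (set cs) {C. C \<subseteq> ?I \<and> cyclic_on (F css) C}"
      proof (cases "C \<inter> set cs = {}")
        case True
        then have "C \<subseteq> ?I" using C by blast
        moreover have "cyclic_on (F css) C"
          using C(2) cyclic_cong[of C "F (cs # css)" "F css"] eq2 calculation by blast
        ultimately show ?thesis by blast
      next
        case False
        then show ?thesis using C(2) cyc by (auto simp: cyclic_on_alldef)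
      qed
    next
      fix C assume C: "C \<in> insert (set cs) {C. C \<subseteq> ?I \<and> cyclic_on (F css) C}"
      show "C \<in> {C. C \<subseteq> set (concat (cs # css)) \<and> cyclic_on (F (cs # css)) C}"
      proof (cases "C = set cs")
        case True
        then show ?thesis using cyc by simp
      next
        case False
        then have "C \<subseteq> ?I" "cyclic_on (F css) C" using C by auto
        moreover have "cyclic_on (F (cs # css)) C"
          using calculation cyclic_cong[of C "F (cs # css)" "F css"] eq2 by blast
        ultimately show ?thesis by auto
      qed
    qed
    moreover have "set cs \<notin> {C. C \<subseteq> ?I \<and> cyclic_on (F css) C}"
      using disj \<open>cs \<noteq> []\<close> by (metis (mono_tags, lifting) inf.absorb1 mem_Collect_eq set_empty)
    moreover have "finite {C. C \<subseteq> ?I \<and> cyclic_on (F css) C} \<and>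
        card {C. C \<subseteq> ?I \<and> cyclic_on (F css) C} = length css"
      using Cons by simp
    ultimately show ?case by simp
  qed
  then show ?thesis
    using assms(3,4) by (simp add: num_cycles_def F_def)
qed

end

theory Submission
  imports Defs "HOL-Computational_Algebra.Fundamental_Theorem_Algebra"
begin

text \<open>
  Let \<open>G\<close> be the symmetric group of degree \<open>n\<close> and let \<open>Z\<close> be the space of class functions on
  \<open>G\<close>. For a class function \<open>g\<close>, summing \<open>g\<close> over all commutators gives \<open>n!\<close> times the trace of
  convolution by \<open>g\<close> on \<open>Z\<close>. For \<open>g y = t ^ num_cycles y\<close>, convolution by \<open>g\<close> is the product of
  \<open>t + J i\<close> over the Jucys-Murphy elements \<open>J 1, \<dots>, J n\<close>. The relations between adjacent elements
  and the transposition exchanging them force each list of joint eigenvalues to consist of the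
  contents of a Young diagram (Okounkov and Vershik). The class sums lie in the algebra generated
  by the power sums of the Jucys-Murphy elements, by induction on the size of the support, so each
  multiset of contents occurs at most once in \<open>Z\<close>. Hence the generating function of the number of
  cycles of a commutator is \<open>1 / n!\<close> times a sum of products of \<open>t + a\<close> over the contents \<open>a\<close> of
  distinct Young diagrams. The trivial diagram contributes the generating function of a uniform
  permutation, and the alternating group differs from it by the contribution of the sign
  character.

  To compare binomial moments, take coefficients at \<open>t = 1 + y\<close>. A nontrivial diagram has
  \<open>d \<ge> 1\<close> boxes of content \<open>- 1\<close>, and it contributes to the \<open>k\<close>-th moment only if \<open>d \<le> k\<close>.
  Then the product of the other \<open>\<bar>1 + a\<bar>\<close> is a product of at most \<open>2 k + 2\<close> factorials with
  arguments adding up to \<open>n - d\<close>, and the sum of these products over all diagrams is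
  \<open>O((n - 1)!)\<close>. The elementary symmetric functions of the \<open>1 / \<bar>1 + a\<bar>\<close> contribute powers of
  \<open>log n\<close>.
\<close>

section \<open>Commuting symmetric operators\<close>

text \<open>No irreducible representation and no tableau is constructed. Jucys-Murphy elements act
  as real symmetric operators on a function space with its standard inner product, so eigenvectors
  come from elementary linear algebra. An upper bound needs only two facts: each list of eigenvalues
  has the diagonal lengths of a Young diagram, and no multiset of contents is repeated. The obstacle
  to the second is that single Jucys-Murphy operators do not in general preserve class functions;
  only their power sums do. Hence the basis of class functions is an eigenbasis of the power sums,
  and its content lists are found in the surrounding eigenspaces of arbitrary functions. The factor
  \<open>1 / n\<close> arises because a box of content \<open>- 1\<close> contributes the factor
  \<open>y\<close> at \<open>t = 1 + y\<close>. A diagram with \<open>d \<ge> 1\<close> such boxes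
  has only \<open>n - d\<close> factors with nonzero constant term, while the normalisation divides
  by \<open>n!\<close>. The sign character is the one-column diagram and is estimated by the same
  bound as the others. The coefficient of \<open>y ^ k\<close> involves at most \<open>k\<close> of
  the reciprocals \<open>1 / \<bar>1 + a\<bar>\<close>, which is why the exponent of the logarithm
  is the degree.\<close>

definition inner_on :: "'a set \<Rightarrow> ('a \<Rightarrow> real) \<Rightarrow> ('a \<Rightarrow> real) \<Rightarrow> real" where
  "inner_on X f g = (\<Sum>x\<in>X. f x * g x)"

text \<open>Functions on \<open>X\<close> are total functions vanishing outside \<open>X\<close>, so
  the zero vector is literally \<open>\<lambda>_. 0\<close> and equality of vectors is equality of
  functions.\<close>

definition fun_subspace :: "'a set \<Rightarrow> ('a \<Rightarrow> real) set \<Rightarrow> bool" where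
  "fun_subspace X W \<longleftrightarrow> (\<forall>f\<in>W. \<forall>x. x \<notin> X \<longrightarrow> f x = 0) \<and> (\<lambda>_. 0) \<in> W \<and>
     (\<forall>f\<in>W. \<forall>g\<in>W. \<forall>a b. (\<lambda>x. a * f x + b * g x) \<in> W)"

text \<open>Every clause is relative to \<open>W\<close>, so one operator can be restricted to ever
  smaller invariant subspaces without being redefined.\<close>

definition symmetric_op :: "'a set \<Rightarrow> ('a \<Rightarrow> real) set \<Rightarrow> (('a \<Rightarrow> real) \<Rightarrow> ('a \<Rightarrow> real)) \<Rightarrow> bool" where
  "symmetric_op X W A \<longleftrightarrow> (\<forall>f\<in>W. A f \<in> W) \<and>
     (\<forall>f\<in>W. \<forall>g\<in>W. \<forall>a b. A (\<lambda>x. a * f x + b * g x) = (\<lambda>x. a * A f x + b * A g x)) \<and>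
     (\<forall>f\<in>W. \<forall>g\<in>W. inner_on X (A f) g = inner_on X f (A g))"

lemma inner_on_commute: "inner_on X f g = inner_on X g f"
  by (simp add: inner_on_def mult.commute)

lemma inner_on_lin_left:
  "inner_on X (\<lambda>x. a * f x + b * g x) h = a * inner_on X f h + b * inner_on X g h"
  by (simp add: inner_on_def sum.distrib sum_distrib_left algebra_simps)

lemma inner_on_lin_right:
  "inner_on X h (\<lambda>x. a * f x + b * g x) = a * inner_on X h f + b * inner_on X h g"
  by (simp add: inner_on_def sum.distrib sum_distrib_left algebra_simps)

lemma inner_on_self_nonneg: "inner_on X f f \<ge> 0"
  by (simp add: inner_on_def sum_nonneg)

lemma inner_on_self_eq_0:
  assumes "finite X" "inner_on X f f = 0" "x \<in> X"
  shows "f x = 0"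
proof -
  have "\<forall>y\<in>X. f y * f y = 0"
    using assms(1,2) unfolding inner_on_def by (subst (asm) sum_nonneg_eq_0_iff) auto
  with assms(3) show ?thesis by simp
qed

lemma fun_subspace_eq_0_iff:
  assumes "fun_subspace X W" "finite X" "f \<in> W"
  shows "inner_on X f f = 0 \<longleftrightarrow> f = (\<lambda>_. 0)"
proof
  assume "inner_on X f f = 0"
  then have "f x = 0" for x
    using inner_on_self_eq_0[of X f x] assms by (cases "x \<in> X") (auto simp: fun_subspace_def)
  then show "f = (\<lambda>_. 0)" by auto
qed (simp add: inner_on_def)

lemma fun_subspace_lin:
  "fun_subspace X W \<Longrightarrow> f \<in> W \<Longrightarrow> g \<in> W \<Longrightarrow> (\<lambda>x. a * f x + b * g x) \<in> W"
  by (auto simp: fun_subspace_def)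

lemma fun_subspace_scale:
  "fun_subspace X W \<Longrightarrow> f \<in> W \<Longrightarrow> (\<lambda>x. a * f x) \<in> W"
  using fun_subspace_lin[of X W f f a 0] by simp

lemma fun_subspace_sum:
  assumes "fun_subspace X W" "finite I" "\<And>i. i \<in> I \<Longrightarrow> u i \<in> W"
  shows "(\<lambda>x. \<Sum>i\<in>I. c i * u i x) \<in> W"
  using assms(2,3)
proof (induction I rule: finite_induct)
  case empty
  then show ?case using assms(1) by (simp add: fun_subspace_def)
next
  case (insert i I)
  have "(\<lambda>x. c i * u i x + 1 * (\<Sum>i\<in>I. c i * u i x)) \<in> W"
    using insert by (intro fun_subspace_lin[OF assms(1)]) auto
  then show ?case using insert by simp
qed

lemma symmetric_op_closed: "symmetric_op X W A \<Longrightarrow> f \<in> W \<Longrightarrow> A f \<in> W"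
  by (auto simp: symmetric_op_def)

lemma symmetric_op_lin:
  "symmetric_op X W A \<Longrightarrow> f \<in> W \<Longrightarrow> g \<in> W \<Longrightarrow>
    A (\<lambda>x. a * f x + b * g x) = (\<lambda>x. a * A f x + b * A g x)"
  by (auto simp: symmetric_op_def)

lemma symmetric_op_inner:
  "symmetric_op X W A \<Longrightarrow> f \<in> W \<Longrightarrow> g \<in> W \<Longrightarrow> inner_on X (A f) g = inner_on X f (A g)"
  by (auto simp: symmetric_op_def)

lemma symmetric_op_zero:
  assumes "fun_subspace X W" "symmetric_op X W A"
  shows "A (\<lambda>_. 0) = (\<lambda>_. 0)"
  using symmetric_op_lin[OF assms(2), of "\<lambda>_. 0" "\<lambda>_. 0" 0 0] assms(1)
  by (simp add: fun_subspace_def)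

lemma symmetric_op_scale:
  "symmetric_op X W A \<Longrightarrow> f \<in> W \<Longrightarrow> A (\<lambda>x. a * f x) = (\<lambda>x. a * A f x)"
  using symmetric_op_lin[of X W A f f a 0] by simp

lemma symmetric_op_sum:
  assumes "fun_subspace X W" "symmetric_op X W A" "finite I" "\<And>i. i \<in> I \<Longrightarrow> u i \<in> W"
  shows "A (\<lambda>x. \<Sum>i\<in>I. c i * u i x) = (\<lambda>x. \<Sum>i\<in>I. c i * A (u i) x)"
  using assms(3,4)
proof (induction I rule: finite_induct)
  case empty
  then show ?case using symmetric_op_zero[OF assms(1,2)] by simp
next
  case (insert i I)
  have "A (\<lambda>x. c i * u i x + 1 * (\<Sum>i\<in>I. c i * u i x)) =
      (\<lambda>x. c i * A (u i) x + 1 * A (\<lambda>x. \<Sum>i\<in>I. c i * u i x) x)"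
    using insert by (intro symmetric_op_lin[OF assms(2)] fun_subspace_sum[OF assms(1)]) auto
  then show ?case using insert by simp
qed

lemma symmetric_op_funpow: "symmetric_op X W A \<Longrightarrow> f \<in> W \<Longrightarrow> (A ^^ k) f \<in> W"
  by (induction k) (auto simp: symmetric_op_def)

text \<open>Gaussian elimination: the coordinate \<open>x\<close> is cleared with a pivot
  \<open>u k\<close>. The vectors form an indexed family, so the powers of an operator applied to a
  vector may coincide.\<close>

lemma linear_dependence:
  fixes u :: "'i \<Rightarrow> 'a \<Rightarrow> real"
  assumes "finite X" "finite I" "card X < card I"
  shows "\<exists>c. (\<exists>i\<in>I. c i \<noteq> 0) \<and> (\<forall>x\<in>X. (\<Sum>i\<in>I. c i * u i x) = 0)"
  using assms
proof (induction X arbitrary: I u rule: finite_induct)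
  case empty
  then have "I \<noteq> {}" by auto
  then show ?case by (intro exI[of _ "\<lambda>_. 1"]) auto
next
  case (insert x X)
  show ?case
  proof (cases "\<forall>i\<in>I. u i x = 0")
    case True
    obtain c where "\<exists>i\<in>I. c i \<noteq> 0" "\<forall>y\<in>X. (\<Sum>i\<in>I. c i * u i y) = 0"
      using insert.IH[of I u] insert.prems insert.hyps by fastforce
    then show ?thesis using True by (intro exI[of _ c]) auto
  next
    case False
    then obtain k where k: "k \<in> I" "u k x \<noteq> 0" by auto
    define u' where "u' i y = u i y - u i x / u k x * u k y" for i y
    have "card X < card (I - {k})" using insert k by auto
    then obtain c where c: "\<exists>i\<in>I - {k}. c i \<noteq> 0" "\<forall>y\<in>X. (\<Sum>i\<in>I - {k}. c i * u' i y) = 0"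
      using insert.IH[of "I - {k}" u'] insert.prems by auto
    \<comment> \<open>The coefficient at the pivot accounts for the multiples of \<open>u k\<close>
      subtracted in \<open>u'\<close>.\<close>
    define d where "d i = (if i = k then - (\<Sum>j\<in>I - {k}. c j * u j x / u k x) else c i)" for i
    have eq: "(\<Sum>i\<in>I. d i * u i y) = (\<Sum>i\<in>I - {k}. c i * u' i y)" for y
    proof -
      have "(\<Sum>i\<in>I. d i * u i y) = d k * u k y + (\<Sum>i\<in>I - {k}. d i * u i y)"
        using insert.prems k by (simp add: sum.remove)
      also have "(\<Sum>i\<in>I - {k}. d i * u i y) = (\<Sum>i\<in>I - {k}. c i * u i y)"
        by (intro sum.cong) (auto simp: d_def)
      also have "d k * u k y = - (\<Sum>i\<in>I - {k}. c i * (u i x / u k x * u k y))"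
        by (simp add: d_def sum_distrib_right mult.assoc)
      finally show ?thesis
        by (simp add: u'_def right_diff_distrib sum_subtractf)
    qed
    have "u' i x = 0" for i using k by (simp add: u'_def)
    then have "\<forall>y\<in>insert x X. (\<Sum>i\<in>I. d i * u i y) = 0"
      using c(2) by (auto simp: eq)
    moreover have "\<exists>i\<in>I. d i \<noteq> 0" using c(1) by (auto simp: d_def)
    ultimately show ?thesis by blast
  qed
qed

section \<open>Polynomials in an operator and real eigenvalues\<close>

definition poly_op :: "(('a \<Rightarrow> real) \<Rightarrow> ('a \<Rightarrow> real)) \<Rightarrow> real poly \<Rightarrow> ('a \<Rightarrow> real) \<Rightarrow> 'a \<Rightarrow> real" where
  "poly_op A q v = (\<lambda>x. \<Sum>k\<le>degree q. coeff q k * (A ^^ k) v x)"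

lemma poly_op_altdef:
  assumes "degree q \<le> N"
  shows "poly_op A q v = (\<lambda>x. \<Sum>k\<le>N. coeff q k * (A ^^ k) v x)"
proof
  fix x
  show "poly_op A q v x = (\<Sum>k\<le>N. coeff q k * (A ^^ k) v x)"
    unfolding poly_op_def using assms
    by (intro sum.mono_neutral_left) (auto simp: coeff_eq_0)
qed

lemma poly_op_add: "poly_op A (p + q) v x = poly_op A p v x + poly_op A q v x"
proof -
  define N where "N = max (degree p) (degree q)"
  have "degree p \<le> N" "degree q \<le> N" "degree (p + q) \<le> N"
    by (auto simp: N_def degree_add_le_max)
  then show ?thesis by (simp add: poly_op_altdef algebra_simps sum.distrib)
qed

lemma poly_op_smult: "poly_op A (smult c p) v x = c * poly_op A p v x"
  using poly_op_altdef[of "smult c p" "degree p" A v]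
  by (simp add: poly_op_def sum_distrib_left mult.assoc)

lemma poly_op_closed:
  assumes "fun_subspace X W" "symmetric_op X W A" "v \<in> W"
  shows "poly_op A p v \<in> W"
  unfolding poly_op_def using assms symmetric_op_funpow[OF assms(2)]
  by (intro fun_subspace_sum[OF assms(1)]) auto

text \<open>Multiplication by the variable becomes application of the operator; this turns
  factorisations of polynomials into relations between vectors.\<close>

lemma poly_op_shift:
  assumes "fun_subspace X W" "symmetric_op X W A" "v \<in> W"
  shows "poly_op A (pCons 0 p) v = A (poly_op A p v)"
proof -
  have "poly_op A (pCons 0 p) v = (\<lambda>x. \<Sum>k\<le>Suc (degree p). coeff (pCons 0 p) k * (A ^^ k) v x)"
    by (intro poly_op_altdef) (simp add: degree_pCons_le)
  also have "\<dots> = (\<lambda>x. \<Sum>k\<le>degree p. coeff p k * A ((A ^^ k) v) x)"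
    by (simp add: sum.atMost_Suc_shift del: sum.atMost_Suc)
  also have "\<dots> = A (poly_op A p v)"
    unfolding poly_op_def
    using assms symmetric_op_funpow[OF assms(2)] by (subst symmetric_op_sum[OF assms(1,2)]) auto
  finally show ?thesis .
qed

definition cpoly :: "real poly \<Rightarrow> complex \<Rightarrow> complex" where
  "cpoly q z = poly (map_poly complex_of_real q) z"

lemma cpoly_pCons [simp]: "cpoly (pCons a p) z = of_real a + z * cpoly p z"
  by (simp add: cpoly_def map_poly_pCons)

lemma cpoly_0 [simp]: "cpoly 0 z = 0"
  by (simp add: cpoly_def)

lemma cpoly_add: "cpoly (p + q) z = cpoly p z + cpoly q z"
  by (induction p q rule: poly_induct2) (auto simp: algebra_simps)

lemma cpoly_smult: "cpoly (smult c q) z = of_real c * cpoly q z"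
  by (induction q) (auto simp: algebra_simps)

lemma cpoly_mult: "cpoly (p * q) z = cpoly p z * cpoly q z"
  by (induction p) (auto simp: algebra_simps cpoly_add cpoly_smult)

lemma cpoly_of_real: "cpoly q (of_real x) = of_real (poly q x)"
  by (induction q) auto

text \<open>Split off a root \<open>z\<close> of the annihilating polynomial and let
  \<open>u\<close> be the cofactor applied to \<open>v\<close>. If \<open>u\<close> is zero, the
  cofactor annihilates \<open>v\<close> and has smaller degree. Otherwise \<open>u\<close> is an
  eigenvector when \<open>z\<close> is real; a nonreal \<open>z\<close> forces \<open>u\<close> to
  be zero by symmetry of \<open>A\<close>.\<close>

lemma symmetric_op_eigenvector_of_poly:
  assumes W: "fun_subspace X W" "symmetric_op X W A" "finite X"
    and "v \<in> W" "v \<noteq> (\<lambda>_. 0)" "q \<noteq> 0" "poly_op A q v = (\<lambda>_. 0)"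
  shows "\<exists>u\<in>W. u \<noteq> (\<lambda>_. 0) \<and> (\<exists>a. A u = (\<lambda>x. a * u x))"
  using assms(4-)
proof (induction "degree q" arbitrary: q rule: less_induct)
  case less
  note zero = fun_subspace_eq_0_iff[OF W(1,3)]
  show ?case
  proof (cases "degree q = 0")
    case True
    then obtain c where c: "q = [:c:]" by (metis degree_eq_zeroE)
    then have "c \<noteq> 0" using less.prems by auto
    then have "v x = 0" for x
      using fun_cong[OF less.prems(4), of x] by (simp add: c poly_op_def)
    then show ?thesis using less.prems(2) by auto
  next
    case False
    then have "\<not> constant (poly (map_poly complex_of_real q))"
      by (simp add: constant_degree degree_map_poly)
    then obtain z where z: "cpoly q z = 0"
      using fundamental_theorem_of_algebra by (auto simp: cpoly_def)
    show ?thesis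
    proof (cases "Im z = 0")
      case True
      then have "z = of_real (Re z)" by (simp add: complex_eq_iff)
      then have "complex_of_real (poly q (Re z)) = 0"
        using z by (metis cpoly_of_real)
      then have "poly q (Re z) = 0" by simp
      then obtain e where e: "q = [:- Re z, 1:] * e" by (auto simp: poly_eq_0_iff_dvd)
      have "e \<noteq> 0" using e less.prems by auto
      then have deg: "degree e < degree q"
        by (subst e, subst degree_mult_eq) auto
      define u where "u = poly_op A e v"
      show ?thesis
      proof (cases "u = (\<lambda>_. 0)")
        case True
        then show ?thesis using less.hyps[OF deg] less.prems \<open>e \<noteq> 0\<close> by (auto simp: u_def)
      next
        case False
        have "u \<in> W" using poly_op_closed[OF W(1,2)] less.prems by (simp add: u_def)
        have "A u = (\<lambda>x. Re z * u x)"
        proof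
          fix x
          have "q = smult (- Re z) e + pCons 0 e" by (simp add: e)
          then have "0 = - Re z * u x + A u x"
            using fun_cong[OF less.prems(4), of x] poly_op_shift[OF W(1,2) less.prems(1), of e]
            by (simp add: poly_op_add poly_op_smult u_def flip: smult_minus_left)
          then show "A u x = Re z * u x" by simp
        qed
        then show ?thesis using False \<open>u \<in> W\<close> by blast
      qed
    next
      case im: False
      \<comment> \<open>The real quadratic whose roots are \<open>z\<close> and its
        conjugate.\<close>
      define d where "d = [:(cmod z)\<^sup>2, - 2 * Re z, 1:]"
      have dz: "cpoly d z = 0"
        using cmod_power2[of z]
        by (simp add: d_def complex_eq_iff algebra_simps) (simp add: power2_eq_square)
      define r where "r = q mod d"
      have "degree r < 2"
        using degree_mod_less'[of d q] by (cases "r = 0") (auto simp: r_def d_def)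
      define r0 r1 where "r0 = coeff r 0" and "r1 = coeff r 1"
      have r: "r = [:r0, r1:]"
        using \<open>degree r < 2\<close>
        by (intro poly_eqI) (auto simp: r0_def r1_def coeff_pCons coeff_eq_0 split: nat.split)
      have "q = d * (q div d) + r" by (simp add: r_def)
      then have "cpoly q z = cpoly d z * cpoly (q div d) z + cpoly r z"
        by (metis cpoly_mult cpoly_add)
      then have "cpoly r z = 0" using z dz by simp
      \<comment> \<open>A real polynomial of degree at most one with a nonreal root
        vanishes.\<close>
      then have "r = 0" using im by (auto simp: r complex_eq_iff)
      define e where "e = q div d"
      have e: "q = d * e" using \<open>q = d * (q div d) + r\<close> \<open>r = 0\<close> by (simp add: e_def)
      have "e \<noteq> 0" "d \<noteq> 0" using e less.prems by auto
      then have deg: "degree e < degree q"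
        by (subst e, subst degree_mult_eq) (auto simp: d_def)
      define u where "u = poly_op A e v"
      have "u = (\<lambda>_. 0)"
      proof -
        have uW: "u \<in> W" using poly_op_closed[OF W(1,2)] less.prems by (simp add: u_def)
        have eq: "A (A u) x - 2 * Re z * A u x + (cmod z)\<^sup>2 * u x = 0" for x
        proof -
          note shift = poly_op_shift[OF W(1,2) less.prems(1)]
          have "q = smult ((cmod z)\<^sup>2) e + pCons 0 (smult (- 2 * Re z) e + pCons 0 e)"
            unfolding e d_def by simp
          then have "poly_op A q v x =
              (cmod z)\<^sup>2 * u x + poly_op A (pCons 0 (smult (- 2 * Re z) e + pCons 0 e)) v x"
            by (simp only: poly_op_add poly_op_smult u_def)
          also have "poly_op A (pCons 0 (smult (- 2 * Re z) e + pCons 0 e)) v =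
              A (\<lambda>x. (- 2 * Re z) * u x + 1 * A u x)"
            unfolding shift
            by (rule arg_cong[of _ _ A])
              (simp only: fun_eq_iff poly_op_add poly_op_smult u_def shift mult_1 simp_thms)
          also have "\<dots> = (\<lambda>x. (- 2 * Re z) * A u x + 1 * A (A u) x)"
            by (intro symmetric_op_lin[OF W(2)] symmetric_op_closed[OF W(2)] uW)
          finally show ?thesis using less.prems(4) by simp
        qed
        define w where "w = (\<lambda>x. 1 * A u x + (- Re z) * u x)"
        have AuW: "A u \<in> W" "A (A u) \<in> W" using uW symmetric_op_closed[OF W(2)] by auto
        \<comment> \<open>Completing the square: \<open>d\<close> is the square of
          \<open>x - Re z\<close> plus the square of \<open>Im z\<close>. Both terms on the left are
          nonnegative.\<close>
        have "inner_on X w w + (Im z)\<^sup>2 * inner_on X u u =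
           inner_on X (A u) (A u) - 2 * Re z * inner_on X (A u) u + (cmod z)\<^sup>2 * inner_on X u u"
          unfolding w_def inner_on_lin_left inner_on_lin_right
          unfolding cmod_power2
          by (simp add: inner_on_commute[of X u "A u"] algebra_simps power2_eq_square)
        also have "inner_on X (A u) (A u) = inner_on X (A (A u)) u"
          using symmetric_op_inner[OF W(2)] AuW uW by metis
        also have "inner_on X (A (A u)) u - 2 * Re z * inner_on X (A u) u + (cmod z)\<^sup>2 * inner_on X u u
          = inner_on X (\<lambda>x. A (A u) x - 2 * Re z * A u x + (cmod z)\<^sup>2 * u x) u"
          by (simp add: inner_on_def sum.distrib sum_subtractf sum_distrib_left algebra_simps)
        also have "\<dots> = 0" by (simp add: eq inner_on_def)
        finally have "(Im z)\<^sup>2 * inner_on X u u \<le> 0"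
          using inner_on_self_nonneg[of X w] by simp
        moreover have "(Im z)\<^sup>2 > 0" using im by simp
        ultimately have "inner_on X u u = 0"
          using inner_on_self_nonneg[of X u] by (simp add: mult_le_0_iff)
        then show ?thesis using zero[OF uW] by simp
      qed
      then show ?thesis using less.hyps[OF deg] less.prems \<open>e \<noteq> 0\<close> by (auto simp: u_def)
    qed
  qed
qed

text \<open>The \<open>card X + 1\<close> vectors \<open>v\<close>, \<open>A v\<close>,
  \<open>A (A v)\<close> and so on are linearly dependent, which yields an annihilating
  polynomial.\<close>

lemma symmetric_op_eigenvector:
  assumes W: "fun_subspace X W" "symmetric_op X W A" "finite X" and v: "v \<in> W" "v \<noteq> (\<lambda>_. 0)"
  shows "\<exists>u\<in>W. u \<noteq> (\<lambda>_. 0) \<and> (\<exists>a. A u = (\<lambda>x. a * u x))"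
proof -
  obtain c where c: "\<exists>i\<in>{..card X}. c i \<noteq> 0" "\<forall>x\<in>X. (\<Sum>i\<in>{..card X}. c i * (A ^^ i) v x) = 0"
    using linear_dependence[of X "{..card X}" "\<lambda>i. (A ^^ i) v"] W(3) by auto
  define q where "q = (\<Sum>i\<le>card X. monom (c i) i)"
  have cq: "coeff q i = (if i \<le> card X then c i else 0)" for i
    by (simp add: q_def coeff_sum if_distrib cong: if_cong)
  have "degree q \<le> card X" by (intro degree_le) (auto simp: cq)
  then have "poly_op A q v = (\<lambda>x. \<Sum>i\<le>card X. c i * (A ^^ i) v x)"
    by (simp add: poly_op_altdef cq)
  also have "\<dots> = (\<lambda>_. 0)"
  proof
    fix x
    show "(\<Sum>i\<le>card X. c i * (A ^^ i) v x) = 0"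
    proof (cases "x \<in> X")
      case False
      then have "(A ^^ i) v x = 0" for i
        using symmetric_op_funpow[OF W(2) v(1)] W(1) by (auto simp: fun_subspace_def)
      then show ?thesis by simp
    qed (use c in auto)
  qed
  finally have "poly_op A q v = (\<lambda>_. 0)" .
  moreover have "q \<noteq> 0" using c(1) cq by (metis atMost_iff coeff_0)
  ultimately show ?thesis using symmetric_op_eigenvector_of_poly[OF W v] by blast
qed

lemma fun_subspace_eigenspace:
  assumes "fun_subspace X W" "symmetric_op X W A"
  shows "fun_subspace X {v \<in> W. A v = (\<lambda>x. a * v x)}"
  using assms symmetric_op_zero[OF assms]
  by (auto simp: fun_subspace_def symmetric_op_def algebra_simps)

text \<open>An eigenspace of the first operator is invariant under the others, because they commute
  with it; the search continues inside this eigenspace.\<close>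

lemma joint_eigenvector:
  assumes "finite X" "fun_subspace X W" "v \<in> W" "v \<noteq> (\<lambda>_. 0)"
    and "\<And>A. A \<in> set As \<Longrightarrow> symmetric_op X W A"
    and "\<And>A B f. A \<in> set As \<Longrightarrow> B \<in> set As \<Longrightarrow> f \<in> W \<Longrightarrow> A (B f) = B (A f)"
  shows "\<exists>u\<in>W. u \<noteq> (\<lambda>_. 0) \<and> (\<forall>A\<in>set As. \<exists>a. A u = (\<lambda>x. a * u x))"
  using assms(2-)
proof (induction As arbitrary: W v)
  case Nil
  then show ?case by auto
next
  case (Cons A As)
  have A: "symmetric_op X W A" using Cons.prems by auto
  obtain u a where u: "u \<in> W" "u \<noteq> (\<lambda>_. 0)" "A u = (\<lambda>x. a * u x)"
    using symmetric_op_eigenvector[OF Cons.prems(1) A assms(1) Cons.prems(2,3)] by blast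
  define W' where "W' = {v \<in> W. A v = (\<lambda>x. a * v x)}"
  have W': "fun_subspace X W'"
    unfolding W'_def by (intro fun_subspace_eigenspace Cons.prems A)
  have "symmetric_op X W' B" if "B \<in> set As" for B
  proof -
    have B: "symmetric_op X W B" using that Cons.prems by auto
    have "B f \<in> W'" if "f \<in> W'" for f
    proof -
      have "A (B f) = B (A f)" using that \<open>B \<in> set As\<close> Cons.prems(5)[of A B f] by (auto simp: W'_def)
      also have "\<dots> = (\<lambda>x. a * B f x)"
        using that symmetric_op_scale[OF B, of f a] by (simp add: W'_def)
      finally show ?thesis using that B by (auto simp: W'_def symmetric_op_def)
    qed
    then show ?thesis using B by (auto simp: symmetric_op_def W'_def)
  qed
  moreover have "B (C f) = C (B f)" if "B \<in> set As" "C \<in> set As" "f \<in> W'" for B C f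
    using that Cons.prems(5) by (auto simp: W'_def)
  moreover have "u \<in> W'" using u by (simp add: W'_def)
  ultimately obtain w where "w \<in> W'" "w \<noteq> (\<lambda>_. 0)" "\<forall>A\<in>set As. \<exists>a. A w = (\<lambda>x. a * w x)"
    using Cons.IH[OF W' _ u(2)] by blast
  then show ?case by (auto simp: W'_def)
qed

section \<open>Orthonormal joint eigenbases\<close>

definition orthonormal_on :: "'a set \<Rightarrow> ('a \<Rightarrow> real) set \<Rightarrow> bool" where
  "orthonormal_on X B \<longleftrightarrow> (\<forall>b\<in>B. \<forall>c\<in>B. inner_on X b c = (if b = c then 1 else 0))"

lemma inner_on_sum_right:
  "inner_on X f (\<lambda>x. \<Sum>i\<in>I. c i * g i x) = (\<Sum>i\<in>I. c i * inner_on X f (g i))"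
  by (simp add: inner_on_def sum_distrib_left mult.left_commute sum.swap[of _ I])

lemma orthonormal_on_card_le:
  assumes "finite X" "finite B" "orthonormal_on X B"
  shows "card B \<le> card X"
proof (rule ccontr)
  assume "\<not> card B \<le> card X"
  then obtain c where c: "\<exists>b\<in>B. c b \<noteq> 0" "\<forall>x\<in>X. (\<Sum>b\<in>B. c b * b x) = 0"
    using linear_dependence[OF assms(1,2), of "\<lambda>b. b"] by auto
  then obtain b where b: "b \<in> B" "c b \<noteq> 0" by auto
  have "0 = inner_on X b (\<lambda>x. \<Sum>b\<in>B. c b * b x)"
    using c(2) by (simp add: inner_on_def)
  also have "\<dots> = (\<Sum>b'\<in>B. c b' * inner_on X b b')" by (rule inner_on_sum_right)
  also have "\<dots> = (\<Sum>b'\<in>B. if b = b' then c b' else 0)"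
    using assms(3) b by (intro sum.cong) (auto simp: orthonormal_on_def)
  also have "\<dots> = c b" using assms(2) b by simp
  finally show False using b by simp
qed

text \<open>An orthonormal set of joint eigenvectors of maximal size spans \<open>W\<close>: by
  symmetry its orthogonal complement is invariant, and a nonzero complement would supply one more
  joint eigenvector.\<close>

theorem joint_eigenbasis:
  assumes X: "finite X" and W: "fun_subspace X W"
    and As: "\<And>A. A \<in> set As \<Longrightarrow> symmetric_op X W A"
    and comm: "\<And>A B f. A \<in> set As \<Longrightarrow> B \<in> set As \<Longrightarrow> f \<in> W \<Longrightarrow> A (B f) = B (A f)"
  obtains B where "finite B" "B \<subseteq> W" "orthonormal_on X B"
    "\<And>b A. b \<in> B \<Longrightarrow> A \<in> set As \<Longrightarrow> \<exists>a. A b = (\<lambda>x. a * b x)"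
    "\<And>w. w \<in> W \<Longrightarrow> w = (\<lambda>x. \<Sum>b\<in>B. inner_on X b w * b x)"
proof -
  define P where "P B \<longleftrightarrow> finite B \<and> B \<subseteq> W \<and> orthonormal_on X B \<and>
      (\<forall>b\<in>B. \<forall>A\<in>set As. \<exists>a. A b = (\<lambda>x. a * b x))" for B
  have P0: "P {}" by (simp add: P_def orthonormal_on_def)
  have "\<forall>B. P B \<longrightarrow> card B \<le> card X" using orthonormal_on_card_le[OF X] by (simp add: P_def)
  then obtain B where B: "P B" "\<And>C. P C \<Longrightarrow> card C \<le> card B"
    using ex_has_greatest_nat[of P "{}" card "Suc (card X)", OF P0] by (auto simp: less_Suc_eq_le)
  have "finite B" using B by (simp add: P_def)
  define W' where "W' = {w \<in> W. \<forall>b\<in>B. inner_on X b w = 0}"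
  have W': "fun_subspace X W'"
    using W by (auto simp: fun_subspace_def W'_def inner_on_lin_right) (simp add: inner_on_def)
  have W'0: "w = (\<lambda>_. 0)" if "w \<in> W'" for w
  proof (rule ccontr)
    assume w0: "w \<noteq> (\<lambda>_. 0)"
    have "symmetric_op X W' A" if A: "A \<in> set As" for A
    proof -
      have "A f \<in> W'" if "f \<in> W'" for f
      proof -
        have "inner_on X b (A f) = 0" if b: "b \<in> B" for b
        proof -
          obtain a where a: "A b = (\<lambda>x. a * b x)" using B(1) A b unfolding P_def by blast
          have "inner_on X b (A f) = inner_on X (A b) f"
            using symmetric_op_inner[OF As[OF A]] b \<open>f \<in> W'\<close> B(1) by (auto simp: P_def W'_def)
          also have "\<dots> = a * inner_on X b f"
            using inner_on_lin_left[of X a b 0 b f] by (simp add: a)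
          finally show ?thesis using b \<open>f \<in> W'\<close> by (simp add: W'_def)
        qed
        then show ?thesis using that As[OF A] by (auto simp: W'_def symmetric_op_def)
      qed
      then show ?thesis using As[OF A] by (auto simp: symmetric_op_def W'_def)
    qed
    moreover have "A (C f) = C (A f)" if "A \<in> set As" "C \<in> set As" "f \<in> W'" for A C f
      using that comm by (auto simp: W'_def)
    ultimately obtain u where u: "u \<in> W'" "u \<noteq> (\<lambda>_. 0)" "\<forall>A\<in>set As. \<exists>a. A u = (\<lambda>x. a * u x)"
      using joint_eigenvector[OF X W' \<open>w \<in> W'\<close> w0, of As] by blast
    define s where "s = inner_on X u u"
    have "s > 0"
      using fun_subspace_eq_0_iff[OF W' X u(1)] u(2) inner_on_self_nonneg[of X u] by (simp add: s_def)
    define e where "e = (\<lambda>x. (1 / sqrt s) * u x)"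
    have eW': "e \<in> W'" unfolding e_def by (intro fun_subspace_scale[OF W'] u)
    have scale: "inner_on X f (\<lambda>x. c * g x) = c * inner_on X f g" for c f g
      using inner_on_lin_right[of X f c g 0 g] by simp
    have ee: "inner_on X e e = 1"
      using \<open>s > 0\<close> unfolding e_def scale
      by (subst inner_on_commute, subst scale) (simp add: s_def[symmetric])
    have eB: "e \<notin> B" using eW' ee by (auto simp: W'_def)
    have "\<exists>a. A e = (\<lambda>x. a * e x)" if A: "A \<in> set As" for A
    proof -
      obtain a where a: "A u = (\<lambda>x. a * u x)" using u(3) A by auto
      have "A e = (\<lambda>x. (1 / sqrt s) * A u x)"
        unfolding e_def using u(1) by (intro symmetric_op_scale[OF As[OF A]]) (simp add: W'_def)
      also have "\<dots> = (\<lambda>x. a * e x)" by (simp add: a e_def)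
      finally show ?thesis by blast
    qed
    moreover have "inner_on X b e = 0" "inner_on X e b = 0" if "b \<in> B" for b
      using that eW' inner_on_commute[of X e b] by (auto simp: W'_def)
    then have "orthonormal_on X (insert e B)"
      using B(1) ee unfolding P_def orthonormal_on_def by auto
    moreover have "e \<in> W" using eW' by (simp add: W'_def)
    ultimately have "P (insert e B)"
      using B(1) unfolding P_def by blast
    then show False using B(2)[of "insert e B"] eB \<open>finite B\<close> by simp
  qed
  show thesis
  proof (rule that)
    show "w = (\<lambda>x. \<Sum>b\<in>B. inner_on X b w * b x)" if "w \<in> W" for w
    proof -
      define r where "r = (\<lambda>x. 1 * w x + (- 1) * (\<Sum>b\<in>B. inner_on X b w * b x))"
      have "r \<in> W'"
      proof -
        have "r \<in> W" unfolding r_def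
          using B(1) that by (intro fun_subspace_lin[OF W] fun_subspace_sum[OF W]) (auto simp: P_def)
        moreover have "inner_on X b r = 0" if b: "b \<in> B" for b
        proof -
          have "(\<Sum>b'\<in>B. inner_on X b' w * inner_on X b b') =
              (\<Sum>b'\<in>B. if b = b' then inner_on X b' w else 0)"
            using B(1) b by (intro sum.cong) (auto simp: P_def orthonormal_on_def)
          also have "\<dots> = inner_on X b w" using b \<open>finite B\<close> by simp
          finally show ?thesis
            unfolding r_def inner_on_lin_right inner_on_sum_right by simp
        qed
        ultimately show ?thesis by (simp add: W'_def)
      qed
      then have "r x = 0" for x using W'0[of r] by simp
      then show ?thesis by (auto simp: r_def fun_eq_iff)
    qed
  qed (use B(1) in \<open>auto simp: P_def\<close>)
qed

section \<open>Cycle counts and Jucys-Murphy elements\<close>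

abbreviation exch :: "'a \<Rightarrow> 'a \<Rightarrow> 'a \<Rightarrow> 'a" where
  "exch \<equiv> Transposition.transpose"

lemma cyclic_sets_eq_orbits:
  assumes "p permutes S" "finite S"
  shows "{C. C \<subseteq> S \<and> cyclic_on p C} = orbit p ` S"
proof (intro equalityI subsetI)
  fix C assume "C \<in> {C. C \<subseteq> S \<and> cyclic_on p C}"
  then obtain s where "s \<in> C" "C = orbit p s" "C \<subseteq> S" by (auto simp: cyclic_on_def)
  then show "C \<in> orbit p ` S" by auto
next
  fix C assume "C \<in> orbit p ` S"
  then obtain s where s: "s \<in> S" "C = orbit p s" by auto
  have "cyclic_on p C" using s cyclic_on_orbit[OF assms] by simp
  moreover have "C \<subseteq> S" using s permutes_orbit_subset[OF assms(1)] by auto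
  ultimately show "C \<in> {C. C \<subseteq> S \<and> cyclic_on p C}" by simp
qed

lemma num_cycles_eq_card_orbits:
  assumes "p permutes S" "finite S"
  shows "num_cycles S p = card (orbit p ` S)"
  unfolding num_cycles_def cyclic_sets_eq_orbits[OF assms] ..

text \<open>Composition with \<open>exch a b\<close> inserts the fixed point \<open>a\<close>
  immediately before \<open>b\<close> in the cycle of \<open>b\<close> and leaves the other cycles
  alone.\<close>

lemma orbit_exch_comp:
  assumes p: "p permutes S" and a: "a \<notin> S" and b: "b \<in> S" and x: "x \<in> S"
  shows "orbit (exch a b \<circ> p) x = orbit p x \<union> (if b \<in> orbit p x then {a} else {})"
    (is "_ = ?R")
proof -
  define f where "f = exch a b \<circ> p"
  have fa: "f a = b" using permutes_not_in[OF p a] by (simp add: f_def)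
  have fx: "f y = (if p y = b then a else p y)" if "y \<in> S" for y
  proof -
    have "p y \<noteq> a" using permutes_in_image[OF p, of y] that a by auto
    then show ?thesis by (simp add: f_def)
  qed
  have sub: "orbit p x \<subseteq> S" by (rule permutes_orbit_subset[OF p x])
  have "z \<in> ?R" if "z \<in> orbit f x" for z
    using that
  proof (induction rule: orbit.induct)
    case base
    then show ?case using fx[OF x] orbit.base[of p x] by auto
  next
    case (step y)
    show ?case
    proof (cases "y = a")
      case True
      then show ?thesis using step fa sub a by (auto split: if_splits)
    next
      case False
      then have y: "y \<in> orbit p x" using step by (auto split: if_splits)
      then have "f y = (if p y = b then a else p y)" using fx[of y] sub by auto
      then show ?thesis using orbit.step[OF y] by auto
    qed
  qed
  moreover have sup: "z \<in> orbit f x \<and> (z = b \<longrightarrow> a \<in> orbit f x)" if "z \<in> orbit p x" for z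
    using that
  proof (induction rule: orbit.induct)
    case base
    then show ?case
      using fx[OF x] orbit.base[of f x] orbit.step[of a f x] fa by (auto split: if_splits)
  next
    case (step y)
    then have "y \<in> S" using sub by auto
    then show ?case
      using fx[of y] orbit.step[of y f x] orbit.step[of a f x] step fa by (auto split: if_splits)
  qed
  then have "?R \<subseteq> orbit f x" by auto
  ultimately have "orbit f x = ?R" by blast
  then show ?thesis by (simp only: f_def)
qed

lemma num_cycles_insert_fixed:
  assumes "p permutes S" "finite S" "a \<notin> S"
  shows "num_cycles (insert a S) p = Suc (num_cycles S p)"
proof -
  have "orbit p a = {a}" using permutes_not_in[OF assms(1,3)] by (simp add: orbit_eq_singleton_iff)
  moreover have "{a} \<notin> orbit p ` S" using permutes_orbit_subset[OF assms(1)] assms(3) by blast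
  moreover have "p permutes insert a S" using assms(1) by (rule permutes_subset) auto
  ultimately show ?thesis
    using assms by (simp add: num_cycles_eq_card_orbits)
qed

text \<open>Since \<open>a\<close> joins the orbit of \<open>b\<close>, every new orbit meets
  \<open>S\<close>, and its trace on \<open>S\<close> is an orbit of \<open>p\<close>.\<close>

lemma num_cycles_insert_exch:
  assumes p: "p permutes S" and S: "finite S" and a: "a \<notin> S" and b: "b \<in> S"
  shows "num_cycles (insert a S) (exch a b \<circ> p) = num_cycles S p"
proof -
  let ?f = "exch a b \<circ> p"
  have f: "?f permutes insert a S"
    using p b by (intro permutes_compose[of p] permutes_swap_id) (auto elim: permutes_subset)
  define \<phi> where "\<phi> C = C \<union> (if b \<in> C then {a} else {})" for C
  have perm: "permutation p" "permutation ?f"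
    using p f S permutation_permutes by blast+
  have "b \<in> orbit ?f a" using orbit.base[of ?f a] permutes_not_in[OF p a] by simp
  then have "orbit ?f a = orbit ?f b"
    using orbit_cyclic_eq3[OF cyclic_on_orbit[OF f]] S
      permutation_self_in_orbit[OF perm(2)] by (metis finite_insert)
  then have "orbit ?f ` insert a S = orbit ?f ` S" using b by auto
  also have "\<dots> = \<phi> ` (orbit p ` S)"
    unfolding image_image \<phi>_def
    by (intro image_cong refl orbit_exch_comp[OF p a b])
  finally have "num_cycles (insert a S) ?f = card (\<phi> ` (orbit p ` S))"
    using f S by (simp add: num_cycles_eq_card_orbits)
  also have "\<dots> = card (orbit p ` S)"
  proof (rule card_image, rule inj_onI)
    fix C D assume "C \<in> orbit p ` S" "D \<in> orbit p ` S" "\<phi> C = \<phi> D"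
    moreover from this have "a \<notin> C" "a \<notin> D" using permutes_orbit_subset[OF p] a by blast+
    ultimately show "C = D" by (auto simp: \<phi>_def split: if_splits)
  qed
  finally show ?thesis using p S by (simp add: num_cycles_eq_card_orbits)
qed

type_synonym perm_fun = "(nat \<Rightarrow> nat) \<Rightarrow> real"

text \<open>The element multiplies the argument from the left, so the operator commutes with right
  translations. \<open>JM 1\<close> is the zero operator.\<close>

definition JM :: "nat \<Rightarrow> perm_fun \<Rightarrow> perm_fun" where
  "JM i f = (\<lambda>x. \<Sum>j\<in>{1..<i}. f (exch j i \<circ> x))"

text \<open>A permutation of \<open>{1..Suc m}\<close> is either \<open>q\<close> or
  \<open>exch (Suc m) b \<circ> q\<close> with \<open>q\<close> permuting \<open>{1..m}\<close>. The
  first kind has one more cycle than \<open>q\<close> on \<open>{1..m}\<close> and gives the factor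
  \<open>t\<close>; the second kind has equally many, and its sum over \<open>b\<close> is
  \<open>JM (Suc m)\<close>.\<close>

lemma JM_generating_function:
  assumes "\<And>i. i \<in> {1..m} \<Longrightarrow> JM i v = (\<lambda>x. a i * v x)"
  shows "(\<Sum>y | y permutes {1..m}. t ^ num_cycles {1..m} y * v (y \<circ> x)) = (\<Prod>i=1..m. t + a i) * v x"
  using assms
proof (induction m)
  case 0
  have "num_cycles {} y = 0" for y :: "nat \<Rightarrow> nat"
    by (simp add: num_cycles_def cyclic_on_def)
  then show ?case by simp
next
  case (Suc m)
  let ?P = "{y. y permutes {1..m}}"
  have ins: "{1..Suc m} = insert (Suc m) {1..m}" by auto
  have ev: "JM (Suc m) v = (\<lambda>x. a (Suc m) * v x)" using Suc.prems by simp
  have "(\<Sum>y | y permutes {1..Suc m}. t ^ num_cycles {1..Suc m} y * v (y \<circ> x)) =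
     (\<Sum>b\<in>insert (Suc m) {1..m}. \<Sum>q\<in>?P. t ^ num_cycles (insert (Suc m) {1..m}) (exch (Suc m) b \<circ> q)
        * v (exch (Suc m) b \<circ> q \<circ> x))"
    unfolding ins by (intro sum_over_permutations_insert) auto
  also have "\<dots> = (\<Sum>q\<in>?P. t * t ^ num_cycles {1..m} q * v (q \<circ> x)) +
     (\<Sum>b\<in>{1..m}. \<Sum>q\<in>?P. t ^ num_cycles {1..m} q * v (exch (Suc m) b \<circ> q \<circ> x))"
    by (subst sum.insert) (auto simp: num_cycles_insert_fixed num_cycles_insert_exch)
  also have "(\<Sum>b\<in>{1..m}. \<Sum>q\<in>?P. t ^ num_cycles {1..m} q * v (exch (Suc m) b \<circ> q \<circ> x))
     = (\<Sum>q\<in>?P. t ^ num_cycles {1..m} q * JM (Suc m) v (q \<circ> x))"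
    by (subst sum.swap)
      (simp add: JM_def sum_distrib_left comp_assoc transpose_commute atLeastLessThanSuc_atLeastAtMost)
  also have "(\<Sum>q\<in>?P. t * t ^ num_cycles {1..m} q * v (q \<circ> x)) +
       (\<Sum>q\<in>?P. t ^ num_cycles {1..m} q * JM (Suc m) v (q \<circ> x)) =
     (t + a (Suc m)) * (\<Sum>q\<in>?P. t ^ num_cycles {1..m} q * v (q \<circ> x))"
    by (simp add: ev sum_distrib_left sum.distrib algebra_simps)
  also have "\<dots> = (\<Prod>i=1..Suc m. t + a i) * v x"
    using Suc.IH Suc.prems by (subst Suc.IH) (simp_all add: mult_ac)
  finally show ?case .
qed

section \<open>Content vectors\<close>

text \<open>The local conditions satisfied by the set of all joint eigenvalue lists. Isolating them
  as closure properties of a set of lists separates the combinatorics of contents from the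
  operators.\<close>

definition okounkov_vershik :: "real list set \<Rightarrow> bool" where
  "okounkov_vershik S \<longleftrightarrow>
     (\<forall>b ys. b # ys \<in> S \<longrightarrow> b = 0) \<and>
     (\<forall>xs b c zs. xs @ b # c # zs \<in> S \<longrightarrow> b \<noteq> c \<and> (c \<noteq> b + 1 \<longrightarrow> c \<noteq> b - 1 \<longrightarrow> xs @ c # b # zs \<in> S)) \<and>
     (\<forall>xs b e zs. \<bar>e\<bar> = 1 \<longrightarrow> xs @ b # (b + e) # b # zs \<notin> S)"

text \<open>A \<open>b\<close> between any two occurrences of \<open>c\<close> gives the bound with
  an excess of one. For \<open>k = 0\<close> a further \<open>b\<close> in front of the first
  \<open>c\<close> removes the excess.\<close>

lemma count_list_interlace:
  assumes "\<And>p q r. xs = p @ c # q @ c # r \<Longrightarrow> b \<in> set q"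
    and "\<And>p r. k = 0 \<Longrightarrow> xs = p @ c # r \<Longrightarrow> c \<notin> set p \<Longrightarrow> b \<in> set p"
  shows "count_list xs c \<le> count_list xs b + k"
  using assms
proof (induction "length xs" arbitrary: xs rule: less_induct)
  case less
  show ?case
  proof (cases "c \<in> set xs")
    case False
    then show ?thesis by (simp add: count_list_0_iff)
  next
    case True
    then obtain p r where xs: "xs = p @ c # r" "c \<notin> set r" by (meson split_list_last)
    then have r0: "count_list r c = 0" by (simp add: count_list_0_iff)
    show ?thesis
    proof (cases "c \<in> set p")
      case False
      then have "count_list xs c = 1" using xs r0 by (simp add: count_list_0_iff)
      moreover have "count_list xs b \<ge> 1" if "k = 0"
      proof -
        have "b \<in> set p" using less.prems(2)[OF that xs(1)] False by auto
        then show ?thesis using xs(1)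
          by (metis One_nat_def Suc_leI Un_iff count_list_0_iff neq0_conv set_append)
      qed
      ultimately show ?thesis by (cases "k = 0") auto
    next
      case True
      then obtain p1 p2 where p: "p = p1 @ c # p2" "c \<notin> set p2" by (meson split_list_last)
      have "b \<in> set p2" using less.prems(1)[of p1 p2 r] xs p by auto
      then have b2: "count_list p2 b \<ge> 1"
        by (metis One_nat_def Suc_leI count_list_0_iff neq0_conv)
      \<comment> \<open>Cut after the last but one \<open>c\<close>: the part removed contains
        exactly one \<open>c\<close> and at least one \<open>b\<close>.\<close>
      have "count_list (p1 @ [c]) c \<le> count_list (p1 @ [c]) b + k"
      proof (rule less.hyps)
        show "length (p1 @ [c]) < length xs" using xs p by simp
        show "b \<in> set q" if "p1 @ [c] = p' @ c # q @ c # r'" for p' q r'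
          using less.prems(1)[of p' q "r' @ p2 @ c # r"] that xs p
          by (metis append.assoc append_Cons append_Nil)
        show "b \<in> set p'" if "k = 0" "p1 @ [c] = p' @ c # r'" "c \<notin> set p'" for p' r'
          using less.prems(2)[of p' "r' @ p2 @ c # r"] that xs p
          by (metis append.assoc append_Cons append_Nil)
      qed
      then show ?thesis using xs p r0 b2 by (auto simp: count_list_0_iff)
    qed
  qed
qed

context
  fixes S :: "real list set"
  assumes S: "okounkov_vershik S"
begin

lemma ov_hd: "b # ys \<in> S \<Longrightarrow> b = 0"
  using S by (auto simp: okounkov_vershik_def)

lemma ov_neq: "xs @ b # c # zs \<in> S \<Longrightarrow> b \<noteq> c"
  using S by (auto simp: okounkov_vershik_def)

lemma ov_swap: "xs @ b # c # zs \<in> S \<Longrightarrow> c \<noteq> b + 1 \<Longrightarrow> c \<noteq> b - 1 \<Longrightarrow> xs @ c # b # zs \<in> S"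
  using S by (auto simp: okounkov_vershik_def)

lemma ov_pattern: "\<bar>e\<bar> = 1 \<Longrightarrow> xs @ b # (b + e) # b # zs \<notin> S"
  using S by (auto simp: okounkov_vershik_def)

text \<open>An entry can be commuted past all entries that do not differ from it by one.\<close>

lemma ov_move_left:
  assumes "xs @ ys @ b # zs \<in> S" "b + 1 \<notin> set ys" "b - 1 \<notin> set ys"
  shows "xs @ b # ys @ zs \<in> S"
  using assms
proof (induction ys arbitrary: zs rule: rev_induct)
  case (snoc y ys)
  have "(xs @ ys) @ b # y # zs \<in> S"
    using snoc.prems ov_swap[of "xs @ ys" y b zs] by auto
  then show ?case using snoc.IH[of "y # zs"] snoc.prems by simp
qed auto

lemma ov_move_right:
  assumes "xs @ b # ys @ zs \<in> S" "b + 1 \<notin> set ys" "b - 1 \<notin> set ys"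
  shows "xs @ ys @ b # zs \<in> S"
  using assms
proof (induction ys arbitrary: xs)
  case (Cons y ys)
  have "xs @ y # b # (ys @ zs) \<in> S"
    using Cons.prems ov_swap[of xs b y "ys @ zs"] by auto
  then show ?case using Cons.IH[of "xs @ [y]"] Cons.prems by simp
qed auto

text \<open>Without a neighbour in front of it, \<open>b\<close> could be moved to the front. It
  would then be \<open>0\<close> and stand next to the old first entry, which is \<open>0\<close> as
  well.\<close>

lemma ov_adjacent_before:
  assumes "xs @ b # zs \<in> S" "xs \<noteq> []"
  shows "b + 1 \<in> set xs \<or> b - 1 \<in> set xs"
proof (rule ccontr)
  assume "\<not> ?thesis"
  then have "[] @ b # xs @ zs \<in> S" using ov_move_left[of "[]" xs b zs] assms by auto
  moreover obtain x xs' where xs: "xs = x # xs'" using assms(2) by (cases xs) auto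
  ultimately have "b = 0" "b \<noteq> x" using ov_hd[of b] ov_neq[of "[]" b x] by auto
  moreover have "x = 0" using assms(1) ov_hd[of x] by (simp add: xs)
  ultimately show False by simp
qed

text \<open>Take two occurrences of \<open>b\<close> with no \<open>b\<close> between them. If
  neither neighbour lies between, they can be made adjacent. If only \<open>b - e\<close> does, it
  occurs once, and both copies of \<open>b\<close> can be moved next to it, which produces the
  forbidden pattern \<open>b, b - e, b\<close>.\<close>

lemma ov_adjacent_between_aux:
  assumes "xs @ b # ys @ b # zs \<in> S" "\<bar>e\<bar> = 1"
  shows "b + e \<in> set ys"
  using assms
proof (induction "length ys" arbitrary: xs b ys zs e rule: less_induct)
  case less
  show ?case
  proof (cases "b \<in> set ys")
    case True
    then obtain y1 y2 where ys: "ys = y1 @ b # y2" by (auto simp: in_set_conv_decomp)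
    then show ?thesis
      using less.hyps[of y1 xs b "y2 @ b # zs" e] less.prems by auto
  next
    case False
    show ?thesis
    proof (rule ccontr)
      assume no: "b + e \<notin> set ys"
      have e: "e = 1 \<or> e = -1" using less.prems by (auto simp: abs_if split: if_splits)
      show False
      proof (cases "b - e \<in> set ys")
        case False
        then have "b + 1 \<notin> set ys" "b - 1 \<notin> set ys" using no e by auto
        then have "(xs @ [b]) @ b # ys @ zs \<in> S"
          using less.prems ov_move_left[of "xs @ [b]" ys b zs] by auto
        then show False using ov_neq[of xs b b] by auto
      next
        case True
        then obtain y1 y2 where ys: "ys = y1 @ (b - e) # y2" and y1: "b - e \<notin> set y1"
          by (meson split_list_first)
        \<comment> \<open>Two occurrences of \<open>b - e\<close> would, by induction on the gap,
          enclose \<open>b - e + e\<close>, that is \<open>b\<close>.\<close>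
        have y2: "b - e \<notin> set y2"
        proof
          assume "b - e \<in> set y2"
          then obtain y3 y4 where "y2 = y3 @ (b - e) # y4" by (auto simp: in_set_conv_decomp)
          then have "b - e + e \<in> set y3"
            using less.hyps[of y3 "xs @ b # y1" "b - e" "y4 @ b # zs" e] less.prems ys by auto
          then show False using \<open>b \<notin> set ys\<close> ys \<open>y2 = _\<close> by auto
        qed
        have "(xs @ b # y1 @ [b - e]) @ b # y2 @ zs \<in> S"
          using less.prems no e y2 ys ov_move_left[of "xs @ b # y1 @ [b - e]" y2 b zs] by auto
        then have "xs @ y1 @ b # ((b - e) # b # y2 @ zs) \<in> S"
          using no e y1 ys ov_move_right[of xs b y1 "(b - e) # b # y2 @ zs"] by auto
        then show False using ov_pattern[of "- e" "xs @ y1" b "y2 @ zs"] less.prems by auto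
      qed
    qed
  qed
qed

lemma ov_adjacent_between:
  assumes "xs @ b # ys @ b # zs \<in> S"
  shows "b + 1 \<in> set ys" "b - 1 \<in> set ys"
  using ov_adjacent_between_aux[OF assms, of 1] ov_adjacent_between_aux[OF assms, of "-1"] by auto

text \<open>The first entry is \<open>0\<close>, and each later one is a neighbour of an earlier
  one, so it extends the interval by at most one integer. This is also where integrality of the
  eigenvalues comes from.\<close>

lemma ov_prefix_interval:
  assumes "xs @ zs \<in> S" "xs \<noteq> []"
  shows "\<exists>l u :: int. l \<le> 0 \<and> 0 \<le> u \<and> set xs = real_of_int ` {l..u}"
  using assms
proof (induction xs arbitrary: zs rule: rev_induct)
  case (snoc b xs)
  show ?case
  proof (cases "xs = []")
    case True
    then have "b = 0" using snoc.prems ov_hd[of b] by auto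
    then show ?thesis using True by (intro exI[of _ 0]) auto
  next
    case False
    then obtain l u where lu: "l \<le> 0" "0 \<le> u" "set xs = real_of_int ` {l..u}"
      using snoc.IH[of "b # zs"] snoc.prems by auto
    have "b + 1 \<in> set xs \<or> b - 1 \<in> set xs"
      using ov_adjacent_before[of xs b zs] snoc.prems False by auto
    then obtain k e where k: "b = real_of_int (k + e)" "k \<in> {l..u}" "e = 1 \<or> e = -1"
    proof
      assume "b + 1 \<in> set xs"
      then obtain k where "k \<in> {l..u}" "b + 1 = real_of_int k" using lu by auto
      then show thesis using that[of k "-1"] by auto
    next
      assume "b - 1 \<in> set xs"
      then obtain k where "k \<in> {l..u}" "b - 1 = real_of_int k" using lu by auto
      then show thesis using that[of k "1"] by auto
    qed
    have "set (xs @ [b]) = real_of_int ` (insert (k + e) {l..u})" using lu k by auto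
    moreover have "insert (k + e) {l..u} = {l..u} \<or> insert (k + e) {l..u} = {l - 1..u} \<or>
        insert (k + e) {l..u} = {l..u + 1}"
      using k(2,3) by auto
    ultimately obtain l' u' where "set (xs @ [b]) = real_of_int ` {l'..u'}"
        "l' \<in> {l - 1, l}" "u' \<in> {u, u + 1}"
      by (metis insertCI)
    then show ?thesis using lu(1,2) by (intro exI[of _ l'] exI[of _ u']) auto
  qed
qed auto

text \<open>The counts behave like the diagonal lengths of a Young diagram: they decrease away from
  the main diagonal, which exceeds the diagonal of content \<open>- 1\<close> by at most
  one.\<close>

lemma ov_count:
  assumes "as \<in> S" "as \<noteq> []"
  shows "set as \<subseteq> \<int>"
    and "z \<ge> 0 \<Longrightarrow> count_list as (real_of_int (z + 1)) \<le> count_list as (real_of_int z)"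
    and "z \<le> 0 \<Longrightarrow> count_list as (real_of_int (z - 1)) \<le> count_list as (real_of_int z)"
    and "count_list as 0 \<le> count_list as (- 1) + 1"
proof -
  have interval: "\<exists>l u :: int. l \<le> 0 \<and> 0 \<le> u \<and> set p = real_of_int ` {l..u} \<and>
      (b + 1 \<in> set p \<or> b - 1 \<in> set p)"
    if "as = p @ b # r" "b \<noteq> 0" for p b r
  proof -
    have "p \<noteq> []" using assms that ov_hd[of b r] by auto
    then show ?thesis using ov_prefix_interval[of p "b # r"] ov_adjacent_before[of p b r] assms that by auto
  qed
  show "set as \<subseteq> \<int>" using ov_prefix_interval[of as "[]"] assms by auto
  show "count_list as (real_of_int (z + 1)) \<le> count_list as (real_of_int z)" if z: "z \<ge> 0"
  proof -
    have "count_list as (real_of_int (z + 1)) \<le> count_list as (real_of_int z) + 0"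
    proof (rule count_list_interlace)
      fix p q r assume "as = p @ real_of_int (z + 1) # q @ real_of_int (z + 1) # r"
      then show "real_of_int z \<in> set q" using ov_adjacent_between(2)[of p "real_of_int (z + 1)" q r] assms by auto
    next
      fix p r assume pr: "as = p @ real_of_int (z + 1) # r" "real_of_int (z + 1) \<notin> set p"
      then obtain l u where lu: "l \<le> 0" "0 \<le> u" "set p = real_of_int ` {l..u}"
          "real_of_int (z + 1) + 1 \<in> set p \<or> real_of_int (z + 1) - 1 \<in> set p"
        using interval[OF pr(1)] z by auto
      \<comment> \<open>The interval contains \<open>0\<close> and misses the positive number
        \<open>z + 1\<close>, hence also \<open>z + 2\<close>. So the neighbour of
        \<open>z + 1\<close> already present is \<open>z\<close>.\<close>
      have "z + 1 \<notin> {l..u}" using pr(2) lu(3) by (metis imageI)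
      then have "real_of_int (z + 1 + 1) \<notin> set p" using lu z by auto
      then show "real_of_int z \<in> set p" using lu(4) by simp
    qed
    then show ?thesis by simp
  qed
  show "count_list as (real_of_int (z - 1)) \<le> count_list as (real_of_int z)" if z: "z \<le> 0"
  proof -
    have "count_list as (real_of_int (z - 1)) \<le> count_list as (real_of_int z) + 0"
    proof (rule count_list_interlace)
      fix p q r assume "as = p @ real_of_int (z - 1) # q @ real_of_int (z - 1) # r"
      then show "real_of_int z \<in> set q" using ov_adjacent_between(1)[of p "real_of_int (z - 1)" q r] assms by auto
    next
      fix p r assume pr: "as = p @ real_of_int (z - 1) # r" "real_of_int (z - 1) \<notin> set p"
      then obtain l u where lu: "l \<le> 0" "0 \<le> u" "set p = real_of_int ` {l..u}"
          "real_of_int (z - 1) + 1 \<in> set p \<or> real_of_int (z - 1) - 1 \<in> set p"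
        using interval[OF pr(1)] z by auto
      have "z - 1 \<notin> {l..u}" using pr(2) lu(3) by (metis imageI)
      then have "real_of_int (z - 1 - 1) \<notin> set p" using lu z by auto
      then show "real_of_int z \<in> set p" using lu(4) by simp
    qed
    then show ?thesis by simp
  qed
  show "count_list as 0 \<le> count_list as (- 1) + 1"
  proof (rule count_list_interlace)
    fix p q r assume "as = p @ 0 # q @ 0 # r"
    then show "- 1 \<in> set q" using ov_adjacent_between(2)[of p 0 q r] assms by auto
  qed simp
qed

end

section \<open>The spectrum of the Jucys-Murphy elements\<close>

abbreviation sym_carrier :: "nat \<Rightarrow> (nat \<Rightarrow> nat) set" where
  "sym_carrier n \<equiv> {x. x permutes {1..n}}"

definition translate :: "(nat \<Rightarrow> nat) \<Rightarrow> perm_fun \<Rightarrow> perm_fun" where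
  "translate y f = (\<lambda>x. f (y \<circ> x))"

definition perm_functions :: "nat \<Rightarrow> perm_fun set" where
  "perm_functions n = {f. \<forall>x. \<not> x permutes {1..n} \<longrightarrow> f x = 0}"

lemma finite_sym_carrier: "finite (sym_carrier n)"
  by (simp add: finite_permutations)

lemma fun_subspace_perm_functions: "fun_subspace (sym_carrier n) (perm_functions n)"
  by (auto simp: fun_subspace_def perm_functions_def)

lemma permutes_comp_iff:
  assumes "y permutes S"
  shows "y \<circ> x permutes S \<longleftrightarrow> x permutes S"
proof
  assume yx: "y \<circ> x permutes S"
  show "x permutes S"
    using permutes_compose[OF yx permutes_inv[OF assms]] permutes_inv_o(2)[OF assms]
    by (simp add: o_assoc)
qed (use assms permutes_compose in auto)

lemma sum_sym_carrier_comp_left: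
  assumes "y permutes {1..n}"
  shows "(\<Sum>x\<in>sym_carrier n. g (y \<circ> x)) = (\<Sum>x\<in>sym_carrier n. g x)"
proof (rule sum.reindex_bij_witness[of _ "\<lambda>x. inv' y \<circ> x" "\<lambda>x. y \<circ> x"])
  fix x assume "x \<in> sym_carrier n"
  then show "inv' y \<circ> x \<in> sym_carrier n" "y \<circ> x \<in> sym_carrier n"
    "inv' y \<circ> (y \<circ> x) = x" "y \<circ> (inv' y \<circ> x) = x"
    using assms permutes_inv[OF assms] permutes_inv_o[OF assms]
    by (auto simp: o_assoc permutes_compose)
qed auto

lemma inner_on_translate:
  assumes "y permutes {1..n}"
  shows "inner_on (sym_carrier n) (translate y f) (translate y g) = inner_on (sym_carrier n) f g"
  unfolding inner_on_def translate_def using assms by (rule sum_sym_carrier_comp_left)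

lemma translate_closed:
  "y permutes {1..n} \<Longrightarrow> f \<in> perm_functions n \<Longrightarrow> translate y f \<in> perm_functions n"
  by (simp add: perm_functions_def translate_def permutes_comp_iff)

lemma exch_permutes:
  "i \<in> {1..n} \<Longrightarrow> j \<in> {1..n} \<Longrightarrow> exch i j permutes {1..n}"
  by (rule permutes_swap_id)

lemma translate_exch_involutory [simp]: "translate (exch i j) (translate (exch i j) f) = f"
  by (simp add: translate_def o_assoc)

lemma JM_translate: "JM i f = (\<lambda>x. \<Sum>j\<in>{1..<i}. translate (exch j i) f x)"
  by (simp add: JM_def translate_def)

lemma JM_closed:
  assumes "i \<le> n" "f \<in> perm_functions n"
  shows "JM i f \<in> perm_functions n"
proof -
  have "translate (exch j i) f \<in> perm_functions n" if "j \<in> {1..<i}" for j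
    using assms that by (intro translate_closed exch_permutes) auto
  then show ?thesis by (auto simp: JM_translate perm_functions_def)
qed

lemma JM_symmetric:
  assumes "i \<le> n"
  shows "symmetric_op (sym_carrier n) (perm_functions n) (JM i)"
proof -
  let ?X = "sym_carrier n"
  have "inner_on ?X (JM i f) g = inner_on ?X f (JM i g)" for f g
  proof -
    have "inner_on ?X (JM i f) g = (\<Sum>j\<in>{1..<i}. inner_on ?X (translate (exch j i) f) g)"
      unfolding inner_on_def JM_translate sum_distrib_right by (rule sum.swap)
    also have "\<dots> = (\<Sum>j\<in>{1..<i}. inner_on ?X f (translate (exch j i) g))"
    proof (intro sum.cong refl)
      fix j assume "j \<in> {1..<i}"
      then have "exch j i permutes {1..n}" using assms by (intro exch_permutes) auto
      from inner_on_translate[OF this, of "translate (exch j i) f" g]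
      show "inner_on ?X (translate (exch j i) f) g = inner_on ?X f (translate (exch j i) g)"
        by simp
    qed
    also have "\<dots> = inner_on ?X f (JM i g)"
      unfolding inner_on_def JM_translate sum_distrib_left by (rule sum.swap)
    finally show ?thesis .
  qed
  then show ?thesis
    using JM_closed[OF assms]
    by (auto simp: symmetric_op_def JM_def sum.distrib sum_distrib_left algebra_simps)
qed

text \<open>Since \<open>y\<close> fixes \<open>k\<close>, conjugation by \<open>y\<close> only
  permutes the transpositions that exchange \<open>k\<close> with a smaller number.\<close>

lemma JM_translate_commute:
  assumes "y permutes {1..<k}"
  shows "JM k (translate y f) = translate y (JM k f)"
proof
  fix x
  have yk: "y k = k" using permutes_not_in[OF assms] by simp
  have "y \<circ> exch j k = exch (y j) k \<circ> y" for j
    using permutes_inj[OF assms] yk by (auto simp: fun_eq_iff Transposition.transpose_def inj_eq)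
  then have "JM k (translate y f) x = (\<Sum>j\<in>{1..<k}. f (exch (y j) k \<circ> y \<circ> x))"
    by (simp add: JM_def translate_def o_assoc)
  also have "\<dots> = (\<Sum>j\<in>{1..<k}. f (exch j k \<circ> y \<circ> x))"
    by (rule sum.reindex_bij_betw[OF permutes_imp_bij[OF assms]])
  finally show "JM k (translate y f) x = translate y (JM k f) x"
    by (simp add: JM_def translate_def o_assoc)
qed

text \<open>For \<open>i < k\<close>, the operator \<open>JM i\<close> is a sum of translations by
  permutations of \<open>{1..<k}\<close>, with which \<open>JM k\<close> commutes.\<close>

lemma JM_commute: "JM i (JM k f) = JM k (JM i f)"
proof -
  have lt: "JM i (JM k f) = JM k (JM i f)" if "i < k" for i k
  proof
    fix x
    have "JM k (JM i f) x = (\<Sum>j\<in>{1..<i}. JM k (translate (exch j i) f) x)"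
      unfolding JM_def translate_def by (rule sum.swap)
    also have "\<dots> = (\<Sum>j\<in>{1..<i}. translate (exch j i) (JM k f) x)"
    proof (intro sum.cong refl)
      fix j assume "j \<in> {1..<i}"
      then have "exch j i permutes {1..<k}" using that by (intro permutes_swap_id) auto
      then show "JM k (translate (exch j i) f) x = translate (exch j i) (JM k f) x"
        by (simp add: JM_translate_commute)
    qed
    finally show "JM i (JM k f) x = JM k (JM i f) x" by (simp add: JM_translate)
  qed
  show ?thesis using lt[of i k] lt[of k i] by (cases i k rule: linorder_cases) auto
qed

text \<open>Conjugation by \<open>exch i (Suc i)\<close> turns the terms of \<open>JM i\<close> into
  all terms of \<open>JM (Suc i)\<close> but one; the missing term is that transposition
  itself.\<close>

lemma JM_Suc:
  assumes "i \<ge> 1"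
  shows "JM (Suc i) f = (\<lambda>x. translate (exch i (Suc i)) (JM i (translate (exch i (Suc i)) f)) x
     + translate (exch i (Suc i)) f x)"
proof
  fix x
  let ?s = "exch i (Suc i)"
  have "exch j (Suc i) = ?s \<circ> exch j i \<circ> ?s" if "j \<in> {1..<i}" for j
    using that by (auto simp: fun_eq_iff Transposition.transpose_def)
  then have "(\<Sum>j\<in>{1..<i}. f (exch j (Suc i) \<circ> x)) = (\<Sum>j\<in>{1..<i}. f (?s \<circ> (exch j i \<circ> (?s \<circ> x))))"
    by (simp add: o_assoc)
  moreover have "{1..<Suc i} = insert i {1..<i}" using assms by auto
  ultimately show "JM (Suc i) f x = translate ?s (JM i (translate ?s f)) x + translate ?s f x"
    by (simp add: JM_def translate_def)
qed

lemma JM_translate_adjacent: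
  assumes "j \<noteq> i" "j \<noteq> Suc i" "i \<ge> 1"
  shows "JM j (translate (exch i (Suc i)) f) = translate (exch i (Suc i)) (JM j f)"
proof (cases "j < i")
  case True
  let ?s = "exch i (Suc i)"
  have "?s \<circ> exch k j = exch k j \<circ> ?s" if "k \<in> {1..<j}" for k
    using that True by (auto simp: fun_eq_iff Transposition.transpose_def)
  then show ?thesis by (auto simp: JM_def translate_def o_assoc intro!: sum.cong)
next
  case False
  then show ?thesis using assms by (intro JM_translate_commute permutes_swap_id) auto
qed

text \<open>List positions start at \<open>0\<close> and the operators at \<open>1\<close>, hence
  the index \<open>i - 1\<close>.\<close>

definition JM_eigenvector :: "nat \<Rightarrow> real list \<Rightarrow> perm_fun \<Rightarrow> bool" where
  "JM_eigenvector n as v \<longleftrightarrow> length as = n \<and> v \<in> perm_functions n \<and> v \<noteq> (\<lambda>_. 0) \<and>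
     (\<forall>i\<in>{1..n}. JM i v = (\<lambda>x. as ! (i - 1) * v x))"

lemma eigenvectors_orthogonal:
  assumes "symmetric_op X W A" "v \<in> W" "w \<in> W" "A v = (\<lambda>x. b * v x)" "A w = (\<lambda>x. c * w x)" "b \<noteq> c"
  shows "inner_on X v w = 0"
proof -
  have "b * inner_on X v w = inner_on X (A v) w"
    using inner_on_lin_left[of X b v 0 v w] by (simp add: assms(4))
  also have "\<dots> = inner_on X v (A w)" by (rule symmetric_op_inner[OF assms(1-3)])
  also have "\<dots> = c * inner_on X v w"
    using inner_on_lin_right[of X v c w 0 w] by (simp add: assms(5))
  finally show ?thesis using assms(6) by simp
qed

text \<open>Everything happens in the span of \<open>v\<close> and \<open>u = translate s v\<close>.
  There \<open>w = u - v / (c - b)\<close> has the two eigenvalues exchanged. If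
  \<open>\<bar>c - b\<bar> = 1\<close>, orthogonality of \<open>v\<close> and \<open>w\<close>
  together with the equal norms of \<open>u\<close> and \<open>v\<close> forces \<open>w\<close> to
  vanish. In the other case \<open>w\<close> cannot vanish, since \<open>u\<close> would be a
  multiple of \<open>v\<close> of a different norm.\<close>

lemma JM_eigenvector_adjacent:
  assumes "JM_eigenvector n (xs @ b # c # zs) v"
  defines "s \<equiv> exch (Suc (length xs)) (Suc (Suc (length xs)))"
  shows "b \<noteq> c"
    and "\<bar>c - b\<bar> = 1 \<Longrightarrow> translate s v = (\<lambda>x. (c - b) * v x)"
    and "\<bar>c - b\<bar> \<noteq> 1 \<Longrightarrow> \<exists>w. JM_eigenvector n (xs @ c # b # zs) w"
proof -
  define i where "i = Suc (length xs)"
  let ?X = "sym_carrier n"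
  have s: "s = exch i (Suc i)" by (simp add: s_def i_def)
  have n: "n = length (xs @ b # c # zs)" and v: "v \<in> perm_functions n" "v \<noteq> (\<lambda>_. 0)"
    using assms(1) by (auto simp: JM_eigenvector_def)
  have i: "i \<ge> 1" "Suc i \<le> n" by (auto simp: i_def n)
  have sp: "s permutes {1..n}" unfolding s using i by (intro exch_permutes) auto
  define u where "u = translate s v"
  have su: "translate s u = v" by (simp add: u_def s)
  have uV: "u \<in> perm_functions n" unfolding u_def using sp v by (intro translate_closed)
  have ev: "JM j v = (\<lambda>x. (xs @ b # c # zs) ! (j - 1) * v x)" if "j \<in> {1..n}" for j
    using assms(1) that by (auto simp: JM_eigenvector_def)
  have evi: "JM i v = (\<lambda>x. b * v x)"
    using ev[of i] i by (simp add: i_def)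
  have evs: "JM (Suc i) v = (\<lambda>x. c * v x)"
    using ev[of "Suc i"] i by (simp add: i_def nth_append)
  \<comment> \<open>Both operators are triangular on this span. The off-diagonal \<open>v\<close>
    comes from the summand \<open>translate s f\<close> in \<open>JM_Suc\<close>.\<close>
  have J1: "JM (Suc i) u = (\<lambda>x. b * u x + v x)"
    using JM_Suc[OF i(1), of u] su evi unfolding s by (simp add: u_def s) (simp add: translate_def)
  have J2: "JM i u = (\<lambda>x. c * u x - v x)"
  proof -
    have "(\<lambda>x. translate s (JM i u) x + u x) = (\<lambda>x. c * v x)"
      using JM_Suc[OF i(1), of v] evs by (simp add: u_def s)
    then have "translate s (JM i u) = (\<lambda>x. c * v x - u x)" by (auto simp: fun_eq_iff algebra_simps)
    then have "translate s (translate s (JM i u)) = translate s (\<lambda>x. c * v x - u x)" by simp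
    then have "JM i u = translate s (\<lambda>x. c * v x - u x)" by (simp add: s)
    also have "\<dots> = (\<lambda>x. c * u x - translate s u x)" by (simp add: translate_def u_def)
    finally show ?thesis by (simp only: su)
  qed
  have sym: "symmetric_op ?X (perm_functions n) (JM j)" if "j \<le> n" for j
    using that by (rule JM_symmetric)
  have vv: "inner_on ?X v v > 0"
    using fun_subspace_eq_0_iff[OF fun_subspace_perm_functions finite_sym_carrier v(1)] v(2)
      inner_on_self_nonneg[of ?X v] by simp
  show bc: "b \<noteq> c"
  proof
    \<comment> \<open>Equal eigenvalues would make \<open>JM (Suc i)\<close> a nontrivial Jordan
      block, which symmetry excludes.\<close>
    assume "b = c"
    have "inner_on ?X (JM (Suc i) u) v = inner_on ?X u (JM (Suc i) v)"
      using sym[OF i(2)] uV v(1) by (rule symmetric_op_inner)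
    moreover have "inner_on ?X (JM (Suc i) u) v = b * inner_on ?X u v + inner_on ?X v v"
      using inner_on_lin_left[of ?X b u 1 v v] by (simp add: J1)
    moreover have "inner_on ?X u (JM (Suc i) v) = c * inner_on ?X u v"
      using inner_on_lin_right[of ?X u c v 0 v] by (simp add: evs)
    ultimately show False using vv \<open>b = c\<close> by simp
  qed
  define d where "d = c - b"
  have d: "d \<noteq> 0" using bc by (simp add: d_def)
  \<comment> \<open>Subtracting \<open>v / d\<close> from \<open>u\<close> removes the off-diagonal
    terms of \<open>J1\<close> and \<open>J2\<close>.\<close>
  define w where "w = (\<lambda>x. 1 * u x + (- (1 / d)) * v x)"
  have wV: "w \<in> perm_functions n"
    unfolding w_def by (intro fun_subspace_lin[OF fun_subspace_perm_functions] uV v)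
  have Jw: "JM j w = (\<lambda>x. 1 * JM j u x + (- (1 / d)) * JM j v x)" if "j \<le> n" for j
    unfolding w_def by (intro symmetric_op_lin[OF sym[OF that]] uV v)
  have cd: "c * (1 / d) = 1 + b * (1 / d)" using d by (simp add: d_def field_simps)
  have Jwi: "JM i w = (\<lambda>x. c * w x)"
  proof
    fix x
    have "JM i w x = c * u x - v x - b * (1 / d) * v x"
      using Jw[of i] i by (simp add: J2 evi)
    also have "\<dots> = c * u x - (c * (1 / d)) * v x" unfolding cd by algebra
    also have "\<dots> = c * w x" unfolding w_def by algebra
    finally show "JM i w x = c * w x" .
  qed
  have Jws: "JM (Suc i) w = (\<lambda>x. b * w x)"
  proof
    fix x
    have "JM (Suc i) w x = b * u x + v x - c * (1 / d) * v x"
      using Jw[of "Suc i"] i by (simp add: J1 evs)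
    also have "\<dots> = b * u x - b * (1 / d) * v x" unfolding cd by algebra
    also have "\<dots> = b * w x" unfolding w_def by algebra
    finally show "JM (Suc i) w x = b * w x" .
  qed
  show "translate s v = (\<lambda>x. (c - b) * v x)" if "\<bar>c - b\<bar> = 1"
  proof -
    have dd: "d * d = 1" "1 / d = d"
    proof -
      have "d = 1 \<or> d = - 1" using that by (auto simp: d_def abs_if split: if_splits)
      then show "d * d = 1" "1 / d = d" by auto
    qed
    have "inner_on ?X v w = 0"
      using i by (intro eigenvectors_orthogonal[OF sym[of i] v(1) wV evi Jwi bc]) auto
    then have uv: "inner_on ?X v u = d * inner_on ?X v v"
      unfolding w_def inner_on_lin_right dd by simp
    have uu: "inner_on ?X u u = inner_on ?X v v"
      unfolding u_def by (rule inner_on_translate[OF sp])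
    have "inner_on ?X w w = inner_on ?X u u - d * inner_on ?X v u - d * (inner_on ?X v u - d * inner_on ?X v v)"
      unfolding w_def inner_on_lin_right inner_on_lin_left dd
      unfolding inner_on_commute[of ?X u v] by (simp add: algebra_simps)
    also have "\<dots> = 0" unfolding uu uv using dd(1) by (simp add: mult.assoc[symmetric])
    finally have w0: "w = (\<lambda>_. 0)"
      using fun_subspace_eq_0_iff[OF fun_subspace_perm_functions finite_sym_carrier wV] by simp
    have "u x = d * v x" for x
      using fun_cong[OF w0, of x] by (simp add: w_def dd)
    then show ?thesis by (auto simp: u_def d_def)
  qed
  show "\<exists>w. JM_eigenvector n (xs @ c # b # zs) w" if "\<bar>c - b\<bar> \<noteq> 1"
  proof (intro exI[of _ w])
    have "w \<noteq> (\<lambda>_. 0)"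
    proof
      assume w0: "w = (\<lambda>_. 0)"
      have "u x = (1 / d) * v x" for x
        using fun_cong[OF w0, of x] by (simp add: w_def)
      then have u: "u = (\<lambda>x. (1 / d) * v x)" by auto
      have "inner_on ?X v v = inner_on ?X u u"
        unfolding u_def by (rule inner_on_translate[OF sp, symmetric])
      also have "\<dots> = (1 / d) * ((1 / d) * inner_on ?X v v)"
        unfolding u using inner_on_lin_left[of ?X "1/d" v 0 v] inner_on_lin_right[of ?X v "1/d" v 0 v]
        by simp
      finally have "d * d = 1" using vv d by (simp add: field_simps)
      then show False using that
        by (metis abs_1 abs_minus_cancel d_def power2_eq_1_iff power2_eq_square)
    qed
    moreover have "JM j w = (\<lambda>x. (xs @ c # b # zs) ! (j - 1) * w x)" if j: "j \<in> {1..n}" for j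
    proof -
      consider "j = i" | "j = Suc i" | "j \<noteq> i" "j \<noteq> Suc i" by auto
      then show ?thesis
      proof cases
        case 3
        define e where "e = (xs @ b # c # zs) ! (j - 1)"
        have "(xs @ c # b # zs) ! (j - 1) = e"
          using 3 j unfolding e_def i_def by (auto simp: nth_append nth_Cons' )
        moreover have "JM j u = (\<lambda>x. e * u x)"
          using JM_translate_adjacent[OF 3 i(1), of v] ev[OF j]
          by (simp add: u_def s e_def translate_def)
        moreover have "JM j v = (\<lambda>x. e * v x)" using ev[OF j] by (simp add: e_def)
        ultimately show ?thesis using Jw[of j] j by (auto simp: w_def algebra_simps)
      qed (use Jwi Jws in \<open>auto simp: i_def nth_append\<close>)
    qed
    ultimately show "JM_eigenvector n (xs @ c # b # zs) w"
      using wV by (auto simp: JM_eigenvector_def n)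
  qed
qed

text \<open>The first condition holds because \<open>JM 1\<close> is zero, the second is the
  analysis of adjacent entries, and the last is the braid relation.\<close>

lemma okounkov_vershik_JM: "okounkov_vershik {as. \<exists>v. JM_eigenvector n as v}"
  unfolding okounkov_vershik_def
proof (intro conjI allI impI)
  fix b ys assume "b # ys \<in> {as. \<exists>v. JM_eigenvector n as v}"
  then obtain v where v: "JM_eigenvector n (b # ys) v" by auto
  then have "JM 1 v = (\<lambda>x. b * v x)" by (force simp: JM_eigenvector_def)
  then have "b * v x = 0" for x by (simp add: JM_def) (metis mult_eq_0_iff)
  then show "b = 0" using v by (auto simp: JM_eigenvector_def fun_eq_iff)
next
  fix xs b c zs assume "xs @ b # c # zs \<in> {as. \<exists>v. JM_eigenvector n as v}"
  then obtain v where v: "JM_eigenvector n (xs @ b # c # zs) v" by auto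
  show "b \<noteq> c" using JM_eigenvector_adjacent(1)[OF v] .
  assume "c \<noteq> b + 1" "c \<noteq> b - 1"
  then have "\<bar>c - b\<bar> \<noteq> 1" by (auto simp: abs_if)
  then show "xs @ c # b # zs \<in> {as. \<exists>v. JM_eigenvector n as v}"
    using JM_eigenvector_adjacent(3)[OF v] by auto
next
  fix xs :: "real list" and b e :: real and zs assume e: "\<bar>e\<bar> = 1"
  show "xs @ b # (b + e) # b # zs \<notin> {as. \<exists>v. JM_eigenvector n as v}"
  proof
    assume "xs @ b # (b + e) # b # zs \<in> {as. \<exists>v. JM_eigenvector n as v}"
    then obtain v where v: "JM_eigenvector n (xs @ b # (b + e) # b # zs) v" by auto
    define i where "i = Suc (length xs)"
    define s where "s = exch i (Suc i)"
    define t where "t = exch (Suc i) (Suc (Suc i))"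
    have 1: "translate s v = (\<lambda>x. e * v x)"
      using JM_eigenvector_adjacent(2)[OF v] e by (simp add: s_def i_def)
    have 2: "translate t v = (\<lambda>x. - e * v x)"
      using JM_eigenvector_adjacent(2)[of n "xs @ [b]" "b + e" b zs v] v e by (simp add: t_def i_def)
    have h1: "v (s \<circ> x) = e * v x" for x using fun_cong[OF 1, of x] by (simp add: translate_def)
    have h2: "v (t \<circ> x) = - e * v x" for x using fun_cong[OF 2, of x] by (simp add: translate_def)
    \<comment> \<open>\<open>s\<close> acts on \<open>v\<close> by \<open>e\<close> and
      \<open>t\<close> by \<open>- e\<close>, so the two sides of the braid relation act by scalars
      of opposite sign.\<close>
    have braid: "s \<circ> t \<circ> s = t \<circ> s \<circ> t" by (auto simp: s_def t_def Transposition.transpose_def fun_eq_iff)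
    have "v x = 0" for x
    proof -
      have "v (s \<circ> (t \<circ> (s \<circ> x))) = v (t \<circ> (s \<circ> (t \<circ> x)))" using braid by (simp add: o_assoc)
      then have "- e * (e * (e * v x)) = e * (e * (e * v x))" unfolding h1 h2 by simp
      then show ?thesis using e by auto
    qed
    then show False using v by (auto simp: JM_eigenvector_def)
  qed
qed

section \<open>Power sums of the Jucys-Murphy elements\<close>

lemma JM_lin: "JM i (\<lambda>x. a * f x + b * g x) = (\<lambda>x. a * JM i f x + b * JM i g x)"
  by (simp add: JM_def sum.distrib sum_distrib_left)

lemma JM_add: "JM i (\<lambda>x. f x + g x) = (\<lambda>x. JM i f x + JM i g x)"
  using JM_lin[of i 1 f 1 g] by simp

lemma JM_diff: "JM i (\<lambda>x. f x - g x) = (\<lambda>x. JM i f x - JM i g x)"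
  using JM_lin[of i 1 f "-1" g] by simp

lemma JM_scale: "JM i (\<lambda>x. a * f x) = (\<lambda>x. a * JM i f x)"
  using JM_lin[of i a f 0 f] by simp

lemma JM_funpow_commute: "JM i ((JM k ^^ m) f) = (JM k ^^ m) (JM i f)"
  by (induction m) (simp_all add: JM_commute[of i k])

text \<open>
  With \<open>A\<close>, \<open>B\<close> the Jucys-Murphy operators of \<open>i\<close>, \<open>i + 1\<close> and \<open>s\<close> the transposition exchanging
  \<open>i\<close> and \<open>i + 1\<close>, this is the complete homogeneous polynomial of degree \<open>k - 1\<close> in \<open>A\<close> and \<open>B\<close>; it is
  the defect in the commutation of \<open>s\<close> with the powers of \<open>A\<close> and of \<open>B\<close>.
\<close>

fun JM_complete :: "nat \<Rightarrow> nat \<Rightarrow> perm_fun \<Rightarrow> perm_fun" where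
  "JM_complete i 0 f = (\<lambda>_. 0)"
| "JM_complete i (Suc k) f = (\<lambda>x. (JM (Suc i) ^^ k) f x + JM i (JM_complete i k f) x)"

text \<open>The defining recursion peels off powers of one operator, this form powers of the other.
  Commuting \<open>s\<close> past \<open>A\<close> uses the first and past \<open>B\<close> the
  second.\<close>

lemma JM_complete_altdef:
  "JM_complete i (Suc k) f = (\<lambda>x. (JM i ^^ k) f x + JM (Suc i) (JM_complete i k f) x)"
proof (induction k)
  case 0
  then show ?case by (simp add: JM_def)
next
  case (Suc k)
  have "JM i (JM_complete i (Suc k) f) = (\<lambda>x. (JM i ^^ Suc k) f x + JM i (JM (Suc i) (JM_complete i k f)) x)"
    unfolding Suc.IH by (simp add: JM_add)
  moreover have "JM (Suc i) (JM_complete i (Suc k) f) =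
      (\<lambda>x. (JM (Suc i) ^^ Suc k) f x + JM i (JM (Suc i) (JM_complete i k f)) x)"
    unfolding JM_complete.simps by (simp add: JM_add JM_commute[of "Suc i" i])
  ultimately show ?case by (subst JM_complete.simps(2)) (auto simp: fun_eq_iff)
qed

text \<open>Neither power commutes with \<open>s\<close>, but the two defects are opposite, so the
  sum of the powers does.\<close>

lemma JM_funpow_translate_adjacent:
  assumes "i \<ge> 1"
  defines "s \<equiv> exch i (Suc i)"
  shows "(JM i ^^ k) (translate s f) = (\<lambda>x. translate s ((JM (Suc i) ^^ k) f) x - JM_complete i k f x)"
    and "(JM (Suc i) ^^ k) (translate s f) = (\<lambda>x. translate s ((JM i ^^ k) f) x + JM_complete i k f x)"
proof -
  have ss: "translate s (translate s g) = g" for g by (simp add: s_def)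
  have B: "JM (Suc i) (translate s g) = (\<lambda>x. translate s (JM i g) x + g x)" for g
    using JM_Suc[OF assms(1), of "translate s g"] by (simp add: ss flip: s_def)
  have A: "JM i (translate s g) = (\<lambda>x. translate s (JM (Suc i) g) x - g x)" for g
  proof -
    have "translate s (JM (Suc i) g) = translate s (\<lambda>x. translate s (JM i (translate s g)) x + translate s g x)"
      using JM_Suc[OF assms(1), of g] by (simp flip: s_def)
    also have "\<dots> = (\<lambda>x. translate s (translate s (JM i (translate s g))) x + translate s (translate s g) x)"
      by (simp add: translate_def)
    finally show ?thesis by (simp add: ss)
  qed
  show "(JM i ^^ k) (translate s f) = (\<lambda>x. translate s ((JM (Suc i) ^^ k) f) x - JM_complete i k f x)"
  proof (induction k)
    case (Suc k)
    have "(JM i ^^ Suc k) (translate s f) =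
        JM i (\<lambda>x. translate s ((JM (Suc i) ^^ k) f) x - JM_complete i k f x)"
      using Suc by simp
    also have "\<dots> = (\<lambda>x. translate s (JM (Suc i) ((JM (Suc i) ^^ k) f)) x - (JM (Suc i) ^^ k) f x
        - JM i (JM_complete i k f) x)"
      by (simp only: JM_diff A)
    finally show ?case by (simp add: diff_diff_eq)
  qed simp
  show "(JM (Suc i) ^^ k) (translate s f) = (\<lambda>x. translate s ((JM i ^^ k) f) x + JM_complete i k f x)"
  proof (induction k)
    case (Suc k)
    have "(JM (Suc i) ^^ Suc k) (translate s f) =
        JM (Suc i) (\<lambda>x. translate s ((JM i ^^ k) f) x + JM_complete i k f x)"
      using Suc by simp
    also have "\<dots> = (\<lambda>x. translate s (JM i ((JM i ^^ k) f)) x + (JM i ^^ k) f x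
        + JM (Suc i) (JM_complete i k f) x)"
      by (simp only: JM_add B)
    finally show ?case by (simp add: JM_complete_altdef add.assoc del: JM_complete.simps)
  qed simp
qed

definition JM_psum :: "nat \<Rightarrow> nat \<Rightarrow> perm_fun \<Rightarrow> perm_fun" where
  "JM_psum n k f = (\<lambda>x. \<Sum>i\<in>{1..n}. (JM i ^^ k) f x)"

lemma JM_psum_translate_adjacent:
  assumes "i \<ge> 1" "Suc i \<le> n"
  defines "s \<equiv> exch i (Suc i)"
  shows "JM_psum n k (translate s f) = translate s (JM_psum n k f)"
proof
  fix x
  have split: "(\<Sum>j\<in>{1..n}. h j) = h i + h (Suc i) + (\<Sum>j\<in>{1..n} - {i, Suc i}. h j)" for h :: "nat \<Rightarrow> real"
    using assms by (subst sum.subset_diff[of "{i, Suc i}"]) auto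
  have other: "(JM j ^^ k) (translate s f) = translate s ((JM j ^^ k) f)" if "j \<in> {1..n} - {i, Suc i}" for j
    using that JM_translate_adjacent[of j i] assms by (induction k) auto
  show "JM_psum n k (translate s f) x = translate s (JM_psum n k f) x"
    unfolding JM_psum_def split
    using JM_funpow_translate_adjacent[OF assms(1), of k f] other
    by (simp flip: s_def) (simp add: translate_def)
qed

text \<open>Adjacent transpositions generate: \<open>exch a (Suc b)\<close> is the conjugate of
  \<open>exch a b\<close> by \<open>exch b (Suc b)\<close>.\<close>

lemma adjacent_permutes_induct:
  assumes "p permutes {1..n}" and id: "P id"
    and step: "\<And>i p. i \<ge> 1 \<Longrightarrow> Suc i \<le> n \<Longrightarrow> P p \<Longrightarrow> P (exch i (Suc i) \<circ> p)"
  shows "P p"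
proof -
  have lt: "P (exch a b \<circ> p)" if "1 \<le> a" "a < b" "b \<le> n" "P p" for a b p
    using that
  proof (induction b arbitrary: p)
    case (Suc b)
    show ?case
    proof (cases "a = b")
      case False
      have "exch a (Suc b) = exch b (Suc b) \<circ> exch a b \<circ> exch b (Suc b)"
        using False Suc.prems by (auto simp: fun_eq_iff Transposition.transpose_def)
      moreover have "P (exch b (Suc b) \<circ> (exch a b \<circ> (exch b (Suc b) \<circ> p)))"
        using False Suc.prems by (intro step Suc.IH) auto
      ultimately show ?thesis by (simp only: o_assoc)
    next
      case True
      show ?thesis unfolding True using Suc.prems True by (intro step) auto
    qed
  qed simp
  have "P (exch a b \<circ> p)" 
    if "a \<in> {1..n}" "b \<in> {1..n}" "a \<noteq> b" "P p" for a b p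
  proof -
    have "a < b \<or> b < a" using that by auto
    then show ?thesis
      using lt[of a b p] lt[of b a p] that unfolding transpose_commute[of b a] by auto
  qed
  then show ?thesis using permutes_induct[of p "{1..n}" P] assms(1) id by blast
qed

lemma translate_comp: "translate (y \<circ> z) f = translate z (translate y f)"
  by (simp add: translate_def o_assoc)

lemma translate_id [simp]: "translate id f = f"
  by (simp add: translate_def)

text \<open>The power sums are central in the group algebra, although the Jucys-Murphy elements
  themselves are not.\<close>

lemma JM_psum_translate:
  assumes "y permutes {1..n}"
  shows "JM_psum n k (translate y f) = translate y (JM_psum n k f)"
proof -
  define P where "P y \<longleftrightarrow> (\<forall>f. JM_psum n k (translate y f) = translate y (JM_psum n k f))" for y
  have "P y"
  proof (rule adjacent_permutes_induct[OF assms])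
    show "P id" unfolding P_def by simp
    show "P (exch i (Suc i) \<circ> p)" if "i \<ge> 1" "Suc i \<le> n" "P p" for i p
      using that unfolding P_def translate_comp by (simp add: JM_psum_translate_adjacent)
  qed
  then show ?thesis unfolding P_def by blast
qed

section \<open>Words in the transpositions at a fixed point, cycles and supports\<close>

fun star_word :: "nat \<Rightarrow> nat list \<Rightarrow> nat \<Rightarrow> nat" where
  "star_word i [] = id"
| "star_word i (j # js) = star_word i js \<circ> exch j i"

text \<open>The outermost operator contributes the transposition next to \<open>x\<close>, which is
  why \<open>star_word\<close> applies the head of the word first.\<close>

lemma JM_funpow_words:
  "(JM i ^^ k) f x = (\<Sum>js | set js \<subseteq> {1..<i} \<and> length js = k. f (star_word i js \<circ> x))"
proof (induction k arbitrary: x)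
  case 0
  have "{js. set js \<subseteq> {1..<i} \<and> length js = 0} = {[]}" by auto
  then show ?case by simp
next
  case (Suc k)
  let ?L = "{js. set js \<subseteq> {1..<i} \<and> length js = k}"
  have "(\<Sum>js | set js \<subseteq> {1..<i} \<and> length js = Suc k. f (star_word i js \<circ> x)) =
      (\<Sum>(js, j)\<in>?L \<times> {1..<i}. f (star_word i (j # js) \<circ> x))"
    unfolding lists_length_Suc_eq
    by (subst sum.reindex) (auto simp: inj_on_def case_prod_unfold)
  also have "\<dots> = (\<Sum>j\<in>{1..<i}. \<Sum>js\<in>?L. f (star_word i (j # js) \<circ> x))"
    by (simp only: sum.cartesian_product[symmetric]) (rule sum.swap)
  also have "\<dots> = (JM i ^^ Suc k) f x"
  proof -
    have "(JM i ^^ Suc k) f x = JM i ((JM i ^^ k) f) x" by simp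
    moreover have "f (star_word i (j # js) \<circ> x) = f (star_word i js \<circ> (exch j i \<circ> x))" for j js
      by (simp only: star_word.simps comp_assoc)
    ultimately show ?thesis unfolding JM_def Suc.IH by simp
  qed
  finally show ?case by (rule sym)
qed

text \<open>Multiplication by \<open>exch j i\<close> on the right inserts the new letter
  \<open>j\<close> directly after \<open>i\<close> in the cycle.\<close>

lemma star_word_eq_cycle:
  assumes "distinct (i # js)"
  shows "star_word i js = cycle_of_list (i # js)"
  using assms
proof (induction js)
  case (Cons j js)
  let ?t = "exch i j"
  have "map ?t (j # js) = i # js"
    using Cons.prems by (auto intro!: map_idI simp: transpose_eq_iff)
  then have "?t \<circ> cycle_of_list (j # js) \<circ> inv' ?t = cycle_of_list (i # js)"
    using conjugation_of_cycle[of "j # js" ?t] Cons.prems by simp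
  then have "cycle_of_list (i # js) \<circ> ?t = ?t \<circ> cycle_of_list (j # js) \<circ> (?t \<circ> ?t)"
    by (metis comp_assoc inv_transpose_eq)
  then have "cycle_of_list (i # js) \<circ> ?t = cycle_of_list (i # j # js)" by simp
  moreover have "star_word i js = cycle_of_list (i # js)" using Cons by simp
  ultimately show ?case by (simp only: star_word.simps transpose_commute[of j i])
qed simp

lemma star_word_fixes: "x \<noteq> i \<Longrightarrow> x \<notin> set js \<Longrightarrow> star_word i js x = x"
  by (induction js) auto

lemma star_word_permutes:
  assumes "i \<in> {1..n}" "set js \<subseteq> {1..<i}"
  shows "star_word i js permutes {1..n}"
  using assms
proof (induction js)
  case (Cons j js)
  have "j \<in> {1..n}" using Cons.prems by auto
  moreover have "star_word i js permutes {1..n}" using Cons by simp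
  ultimately show ?case
    unfolding star_word.simps using Cons.prems(1) by (intro permutes_compose exch_permutes)
qed (simp add: permutes_id)

definition moved :: "('a \<Rightarrow> 'a) \<Rightarrow> 'a set" where
  "moved w = {x. w x \<noteq> x}"

lemma moved_subset: "w permutes S \<Longrightarrow> moved w \<subseteq> S"
  by (auto simp: moved_def permutes_def)

lemma moved_comp: "moved (u \<circ> w) \<subseteq> moved u \<union> moved w"
  by (auto simp: moved_def)

lemma moved_comp_disjoint:
  assumes "moved u \<inter> moved w = {}" "bij w"
  shows "moved (u \<circ> w) = moved u \<union> moved w"
proof -
  have "u (w x) \<noteq> x" if "x \<in> moved u \<union> moved w" for x
  proof (cases "x \<in> moved w")
    case True
    then have "w x \<in> moved w" using assms(2) by (auto simp: moved_def bij_def inj_eq)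
    then have "u (w x) = w x" using assms(1) by (auto simp: moved_def)
    then show ?thesis using True by (simp add: moved_def)
  qed (use that in \<open>auto simp: moved_def\<close>)
  then show ?thesis using moved_comp[of u w] by (auto simp: moved_def)
qed

lemma moved_conj:
  assumes "bij r"
  shows "moved (r \<circ> w \<circ> inv' r) = r ` moved w"
proof -
  have "r (w (inv' r x)) = x \<longleftrightarrow> w (inv' r x) = inv' r x" for x
    using assms by (metis bij_inv_eq_iff)
  then show ?thesis
    using assms by (auto simp: moved_def bij_image_Collect_eq)
qed

lemma moved_cycle:
  assumes "distinct cs" "length cs \<ge> 2"
  shows "moved (cycle_of_list cs) = set cs"
proof
  show "moved (cycle_of_list cs) \<subseteq> set cs"
    using id_outside_supp[of _ cs] by (auto simp: moved_def)
  show "set cs \<subseteq> moved (cycle_of_list cs)"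
  proof
    fix x assume "x \<in> set cs"
    then obtain k where k: "k < length cs" "x = cs ! k" by (auto simp: in_set_conv_nth)
    have "cycle_of_list cs x = map (cycle_of_list cs) cs ! k" using k by simp
    also have "\<dots> = rotate1 cs ! k" using cyclic_rotation[OF assms(1), of 1] by simp
    also have "\<dots> = cs ! (Suc k mod length cs)" using k by (simp add: nth_rotate1)
    finally have "cycle_of_list cs x = cs ! (Suc k mod length cs)" .
    moreover have "Suc k mod length cs \<noteq> k"
      using k assms(2) by (cases "Suc k = length cs") auto
    ultimately show "x \<in> moved (cycle_of_list cs)"
      using k nth_eq_iff_index_eq[OF assms(1), of "Suc k mod length cs" k]
        mod_less_divisor[of "length cs" "Suc k"] by (cases "length cs") (auto simp: moved_def)
  qed
qed

lemma cycle_decomp_permutes: "cycle_decomp I p \<Longrightarrow> p permutes I"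
proof (induction rule: cycle_decomp.induct)
  case (comp I p cs)
  show ?case
    using permutes_subset[OF comp.IH, of "set cs \<union> I"] permutes_subset[OF cycle_permutes[of cs], of "set cs \<union> I"]
    by (intro permutes_compose) auto
qed (rule permutes_id)

text \<open>Factors with fewer than two letters are the identity and are skipped until a genuine
  cycle appears.\<close>

lemma extract_cycle:
  assumes "cycle_decomp I w" "w \<noteq> id"
  shows "\<exists>cs p. distinct cs \<and> length cs \<ge> 2 \<and> set cs \<subseteq> I \<and> p permutes (I - set cs) \<and>
    w = cycle_of_list cs \<circ> p"
  using assms
proof (induction rule: cycle_decomp.induct)
  case (comp I p cs)
  show ?case
  proof (cases "length cs \<ge> 2")
    case True
    have "set cs \<union> I - set cs = I" using comp.hyps by auto
    then have "p permutes (set cs \<union> I - set cs)"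
      using cycle_decomp_permutes[OF comp.hyps(1)] by simp
    then show ?thesis using True comp.hyps by (intro exI[of _ cs] exI[of _ p]) simp
  next
    case False
    then have c: "cycle_of_list cs = id"
      by (cases cs rule: cycle_of_list.cases) simp_all
    have "p \<noteq> id"
    proof
      assume "p = id"
      then have "cycle_of_list cs \<circ> p = id" using c by (simp only: id_o)
      then show False using comp.prems by contradiction
    qed
    then obtain ds q where ds: "distinct ds" "length ds \<ge> 2" "set ds \<subseteq> I" "q permutes (I - set ds)"
        "p = cycle_of_list ds \<circ> q"
      using comp.IH by blast
    have "q permutes (set cs \<union> I - set ds)"
      using ds(4) by (rule permutes_subset) auto
    then show ?thesis using c ds by (intro exI[of _ ds] exI[of _ q]) auto
  qed
qed simp

text \<open>Built entry by entry: the next image is corrected by a transposition that fixes the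
  images already placed.\<close>

lemma permutes_map_list:
  assumes "distinct cs" "distinct ds" "length cs = length ds" "set cs \<subseteq> A" "set ds \<subseteq> A"
  shows "\<exists>\<theta>. \<theta> permutes A \<and> map \<theta> cs = ds"
  using assms(3,1,2,4,5)
proof (induction cs ds rule: list_induct2)
  case Nil
  show ?case using permutes_id by (metis list.map(1))
next
  case (Cons c cs d ds)
  then obtain \<theta> where \<theta>: "\<theta> permutes A" "map \<theta> cs = ds" by fastforce
  have "\<theta> c \<in> A" using permutes_in_image[OF \<theta>(1)] Cons.prems by simp
  then have "exch (\<theta> c) d \<circ> \<theta> permutes A"
    using \<theta>(1) Cons.prems by (intro permutes_compose permutes_swap_id) simp_all
  moreover have "\<theta> c \<notin> set ds"
    using \<theta>(2) Cons.prems(1) permutes_inj[OF \<theta>(1)] by (auto simp: inj_eq)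
  then have "map (exch (\<theta> c) d) ds = ds"
    using Cons.prems(2) by (intro map_idI) (auto simp: transpose_eq_iff)
  then have "map (exch (\<theta> c) d \<circ> \<theta>) (c # cs) = d # ds"
    using \<theta>(2) by (simp flip: map_map)
  ultimately show ?case by (intro exI[of _ "exch (\<theta> c) d \<circ> \<theta>"] conjI)
qed

text \<open>Summing over all conjugators counts each conjugate as often as the order of the
  centraliser, so no class sizes have to be computed.\<close>

definition class_sum :: "nat \<Rightarrow> (nat \<Rightarrow> nat) \<Rightarrow> perm_fun \<Rightarrow> perm_fun" where
  "class_sum n w f = (\<lambda>x. \<Sum>r\<in>sym_carrier n. f (r \<circ> w \<circ> inv' r \<circ> x))"

lemma sum_sym_carrier_comp_right:
  assumes "y permutes {1..n}"
  shows "(\<Sum>x\<in>sym_carrier n. g (x \<circ> y)) = (\<Sum>x\<in>sym_carrier n. g x)"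
proof (rule sum.reindex_bij_witness[of _ "\<lambda>x. x \<circ> inv' y" "\<lambda>x. x \<circ> y"])
  fix x assume "x \<in> sym_carrier n"
  then show "x \<circ> inv' y \<in> sym_carrier n" "x \<circ> y \<in> sym_carrier n"
    "x \<circ> inv' y \<circ> y = x" "x \<circ> y \<circ> inv' y = x"
    using assms permutes_inv[OF assms] permutes_inv_o[OF assms]
    by (auto simp: comp_assoc permutes_compose)
qed auto

lemma inv_comp_permutes:
  assumes "x permutes S" "y permutes T"
  shows "inv' (x \<circ> y) = inv' y \<circ> inv' x"
  using assms by (intro o_inv_distrib permutes_bij)

lemma class_sum_conj:
  assumes "q permutes {1..n}"
  shows "class_sum n (q \<circ> w \<circ> inv' q) f = class_sum n w f"
proof
  fix x
  have "class_sum n (q \<circ> w \<circ> inv' q) f x =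
      (\<Sum>r\<in>sym_carrier n. f ((r \<circ> q) \<circ> w \<circ> inv' (r \<circ> q) \<circ> x))"
    unfolding class_sum_def
    by (intro sum.cong refl) (simp add: inv_comp_permutes[OF _ assms] comp_assoc)
  also have "\<dots> = class_sum n w f x"
    unfolding class_sum_def
    by (rule sum_sym_carrier_comp_right[OF assms, of "\<lambda>r. f (r \<circ> w \<circ> inv' r \<circ> x)"])
  finally show "class_sum n (q \<circ> w \<circ> inv' q) f x = class_sum n w f x" .
qed

lemma class_sum_translate:
  assumes "y permutes {1..n}"
  shows "class_sum n w (translate y f) = translate y (class_sum n w f)"
proof
  fix x
  have y: "inv' y \<circ> y = id" using permutes_inv_o(2)[OF assms] .
  have "translate y (class_sum n w f) x = (\<Sum>r\<in>sym_carrier n. f (r \<circ> w \<circ> inv' r \<circ> (y \<circ> x)))"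
    by (simp add: translate_def class_sum_def)
  also have "\<dots> = (\<Sum>r\<in>sym_carrier n. f ((y \<circ> r) \<circ> w \<circ> inv' (y \<circ> r) \<circ> (y \<circ> x)))"
    by (rule sum_sym_carrier_comp_left[OF assms, symmetric])
  also have "\<dots> = (\<Sum>r\<in>sym_carrier n. f (y \<circ> (r \<circ> w \<circ> inv' r \<circ> x)))"
  proof (intro sum.cong refl arg_cong[of _ _ f])
    fix r assume "r \<in> sym_carrier n"
    then have "(y \<circ> r) \<circ> w \<circ> inv' (y \<circ> r) \<circ> (y \<circ> x) = y \<circ> r \<circ> w \<circ> inv' r \<circ> (inv' y \<circ> y) \<circ> x"
      by (simp add: inv_comp_permutes[OF assms] o_assoc)
    then show "(y \<circ> r) \<circ> w \<circ> inv' (y \<circ> r) \<circ> (y \<circ> x) = y \<circ> (r \<circ> w \<circ> inv' r \<circ> x)"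
      by (simp add: y o_assoc)
  qed
  finally show "class_sum n w (translate y f) x = translate y (class_sum n w f) x"
    by (simp add: translate_def class_sum_def)
qed

lemma class_sum_scale: "class_sum n w (\<lambda>x. a * f x) = (\<lambda>x. a * class_sum n w f x)"
  by (simp add: class_sum_def sum_distrib_left)

section \<open>Class sums\<close>

text \<open>It lies in the space of all functions on permutations, so that the Jucys-Murphy
  operators act on it. The range of \<open>k\<close> contains \<open>length cs - 1\<close> for every
  cycle \<open>cs\<close> in \<open>{1..n}\<close>.\<close>

definition psum_eigenspace :: "nat \<Rightarrow> (nat \<Rightarrow> real) \<Rightarrow> perm_fun set" where
  "psum_eigenspace n \<pi> = {f \<in> perm_functions n. \<forall>k\<le>n. JM_psum n k f = (\<lambda>x. \<pi> k * f x)}"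

definition star_pairs :: "nat \<Rightarrow> nat \<Rightarrow> (nat \<times> nat list) set" where
  "star_pairs n k = (SIGMA i:{1..n}. {js. set js \<subseteq> {1..<i} \<and> length js = k})"

lemma finite_star_pairs: "finite (star_pairs n k)"
  unfolding star_pairs_def by (intro finite_SigmaI finite_lists_length_eq) auto

lemma JM_psum_words: "JM_psum n k f x = (\<Sum>(i, js)\<in>star_pairs n k. f (star_word i js \<circ> x))"
  unfolding JM_psum_def star_pairs_def JM_funpow_words
  by (rule sum.Sigma) (auto intro: finite_lists_length_eq)

text \<open>The operator on the left commutes with translations, so all its terms may be conjugated
  by the same \<open>r\<close>. Averaging over \<open>r\<close> writes a class sum times a power sum
  as a combination of class sums.\<close>

lemma class_sum_psum_average:
  fixes n k w
  defines "Y \<equiv> (\<lambda>(r, i, js). star_word i js \<circ> (r \<circ> w \<circ> inv' r))"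
  defines "I \<equiv> sym_carrier n \<times> star_pairs n k"
  shows "fact n * class_sum n w (JM_psum n k f) x = (\<Sum>\<omega>\<in>I. class_sum n (Y \<omega>) f x)"
proof -
  define T where "T f = class_sum n w (JM_psum n k f)" for f
  have T_words: "T f x = (\<Sum>\<omega>\<in>I. f (Y \<omega> \<circ> x))" for f x
    unfolding T_def class_sum_def JM_psum_words I_def Y_def
    by (subst sum.cartesian_product) (simp add: case_prod_unfold comp_assoc)
  have T_translate: "T (translate y f) = translate y (T f)" if "y permutes {1..n}" for y f
    unfolding T_def using that by (simp add: JM_psum_translate class_sum_translate)
  have conj: "T f x = (\<Sum>\<omega>\<in>I. f (r \<circ> Y \<omega> \<circ> inv' r \<circ> x))" if r: "r \<in> sym_carrier n" for r
  proof -
    have rr: "r \<circ> (inv' r \<circ> x) = x"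
      using permutes_inv_o(1)[of r "{1..n}"] r by (simp add: o_assoc)
    have "T f x = translate r (T f) (inv' r \<circ> x)" by (simp only: translate_def rr)
    also have "\<dots> = T (translate r f) (inv' r \<circ> x)" using T_translate r by simp
    also have "\<dots> = (\<Sum>\<omega>\<in>I. f (r \<circ> Y \<omega> \<circ> inv' r \<circ> x))"
      unfolding T_words translate_def by (simp only: comp_assoc)
    finally show ?thesis .
  qed
  have "fact n * T f x = (\<Sum>r\<in>sym_carrier n. T f x)"
    using card_permutations[of "{1..n}" n] by simp
  also have "\<dots> = (\<Sum>r\<in>sym_carrier n. \<Sum>\<omega>\<in>I. f (r \<circ> Y \<omega> \<circ> inv' r \<circ> x))"
    by (intro sum.cong refl conj)
  also have "\<dots> = (\<Sum>\<omega>\<in>I. class_sum n (Y \<omega>) f x)"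
    unfolding class_sum_def by (rule sum.swap)
  finally show ?thesis by (simp only: T_def)
qed

text \<open>A cycle read from its largest entry has the shape of the words in
  \<open>JM_funpow_words\<close>, whose letters all lie below \<open>i\<close>.\<close>

lemma rotate_to_Max:
  assumes "distinct cs" "cs \<noteq> ([] :: nat list)"
  obtains i js where "cycle_of_list cs = cycle_of_list (i # js)" "set cs = set (i # js)"
    "distinct (i # js)" "length cs = length (i # js)" "set js \<subseteq> {..<i}"
proof -
  have "Max (set cs) \<in> set cs" using assms by auto
  then obtain xs ys where xs: "cs = xs @ Max (set cs) # ys" by (auto simp: in_set_conv_decomp)
  define i js where "i = Max (set cs)" and "js = ys @ xs"
  have cs: "cs = xs @ i # ys" using xs by (simp add: i_def)
  have r: "rotate (length xs) cs = i # js"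
    unfolding cs rotate_append js_def by simp
  have "distinct (i # js)" using assms(1) r by (metis distinct_rotate)
  moreover have set: "set cs = set (i # js)" using r by (metis set_rotate)
  moreover have "set js \<subseteq> {..<i}"
  proof
    fix x assume "x \<in> set js"
    moreover from this have "x \<le> i" unfolding i_def using set by simp
    ultimately show "x \<in> {..<i}" using \<open>distinct (i # js)\<close> by (cases "x = i") auto
  qed
  moreover have "cycle_of_list cs = cycle_of_list (i # js)"
    using cycle_of_list_rotate_independent[OF assms(1), of "length xs"] r by simp
  moreover have "length cs = length (i # js)" using r by (metis length_rotate)
  ultimately show thesis using that by blast
qed

text \<open>The word moves at most \<open>k + 1\<close> points, and conjugation preserves the number
  of points moved by \<open>p\<close>. Equality is possible only if the letters are distinct and
  avoid the conjugate of \<open>p\<close>; then \<open>y\<close> has the cycle structure of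
  \<open>w\<close>.\<close>

lemma moved_star_conj:
  assumes w: "w = cycle_of_list cs \<circ> p" "distinct cs" "length cs = Suc k" "k \<ge> 1"
      "set cs \<subseteq> {1..n}" "p permutes ({1..n} - set cs)"
    and r: "r permutes {1..n}" and ijs: "(i, js) \<in> star_pairs n k"
  defines "y \<equiv> star_word i js \<circ> (r \<circ> p \<circ> inv' r)"
  shows "card (moved y) \<le> card (moved w)"
    and "card (moved y) = card (moved w) \<Longrightarrow> class_sum n y f = class_sum n w f"
proof -
  have fin: "finite (moved p)" "finite (moved w)"
    using moved_subset[OF w(6)] moved_comp[of "cycle_of_list cs" p] moved_cycle[of cs] w
    by (auto intro: finite_subset)
  have p: "p permutes {1..n}" using w(6) by (rule permutes_subset) auto
  have mw: "moved w = set cs \<union> moved p"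
    using moved_comp_disjoint[of "cycle_of_list cs" p] moved_cycle[of cs] w moved_subset[OF w(6)]
      permutes_bij[OF w(6)] by auto
  have "set cs \<inter> moved p = {}" using moved_subset[OF w(6)] by auto
  then have cw: "card (moved w) = Suc k + card (moved p)"
    using mw w fin distinct_card[OF w(2)] by (simp add: card_Un_disjoint)
  have js: "length js = k" "set (i # js) \<subseteq> {1..n}" using ijs by (auto simp: star_pairs_def)
  have mr: "moved (r \<circ> p \<circ> inv' r) = r ` moved p" by (rule moved_conj[OF permutes_bij[OF r]])
  have cr: "card (r ` moved p) = card (moved p)"
    using permutes_inj[OF r] by (intro card_image) (auto intro: inj_on_subset)
  have sub: "moved y \<subseteq> set (i # js) \<union> r ` moved p"
  proof -
    have "moved (star_word i js) \<subseteq> set (i # js)"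
      using star_word_fixes[of _ i js] by (auto simp: moved_def)
    then show ?thesis using moved_comp[of "star_word i js" "r \<circ> p \<circ> inv' r"] mr
      by (auto simp: y_def)
  qed
  then have "card (moved y) \<le> card (set (i # js) \<union> r ` moved p)"
    using fin by (intro card_mono) auto
  also have "\<dots> \<le> card (set (i # js)) + card (r ` moved p)" by (rule card_Un_le)
  also have "card (set (i # js)) \<le> Suc k" using card_length[of "i # js"] js by simp
  finally show le: "card (moved y) \<le> card (moved w)" using cw cr by simp
  assume eq: "card (moved y) = card (moved w)"
  have le1: "card (moved y) \<le> card (set (i # js) \<union> r ` moved p)"
    using sub fin by (intro card_mono) auto
  have un: "card (set (i # js) \<union> r ` moved p) + card (set (i # js) \<inter> r ` moved p) =
      card (set (i # js)) + card (moved p)"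
    using card_Un_Int[of "set (i # js)" "r ` moved p"] fin cr by simp
  have le2: "card (set (i # js)) \<le> length (i # js)" by (rule card_length)
  have "card (set (i # js)) = length (i # js)" "card (set (i # js) \<inter> r ` moved p) = 0"
  proof -
    have "length (i # js) = Suc k" using js(1) by simp
    then show "card (set (i # js)) = length (i # js)" "card (set (i # js) \<inter> r ` moved p) = 0"
      using le1 un le2 eq cw by linarith+
  qed
  then have dist: "distinct (i # js)" and disj: "set (i # js) \<inter> r ` moved p = {}"
    using card_distinct[of "i # js"] card_eq_0_iff[of "set (i # js) \<inter> r ` moved p"] fin
    by blast+
  \<comment> \<open>The cycle pulled back through \<open>r\<close>. It avoids
    \<open>moved p\<close>, so some \<open>\<theta>\<close> carries \<open>cs\<close> to it while
    fixing \<open>moved p\<close>, and \<open>r \<circ> \<theta>\<close> conjugates \<open>w\<close>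
    to \<open>y\<close>.\<close>
  define ds where "ds = map (inv' r) (i # js)"
  have rinv: "r (inv' r x) = x" "inv' r (r x) = x" for x
    using permutes_inverses[OF r] by auto
  have ds: "distinct ds" "length ds = length cs" "set ds \<subseteq> {1..n} - moved p"
  proof -
    show "distinct ds"
      unfolding ds_def distinct_map
      using dist inj_on_subset[OF permutes_inj[OF permutes_inv[OF r]] subset_UNIV] by blast
    show "length ds = length cs" using js w by (simp add: ds_def)
    show "set ds \<subseteq> {1..n} - moved p"
    proof
      fix x assume "x \<in> set ds"
      then obtain z where z: "z \<in> set (i # js)" "x = inv' r z" by (auto simp: ds_def)
      then have "z \<in> {1..n}" using js by auto
      then have "x \<in> {1..n}" using permutes_in_image[OF permutes_inv[OF r], of z] z by simp
      moreover have "x \<notin> moved p"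
      proof
        assume "x \<in> moved p"
        then have "r x \<in> r ` moved p" by simp
        then show False using z rinv disj by auto
      qed
      ultimately show "x \<in> {1..n} - moved p" by simp
    qed
  qed
  have "set cs \<subseteq> {1..n} - moved p" using w(5) \<open>set cs \<inter> moved p = {}\<close> by auto
  then obtain \<theta> where \<theta>: "\<theta> permutes {1..n} - moved p" "map \<theta> cs = ds"
    using permutes_map_list[OF w(2) ds(1) ds(2)[symmetric] _ ds(3)] by blast
  have \<theta>n: "\<theta> permutes {1..n}" using \<theta>(1) by (rule permutes_subset) auto
  define q where "q = r \<circ> \<theta>"
  have q: "q permutes {1..n}" unfolding q_def using \<theta>n r by (rule permutes_compose)
  have mapq: "map q cs = i # js"
    using \<theta>(2) rinv by (simp add: q_def ds_def flip: map_map) (simp add: o_def)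
  have \<theta>p: "\<theta> \<circ> p \<circ> inv' \<theta> = p"
  proof
    fix x
    have fix\<theta>: "\<theta> z = z" if "z \<in> moved p" for z using permutes_not_in[OF \<theta>(1)] that by auto
    have inv\<theta>: "\<theta> (inv' \<theta> z) = z" "inv' \<theta> (\<theta> z) = z" for z using permutes_inverses[OF \<theta>n] by auto
    show "(\<theta> \<circ> p \<circ> inv' \<theta>) x = p x"
    proof (cases "x \<in> moved p")
      case True
      then have "p x \<in> moved p" using permutes_inj[OF p] by (auto simp: moved_def inj_eq)
      then show ?thesis using fix\<theta> True inv\<theta>(2)[of x] by auto
    next
      case False
      have "inv' \<theta> x \<notin> moved p" using fix\<theta>[of "inv' \<theta> x"] inv\<theta> False by auto
      then show ?thesis using False inv\<theta> by (simp add: moved_def)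
    qed
  qed
  have "q \<circ> w \<circ> inv' q = (q \<circ> cycle_of_list cs \<circ> inv' q) \<circ> (q \<circ> p \<circ> inv' q)"
    using permutes_inv_o(2)[OF q] by (simp add: w(1) fun_eq_iff permutes_inverses[OF q])
  also have "q \<circ> cycle_of_list cs \<circ> inv' q = cycle_of_list (i # js)"
    using conjugation_of_cycle[OF w(2) permutes_bij[OF q]] mapq by simp
  also have "q \<circ> p \<circ> inv' q = r \<circ> (\<theta> \<circ> p \<circ> inv' \<theta>) \<circ> inv' r"
    by (simp only: q_def inv_comp_permutes[OF r \<theta>n] comp_assoc)
  also have "\<dots> = r \<circ> p \<circ> inv' r" by (simp only: \<theta>p)
  also have "cycle_of_list (i # js) \<circ> (r \<circ> p \<circ> inv' r) = y"
    unfolding y_def by (simp only: star_word_eq_cycle[OF dist])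
  finally have "q \<circ> w \<circ> inv' q = y" .
  then show "class_sum n y f = class_sum n w f"
    using class_sum_conj[OF q, of w f] by (simp only:)
qed

text \<open>Remove a cycle of length \<open>k + 1\<close> from \<open>w\<close>, leaving
  \<open>p\<close>. The class sum of \<open>p\<close> times the \<open>k\<close>-th power sum is a
  triangular combination: a positive multiple of the class sum of \<open>w\<close> plus class sums
  of smaller support. Every other term is scalar by induction.\<close>

lemma class_sum_scalar:
  assumes "w permutes {1..n}"
  shows "\<exists>c. \<forall>f\<in>psum_eigenspace n \<pi>. class_sum n w f = (\<lambda>x. c * f x)"
  using assms
proof (induction "card (moved w)" arbitrary: w rule: less_induct)
  case less
  show ?case
  proof (cases "w = id")
    case True
    have "class_sum n w f x = fact n * f x" for f x
    proof -
      have "class_sum n w f x = (\<Sum>r\<in>sym_carrier n. f x)"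
        unfolding class_sum_def True
      proof (intro sum.cong refl arg_cong[of _ _ f])
        fix r assume "r \<in> sym_carrier n"
        then show "r \<circ> id \<circ> inv' r \<circ> x = x" using permutes_inv_o(1)[of r "{1..n}"] by simp
      qed
      then show ?thesis using card_permutations[of "{1..n}" n] by simp
    qed
    then show ?thesis by blast
  next
    case False
    obtain cs p where cs: "distinct cs" "length cs \<ge> 2" "set cs \<subseteq> {1..n}"
        "p permutes ({1..n} - set cs)" "w = cycle_of_list cs \<circ> p"
      using extract_cycle[OF cycle_decomposition[OF less.prems] False] by auto
    define k where "k = length cs - 1"
    have k: "length cs = Suc k" "k \<ge> 1" "k \<le> n"
      using cs(2) card_mono[OF _ cs(3)] distinct_card[OF cs(1)] by (auto simp: k_def)
    have p: "p permutes {1..n}" using cs(4) by (rule permutes_subset) auto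
    have fin: "finite (moved v)" if "v permutes {1..n}" for v
      using moved_subset[OF that] by (rule finite_subset) simp
    have mw: "moved w = set cs \<union> moved p"
      using moved_comp_disjoint[of "cycle_of_list cs" p] moved_cycle[of cs] cs moved_subset[OF cs(4)]
        permutes_bij[OF cs(4)] by auto
    have "moved p \<subset> moved w"
      using mw moved_subset[OF cs(4)] cs(2) by (cases cs) auto
    then have "card (moved p) < card (moved w)" using fin[OF less.prems] by (rule psubset_card_mono[rotated])
    then obtain cp where cp: "\<forall>f\<in>psum_eigenspace n \<pi>. class_sum n p f = (\<lambda>x. cp * f x)"
      using less.hyps p by blast
    define Y where "Y = (\<lambda>(r, i, js). star_word i js \<circ> (r \<circ> p \<circ> inv' r))"
    define I where "I = sym_carrier n \<times> star_pairs n k"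
    define I1 where "I1 = {\<omega>\<in>I. card (moved (Y \<omega>)) < card (moved w)}"
    define I2 where "I2 = {\<omega>\<in>I. card (moved (Y \<omega>)) = card (moved w)}"
    have finI: "finite I" unfolding I_def using finite_sym_carrier finite_star_pairs by blast
    have le: "card (moved (Y \<omega>)) \<le> card (moved w)" if "\<omega> \<in> I" for \<omega>
      using that moved_star_conj(1)[OF cs(5,1) k(1,2) cs(3,4)] by (auto simp: I_def Y_def)
    then have I: "I = I1 \<union> I2" "I1 \<inter> I2 = {}" by (force simp: I1_def I2_def)+
    have Yperm: "Y \<omega> permutes {1..n}" if "\<omega> \<in> I" for \<omega>
    proof -
      obtain r i js where \<omega>: "\<omega> = (r, i, js)" by (cases \<omega>) auto
      have r: "r permutes {1..n}" and ijs: "i \<in> {1..n}" "set js \<subseteq> {1..<i}"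
        using that by (auto simp: \<omega> I_def star_pairs_def)
      show ?thesis
        unfolding \<omega> Y_def prod.case
        using star_word_permutes[OF ijs] r p permutes_inv[OF r] by (intro permutes_compose)
    qed
    have "\<forall>\<omega>\<in>I1. \<exists>c. \<forall>f\<in>psum_eigenspace n \<pi>. class_sum n (Y \<omega>) f = (\<lambda>x. c * f x)"
      using less.hyps Yperm by (auto simp: I1_def)
    then obtain c1 where c1: "\<And>\<omega> f. \<omega> \<in> I1 \<Longrightarrow> f \<in> psum_eigenspace n \<pi> \<Longrightarrow>
        class_sum n (Y \<omega>) f = (\<lambda>x. c1 \<omega> * f x)"
      by metis
    have c2: "class_sum n (Y \<omega>) f = class_sum n w f" if "\<omega> \<in> I2" for \<omega> f
      using that moved_star_conj(2)[OF cs(5,1) k(1,2) cs(3,4)] by (auto simp: I2_def I_def Y_def)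
    \<comment> \<open>Take \<open>r = id\<close> and the removed cycle read from its maximum: the
      resulting product is \<open>w\<close> itself.\<close>
    have "I2 \<noteq> {}"
    proof -
      have "cs \<noteq> []" using cs(2) by auto
      then obtain i js where ijs: "cycle_of_list cs = cycle_of_list (i # js)" "set cs = set (i # js)"
        "distinct (i # js)" "length cs = length (i # js)" "set js \<subseteq> {..<i}"
        by (rule rotate_to_Max[OF cs(1)])
      have "set js \<subseteq> {1..<i}"
      proof
        fix x assume "x \<in> set js"
        then have "x \<in> {1..n}" "x \<in> {..<i}" using ijs(2,5) cs(3) by auto
        then show "x \<in> {1..<i}" by simp
      qed
      moreover have "i \<in> {1..n}" "length js = k" using ijs(2,4) cs(3) k by auto
      ultimately have "(id, i, js) \<in> I"
        by (simp add: I_def star_pairs_def permutes_id del: id_apply)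
      moreover have "Y (id, i, js) = w"
        unfolding Y_def prod.case star_word_eq_cycle[OF ijs(3)] ijs(1)[symmetric] cs(5)
        by (simp only: inv_id id_o o_id)
      ultimately have "(id, i, js) \<in> I2" by (simp add: I2_def)
      then show ?thesis by blast
    qed
    then have N: "card I2 \<noteq> 0" using finI by (simp add: I2_def)
    \<comment> \<open>Solve the averaged identity for the class sum of \<open>w\<close>; its
      coefficient is \<open>card I2\<close>, which is nonzero.\<close>
    have "class_sum n w f x = ((fact n * (cp * \<pi> k) - (\<Sum>\<omega>\<in>I1. c1 \<omega>)) / card I2) * f x"
      if f: "f \<in> psum_eigenspace n \<pi>" for f x
    proof -
      have "fact n * class_sum n p (JM_psum n k f) x = (\<Sum>\<omega>\<in>I. class_sum n (Y \<omega>) f x)"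
        unfolding I_def Y_def by (rule class_sum_psum_average)
      also have "class_sum n p (JM_psum n k f) = (\<lambda>x. cp * \<pi> k * f x)"
        using f k(3) cp by (auto simp: psum_eigenspace_def class_sum_scale)
      also have "(\<Sum>\<omega>\<in>I. class_sum n (Y \<omega>) f x) =
          (\<Sum>\<omega>\<in>I1. class_sum n (Y \<omega>) f x) + (\<Sum>\<omega>\<in>I2. class_sum n (Y \<omega>) f x)"
        using I finI by (metis finite_Un sum.union_disjoint)
      also have "\<dots> = (\<Sum>\<omega>\<in>I1. c1 \<omega>) * f x + card I2 * class_sum n w f x"
        using c1 c2 f by (simp add: sum_distrib_right)
      finally show ?thesis using N by (simp add: field_simps)
    qed
    then show ?thesis by blast
  qed
qed

definition class_function :: "nat \<Rightarrow> perm_fun \<Rightarrow> bool" where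
  "class_function n g \<longleftrightarrow> (\<forall>x r. x permutes {1..n} \<longrightarrow> r permutes {1..n} \<longrightarrow> g (r \<circ> x \<circ> inv' r) = g x)"

text \<open>
  No inverse is taken in the argument of \<open>f\<close>, so that \<open>conv n g f id\<close> is the inner product of
  \<open>g\<close> and \<open>f\<close>.
\<close>

definition conv :: "nat \<Rightarrow> perm_fun \<Rightarrow> perm_fun \<Rightarrow> perm_fun" where
  "conv n g f = (\<lambda>x. \<Sum>y\<in>sym_carrier n. g y * f (y \<circ> x))"

lemma sum_sym_carrier_conj:
  assumes "r permutes {1..n}"
  shows "(\<Sum>x\<in>sym_carrier n. g (r \<circ> x \<circ> inv' r)) = (\<Sum>x\<in>sym_carrier n. g x)"
  using sum_sym_carrier_comp_left[OF assms, of "\<lambda>x. g (x \<circ> inv' r)"]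
    sum_sym_carrier_comp_right[OF permutes_inv[OF assms], of g]
  by (simp add: comp_assoc)

lemma conv_eq_class_sums:
  assumes "class_function n g"
  shows "fact n * conv n g f x = (\<Sum>y\<in>sym_carrier n. g y * class_sum n y f x)"
proof -
  have "fact n * conv n g f x = (\<Sum>r\<in>sym_carrier n. conv n g f x)"
    using card_permutations[of "{1..n}" n] by simp
  also have "\<dots> = (\<Sum>r\<in>sym_carrier n. \<Sum>y\<in>sym_carrier n. g y * f (r \<circ> y \<circ> inv' r \<circ> x))"
  proof (intro sum.cong refl)
    fix r assume r: "r \<in> sym_carrier n"
    then have "conv n g f x = (\<Sum>y\<in>sym_carrier n. g (r \<circ> y \<circ> inv' r) * f (r \<circ> y \<circ> inv' r \<circ> x))"
      unfolding conv_def
      by (intro sum_sym_carrier_conj[of r n "\<lambda>y. g y * f (y \<circ> x)", symmetric]) simp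
    also have "\<dots> = (\<Sum>y\<in>sym_carrier n. g y * f (r \<circ> y \<circ> inv' r \<circ> x))"
      using assms r by (intro sum.cong) (auto simp: class_function_def)
    finally show "conv n g f x = (\<Sum>y\<in>sym_carrier n. g y * f (r \<circ> y \<circ> inv' r \<circ> x))" .
  qed
  also have "\<dots> = (\<Sum>y\<in>sym_carrier n. g y * class_sum n y f x)"
    unfolding class_sum_def sum_distrib_left by (rule sum.swap)
  finally show ?thesis .
qed

text \<open>Convolution by a class function is a combination of class sums. It will be applied to
  cycle counts and also to the basis functions themselves.\<close>

lemma conv_scalar:
  assumes "class_function n g"
  shows "\<exists>c. \<forall>f\<in>psum_eigenspace n \<pi>. conv n g f = (\<lambda>x. c * f x)"
proof -
  have "\<forall>y\<in>sym_carrier n. \<exists>c. \<forall>f\<in>psum_eigenspace n \<pi>. class_sum n y f = (\<lambda>x. c * f x)"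
    using class_sum_scalar by auto
  then obtain c where c: "\<And>y f. y \<in> sym_carrier n \<Longrightarrow> f \<in> psum_eigenspace n \<pi> \<Longrightarrow>
      class_sum n y f = (\<lambda>x. c y * f x)"
    by metis
  have "conv n g f x = (\<Sum>y\<in>sym_carrier n. g y * c y) / fact n * f x"
    if "f \<in> psum_eigenspace n \<pi>" for f x
  proof -
    have "fact n * conv n g f x = (\<Sum>y\<in>sym_carrier n. g y * c y * f x)"
      unfolding conv_eq_class_sums[OF assms] using c that by (intro sum.cong) auto
    then have "fact n * conv n g f x = (\<Sum>y\<in>sym_carrier n. g y * c y) * f x"
      by (simp add: sum_distrib_right)
    then show ?thesis by (simp add: field_simps)
  qed
  then show ?thesis by blast
qed

section \<open>The trace on class functions\<close>

definition class_functions :: "nat \<Rightarrow> perm_fun set" where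
  "class_functions n = {f \<in> perm_functions n. class_function n f}"

lemma fun_subspace_class_functions: "fun_subspace (sym_carrier n) (class_functions n)"
  by (auto simp: fun_subspace_def class_functions_def perm_functions_def class_function_def)

lemma JM_funpow_lin: "(JM i ^^ k) (\<lambda>x. a * f x + b * g x) = (\<lambda>x. a * (JM i ^^ k) f x + b * (JM i ^^ k) g x)"
  by (induction k) (simp_all add: JM_lin)

lemma JM_funpow_symmetric:
  assumes "i \<le> n"
  shows "symmetric_op (sym_carrier n) (perm_functions n) (JM i ^^ k)"
proof (induction k)
  case 0
  then show ?case by (simp add: symmetric_op_def)
next
  case (Suc k)
  then show ?case
    using JM_symmetric[OF assms] by (simp add: symmetric_op_def JM_funpow_commute)
qed

lemma JM_psum_lin: "JM_psum n k (\<lambda>x. a * f x + b * g x) = (\<lambda>x. a * JM_psum n k f x + b * JM_psum n k g x)"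
  by (simp add: JM_psum_def JM_funpow_lin sum.distrib sum_distrib_left)

lemma JM_psum_inner:
  assumes "f \<in> perm_functions n" "g \<in> perm_functions n"
  shows "inner_on (sym_carrier n) (JM_psum n k f) g = inner_on (sym_carrier n) f (JM_psum n k g)"
proof -
  have "inner_on (sym_carrier n) (JM_psum n k f) g =
      (\<Sum>i\<in>{1..n}. inner_on (sym_carrier n) ((JM i ^^ k) f) g)"
    unfolding inner_on_def JM_psum_def sum_distrib_right by (rule sum.swap)
  also have "\<dots> = (\<Sum>i\<in>{1..n}. inner_on (sym_carrier n) f ((JM i ^^ k) g))"
    using assms by (intro sum.cong refl symmetric_op_inner[OF JM_funpow_symmetric]) auto
  also have "\<dots> = inner_on (sym_carrier n) f (JM_psum n k g)"
    unfolding inner_on_def JM_psum_def sum_distrib_left by (rule sum.swap)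
  finally show ?thesis .
qed

lemma JM_psum_closed:
  assumes "f \<in> perm_functions n"
  shows "JM_psum n k f \<in> perm_functions n"
proof -
  have "(JM i ^^ k) f \<in> perm_functions n" if "i \<in> {1..n}" for i
    using that assms by (intro symmetric_op_closed[OF JM_funpow_symmetric]) auto
  then show ?thesis by (simp add: JM_psum_def perm_functions_def)
qed

lemma JM_right: "JM i (\<lambda>x. f (x \<circ> z)) = (\<lambda>x. JM i f (x \<circ> z))"
  by (simp only: JM_def comp_assoc)

lemma JM_funpow_right: "(JM i ^^ k) (\<lambda>x. f (x \<circ> z)) = (\<lambda>x. (JM i ^^ k) f (x \<circ> z))"
proof (induction k)
  case (Suc k)
  have "(JM i ^^ Suc k) g = JM i ((JM i ^^ k) g)" for g by simp
  then show ?case by (simp only: Suc.IH JM_right)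
qed simp

text \<open>Conjugation combines a left and a right translation. Centrality handles the first, and
  the second commutes with everything acting from the left.\<close>

lemma JM_psum_class_function:
  assumes "f \<in> class_functions n"
  shows "JM_psum n k f \<in> class_functions n"
proof -
  have f: "f \<in> perm_functions n" "class_function n f" using assms by (auto simp: class_functions_def)
  have "JM_psum n k f (r \<circ> x \<circ> inv' r) = JM_psum n k f x"
    if x: "x permutes {1..n}" and r: "r permutes {1..n}" for x r
  proof -
    have ff: "(\<lambda>x. translate r f (x \<circ> inv' r)) = f"
    proof
      fix y
      show "translate r f (y \<circ> inv' r) = f y"
      proof (cases "y permutes {1..n}")
        case True
        then show ?thesis using f(2) r by (simp add: translate_def class_function_def o_assoc)
      next
        case False
        have "\<not> r \<circ> (y \<circ> inv' r) permutes {1..n}"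
        proof
          assume "r \<circ> (y \<circ> inv' r) permutes {1..n}"
          then have "y \<circ> inv' r permutes {1..n}" using permutes_comp_iff[OF r] by blast
          from permutes_compose[OF r this] have "y permutes {1..n}"
            using permutes_inv_o(2)[OF r] by (simp add: comp_assoc)
          then show False using False by simp
        qed
        then show ?thesis using f(1) False by (simp add: translate_def perm_functions_def)
      qed
    qed
    have "JM_psum n k f (r \<circ> x \<circ> inv' r) = translate r (JM_psum n k f) (x \<circ> inv' r)"
      by (simp add: translate_def o_assoc)
    also have "\<dots> = JM_psum n k (translate r f) (x \<circ> inv' r)"
      by (simp add: JM_psum_translate[OF r])
    also have "\<dots> = JM_psum n k (\<lambda>x. translate r f (x \<circ> inv' r)) x"
      by (simp add: JM_psum_def JM_funpow_right)
    finally show ?thesis by (simp only: ff)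
  qed
  then show ?thesis using JM_psum_closed[OF f(1)] by (simp add: class_functions_def class_function_def)
qed

lemma JM_psum_symmetric:
  "symmetric_op (sym_carrier n) (class_functions n) (JM_psum n k)"
  unfolding symmetric_op_def
  using JM_psum_class_function JM_psum_lin JM_psum_inner by (auto simp: class_functions_def)

lemma JM_sum: "finite I \<Longrightarrow> JM i (\<lambda>x. \<Sum>j\<in>I. f j x) = (\<lambda>x. \<Sum>j\<in>I. JM i (f j) x)"
  by (induction I rule: finite_induct) (simp_all add: JM_add, simp add: JM_def)

lemma JM_JM_psum: "JM i (JM_psum n k f) = JM_psum n k (JM i f)"
  by (simp add: JM_psum_def JM_sum JM_funpow_commute)

lemma JM_funpow_JM_psum: "(JM i ^^ m) (JM_psum n k f) = JM_psum n k ((JM i ^^ m) f)"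
  by (induction m) (simp_all add: JM_JM_psum)

lemma JM_psum_sum: "finite I \<Longrightarrow> JM_psum n k (\<lambda>x. \<Sum>j\<in>I. f j x) = (\<lambda>x. \<Sum>j\<in>I. JM_psum n k (f j) x)"
proof (induction I rule: finite_induct)
  case empty
  show ?case using JM_psum_lin[of n k 0 "\<lambda>_. 0" 0 "\<lambda>_. 0"] by simp
next
  case (insert j I)
  then show ?case using JM_psum_lin[of n k 1 "f j" 1 "\<lambda>x. \<Sum>j\<in>I. f j x"] by simp
qed

lemma JM_psum_commute: "JM_psum n m (JM_psum n k f) = JM_psum n k (JM_psum n m f)"
proof -
  have "JM_psum n m (JM_psum n k f) = (\<lambda>x. \<Sum>i\<in>{1..n}. JM_psum n k ((JM i ^^ m) f) x)"
    unfolding JM_psum_def[of n m] by (simp add: JM_funpow_JM_psum)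
  also have "\<dots> = JM_psum n k (JM_psum n m f)"
    unfolding JM_psum_def[of n m] by (simp add: JM_psum_sum)
  finally show ?thesis .
qed

lemma fun_subspace_psum_eigenspace: "fun_subspace (sym_carrier n) (psum_eigenspace n \<pi>)"
proof -
  have "JM_psum n k (\<lambda>_. 0) = (\<lambda>_. 0)" for k
    using JM_psum_lin[of n k 0 "\<lambda>_. 0" 0 "\<lambda>_. 0"] by simp
  then show ?thesis
    by (auto simp: fun_subspace_def psum_eigenspace_def perm_functions_def JM_psum_lin algebra_simps)
qed

text \<open>The Jucys-Murphy operators commute with the power sums and hence act on the eigenspace.
  The eigenvector found need not be a class function; it serves to identify the eigenvalues.\<close>

lemma psum_eigenspace_JM_eigenvector:
  assumes "f \<in> psum_eigenspace n \<pi>" "f \<noteq> (\<lambda>_. 0)"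
  obtains as v where "JM_eigenvector n as v" "v \<in> psum_eigenspace n \<pi>"
proof -
  define W where "W = psum_eigenspace n \<pi>"
  have W: "fun_subspace (sym_carrier n) W" unfolding W_def by (rule fun_subspace_psum_eigenspace)
  have sym: "symmetric_op (sym_carrier n) W A" if "A \<in> set (map JM [1..<Suc n])" for A
  proof -
    from that obtain i where "A = JM i" "i \<in> set [1..<Suc n]" unfolding set_map by (rule imageE)
    then have i: "A = JM i" "i \<le> n" by (simp_all del: upt_Suc)
    have "JM i f \<in> W" if "f \<in> W" for f
    proof -
      have "JM_psum n k (JM i f) = (\<lambda>x. \<pi> k * JM i f x)" if "k \<le> n" for k
      proof -
        have "JM_psum n k (JM i f) = JM i (JM_psum n k f)" by (simp add: JM_JM_psum)
        also have "JM_psum n k f = (\<lambda>x. \<pi> k * f x)"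
          using \<open>f \<in> W\<close> that by (simp add: W_def psum_eigenspace_def)
        finally show ?thesis by (simp add: JM_scale)
      qed
      then show ?thesis using that JM_closed[OF i(2)] by (simp add: W_def psum_eigenspace_def)
    qed
    then show ?thesis
      using JM_symmetric[OF i(2)] unfolding i symmetric_op_def by (auto simp: W_def psum_eigenspace_def)
  qed
  have comm: "A (C f) = C (A f)" if "A \<in> set (map JM [1..<Suc n])" "C \<in> set (map JM [1..<Suc n])" for A C f
    using that JM_commute by auto
  obtain v where v: "v \<in> W" "v \<noteq> (\<lambda>_. 0)" "\<forall>A\<in>set (map JM [1..<Suc n]). \<exists>a. A v = (\<lambda>x. a * v x)"
    using joint_eigenvector[of "sym_carrier n" W f "map JM [1..<Suc n]"] finite_sym_carrier W assms sym comm
    unfolding W_def by blast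
  have "\<forall>i\<in>{1..n}. \<exists>a. JM i v = (\<lambda>x. a * v x)" using v(3) by (auto simp: less_Suc_eq_le)
  then obtain a where a: "\<And>i. i \<in> {1..n} \<Longrightarrow> JM i v = (\<lambda>x. a i * v x)" by metis
  have "JM_eigenvector n (map a [1..<Suc n]) v"
    unfolding JM_eigenvector_def
  proof (intro conjI ballI)
    fix i assume i: "i \<in> {1..n}"
    then have "map a [1..<Suc n] ! (i - 1) = a i"
      using nth_map_upt[of "i - 1" "Suc n" 1 a] by (auto simp del: upt_Suc)
    then show "JM i v = (\<lambda>x. map a [1..<Suc n] ! (i - 1) * v x)" using a[OF i] by (simp only:)
  qed (use v in \<open>auto simp: W_def psum_eigenspace_def\<close>)
  then show thesis using that v(1) by (simp add: W_def)
qed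

lemma sum_list_index_shift:
  fixes h :: "real \<Rightarrow> real"
  shows "length as = n \<Longrightarrow> (\<Sum>i=1..n. h (as ! (i - 1))) = sum_list (map h as)"
proof (induction as arbitrary: n rule: rev_induct)
  case (snoc a as)
  have "(\<Sum>i=1..length as. h ((as @ [a]) ! (i - 1))) = (\<Sum>i=1..length as. h (as ! (i - 1)))"
    by (intro sum.cong) (auto simp: nth_append)
  then show ?case using snoc by auto
qed simp

lemma prod_list_index_shift:
  fixes h :: "real \<Rightarrow> real"
  shows "length as = n \<Longrightarrow> (\<Prod>i=1..n. h (as ! (i - 1))) = prod_list (map h as)"
proof (induction as arbitrary: n rule: rev_induct)
  case (snoc a as)
  have "(\<Prod>i=1..length as. h ((as @ [a]) ! (i - 1))) = (\<Prod>i=1..length as. h (as ! (i - 1)))"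
    by (intro prod.cong) (auto simp: nth_append)
  then show ?case using snoc by auto
qed simp

lemma JM_eigenvector_psum:
  assumes "JM_eigenvector n as v" "v \<in> psum_eigenspace n \<pi>" "k \<le> n"
  shows "\<pi> k = sum_list (map (\<lambda>a. a ^ k) as)"
proof -
  have v: "length as = n" "v \<noteq> (\<lambda>_. 0)" using assms by (auto simp: JM_eigenvector_def)
  have "(JM i ^^ k) v = (\<lambda>x. (as ! (i - 1)) ^ k * v x)" if i: "i \<in> {1..n}" for i k
  proof (induction k)
    case (Suc k)
    have "(JM i ^^ Suc k) v = (\<lambda>x. (as ! (i - 1)) ^ k * JM i v x)"
      using Suc by (simp add: JM_scale)
    also have "JM i v = (\<lambda>x. as ! (i - 1) * v x)"
      using assms(1) i by (simp add: JM_eigenvector_def)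
    finally show ?case by (simp add: mult.assoc mult.left_commute)
  qed simp
  then have "JM_psum n k v = (\<lambda>x. (\<Sum>i\<in>{1..n}. (as ! (i - 1)) ^ k) * v x)"
    by (simp add: JM_psum_def sum_distrib_right)
  moreover have "JM_psum n k v = (\<lambda>x. \<pi> k * v x)" using assms by (simp add: psum_eigenspace_def)
  moreover obtain x where "v x \<noteq> 0" using v(2) by auto
  ultimately have "\<pi> k = (\<Sum>i\<in>{1..n}. (as ! (i - 1)) ^ k)" by (metis mult_right_cancel)
  also have "\<dots> = sum_list (map (\<lambda>a. a ^ k) as)" by (rule sum_list_index_shift[OF v(1)])
  finally show ?thesis .
qed

lemma num_cycles_conj:
  assumes "r permutes S"
  shows "num_cycles S (r \<circ> x \<circ> inv' r) = num_cycles S x"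
proof -
  have inj: "inj r" and rinv: "\<And>z. inv' r (r z) = z" "\<And>z. r (inv' r z) = z"
    using permutes_inj[OF assms] permutes_inverses[OF assms] by auto
  have image: "cyclic_on (q \<circ> x \<circ> inv' q) (q ` C)" "q ` C \<subseteq> S"
    if "cyclic_on x C" "C \<subseteq> S" "q permutes S" for q x C
  proof -
    show "cyclic_on (q \<circ> x \<circ> inv' q) (q ` C)"
      using that by (intro cyclic_on_image) (simp_all add: permutes_inverses)
    show "q ` C \<subseteq> S" using that permutes_image by blast
  qed
  have "{C. C \<subseteq> S \<and> cyclic_on (r \<circ> x \<circ> inv' r) C} = (`) r ` {C. C \<subseteq> S \<and> cyclic_on x C}"
  proof (intro equalityI subsetI)
    fix D assume D: "D \<in> {C. C \<subseteq> S \<and> cyclic_on (r \<circ> x \<circ> inv' r) C}"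
    have eq: "inv' r \<circ> (r \<circ> x \<circ> inv' r) \<circ> inv' (inv' r) = x"
      using rinv by (simp add: fun_eq_iff permutes_inv_inv[OF assms])
    have "cyclic_on x (inv' r ` D)" "inv' r ` D \<subseteq> S"
      using image[of "r \<circ> x \<circ> inv' r" D "inv' r"] D permutes_inv[OF assms] by (simp_all only: eq mem_Collect_eq)
    moreover have "r ` (inv' r ` D) = D" using rinv by (force simp: image_image)
    ultimately show "D \<in> (`) r ` {C. C \<subseteq> S \<and> cyclic_on x C}" by blast
  next
    fix D assume "D \<in> (`) r ` {C. C \<subseteq> S \<and> cyclic_on x C}"
    then show "D \<in> {C. C \<subseteq> S \<and> cyclic_on (r \<circ> x \<circ> inv' r) C}" using image assms by blast
  qed
  moreover have "inj_on ((`) r) {C. C \<subseteq> S \<and> cyclic_on x C}"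
    using inj by (auto intro!: inj_onI simp: inj_image_eq_iff)
  ultimately show ?thesis by (simp add: num_cycles_def card_image)
qed

lemma class_function_num_cycles: "class_function n (\<lambda>y. h (num_cycles {1..n} y))"
  by (simp add: class_function_def num_cycles_conj)

lemma conv_JM_eigenvector:
  assumes "JM_eigenvector n as v"
  shows "conv n (\<lambda>y. t ^ num_cycles {1..n} y) v = (\<lambda>x. prod_list (map (\<lambda>a. t + a) as) * v x)"
proof
  fix x
  have "conv n (\<lambda>y. t ^ num_cycles {1..n} y) v x = (\<Prod>i=1..n. t + as ! (i - 1)) * v x"
    unfolding conv_def using assms
    by (intro JM_generating_function) (simp add: JM_eigenvector_def)
  also have "(\<Prod>i=1..n. t + as ! (i - 1)) = prod_list (map (\<lambda>a. t + a) as)"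
    using assms by (intro prod_list_index_shift) (simp add: JM_eigenvector_def)
  finally show "conv n (\<lambda>y. t ^ num_cycles {1..n} y) v x = prod_list (map (\<lambda>a. t + a) as) * v x" .
qed

text \<open>The reproducing kernel of the class functions at \<open>z\<close>, \<open>x\<close>
  counts the \<open>r\<close> conjugating \<open>x\<close> to \<open>z\<close>, divided by
  \<open>n!\<close>. The trace evaluates it at \<open>z = y \<circ> x\<close>, where
  \<open>r \<circ> x \<circ> inv' r = y \<circ> x\<close> says that \<open>y\<close> is a
  commutator.\<close>

lemma commutator_sum_eq_trace:
  assumes B: "finite B" "B \<subseteq> class_functions n"
    and basis: "\<And>w. w \<in> class_functions n \<Longrightarrow> w = (\<lambda>x. \<Sum>b\<in>B. inner_on (sym_carrier n) b w * b x)"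
    and eig: "\<And>b. b \<in> B \<Longrightarrow> inner_on (sym_carrier n) b b = 1 \<and> conv n g b = (\<lambda>x. c b * b x)"
  shows "(\<Sum>x\<in>sym_carrier n. \<Sum>r\<in>sym_carrier n. g (r \<circ> x \<circ> inv' r \<circ> inv' x)) = fact n * (\<Sum>b\<in>B. c b)"
proof -
  let ?G = "sym_carrier n"
  \<comment> \<open>\<open>n!\<close> times the reproducing kernel, as \<open>kernel\<close>
    shows.\<close>
  define D where "D z x = (if x permutes {1..n} then \<Sum>r\<in>?G. (if r \<circ> x \<circ> inv' r = z then 1 else 0) else (0::real))" for z x
  have kernel: "(\<Sum>b\<in>B. b z * b x) * fact n = D z x" if z: "z \<in> ?G" for z x
  proof -
    have "D z (q \<circ> x \<circ> inv' q) = D z x" if x: "x permutes {1..n}" and q: "q permutes {1..n}" for q x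
    proof -
      have "q \<circ> x \<circ> inv' q permutes {1..n}" using x q permutes_inv[OF q] by (intro permutes_compose)
      then have "D z (q \<circ> x \<circ> inv' q) =
          (\<Sum>r\<in>?G. (if (r \<circ> q) \<circ> x \<circ> inv' (r \<circ> q) = z then 1 else 0))"
        unfolding D_def by (simp add: inv_comp_permutes[OF _ q] comp_assoc)
      also have "\<dots> = D z x"
        unfolding D_def using x
        by (subst sum_sym_carrier_comp_right[OF q, of "\<lambda>r. if r \<circ> x \<circ> inv' r = z then 1 else 0"]) simp
      finally show ?thesis .
    qed
    then have "D z \<in> class_functions n"
      by (simp add: class_functions_def class_function_def perm_functions_def D_def)
    moreover have "inner_on ?G b (D z) = fact n * b z" if b: "b \<in> B" for b
    proof -
      have "inner_on ?G b (D z) = (\<Sum>x\<in>?G. \<Sum>r\<in>?G. if r \<circ> x \<circ> inv' r = z then b x else 0)"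
        by (auto simp: inner_on_def D_def sum_distrib_left intro!: sum.cong)
      also have "\<dots> = (\<Sum>r\<in>?G. \<Sum>x\<in>?G. if r \<circ> x \<circ> inv' r = z then b (r \<circ> x \<circ> inv' r) else 0)"
      proof -
        have eq: "b x = b (r \<circ> x \<circ> inv' r)" if "r \<in> ?G" "x \<in> ?G" for r x
        proof -
          have "class_function n b" using b B(2) by (auto simp: class_functions_def)
          then show ?thesis using that unfolding class_function_def by simp
        qed
        show ?thesis by (subst sum.swap) (intro sum.cong refl if_cong eq)
      qed
      also have "\<dots> = (\<Sum>r\<in>?G. \<Sum>x\<in>?G. if x = z then b x else 0)"
        by (intro sum.cong refl sum_sym_carrier_conj) auto
      also have "\<dots> = fact n * b z"
        using z card_permutations[of "{1..n}" n] finite_sym_carrier[of n] by simp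
      finally show ?thesis .
    qed
    ultimately show ?thesis
      using fun_cong[OF basis[of "D z"], of x]
      by (simp add: sum_distrib_right sum_distrib_left mult_ac)
  qed
  have "fact n * (\<Sum>b\<in>B. c b) = (\<Sum>b\<in>B. fact n * inner_on ?G b (conv n g b))"
  proof (unfold sum_distrib_left, intro sum.cong refl)
    fix b assume b: "b \<in> B"
    have "inner_on ?G b (conv n g b) = c b * inner_on ?G b b"
      using eig[OF b] inner_on_lin_right[of ?G b "c b" b 0 b] by simp
    then show "fact n * c b = fact n * inner_on ?G b (conv n g b)" using eig[OF b] by simp
  qed
  also have "\<dots> = (\<Sum>b\<in>B. \<Sum>x\<in>?G. \<Sum>y\<in>?G. g y * (b x * b (y \<circ> x) * fact n))"
    by (simp add: inner_on_def conv_def sum_distrib_left mult_ac)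
  also have "\<dots> = (\<Sum>x\<in>?G. \<Sum>y\<in>?G. g y * ((\<Sum>b\<in>B. b x * b (y \<circ> x)) * fact n))"
    by (subst sum.swap, intro sum.cong refl, subst sum.swap)
      (simp add: sum_distrib_left sum_distrib_right)
  also have "\<dots> = (\<Sum>x\<in>?G. \<Sum>y\<in>?G. g y * D (y \<circ> x) x)"
  proof (intro sum.cong refl)
    fix x y assume "x \<in> ?G" "y \<in> ?G"
    then have "y \<circ> x \<in> ?G" by (simp add: permutes_compose)
    from kernel[OF this, of x] show "g y * ((\<Sum>b\<in>B. b x * b (y \<circ> x)) * fact n) = g y * D (y \<circ> x) x"
      by (simp add: mult.commute)
  qed
  also have "\<dots> = (\<Sum>x\<in>?G. \<Sum>r\<in>?G. \<Sum>y\<in>?G. if y = r \<circ> x \<circ> inv' r \<circ> inv' x then g y else 0)"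
  proof (rule sum.cong[OF refl])
    fix x assume x: "x \<in> ?G"
    have iff: "r \<circ> x \<circ> inv' r = y \<circ> x \<longleftrightarrow> y = r \<circ> x \<circ> inv' r \<circ> inv' x" for r y
    proof
      assume "r \<circ> x \<circ> inv' r = y \<circ> x"
      then have "r \<circ> x \<circ> inv' r \<circ> inv' x = y \<circ> (x \<circ> inv' x)" by (simp only: comp_assoc)
      then show "y = r \<circ> x \<circ> inv' r \<circ> inv' x" using permutes_inv_o(1)[of x "{1..n}"] x by simp
    next
      assume "y = r \<circ> x \<circ> inv' r \<circ> inv' x"
      then have "y \<circ> x = r \<circ> x \<circ> inv' r \<circ> (inv' x \<circ> x)" by (simp only: comp_assoc)
      then show "r \<circ> x \<circ> inv' r = y \<circ> x" using permutes_inv_o(2)[of x "{1..n}"] x by simp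
    qed
    have "(\<Sum>y\<in>?G. g y * D (y \<circ> x) x) =
        (\<Sum>y\<in>?G. \<Sum>r\<in>?G. if y = r \<circ> x \<circ> inv' r \<circ> inv' x then g y else 0)"
      using x by (auto simp: D_def iff sum_distrib_left intro!: sum.cong)
    also have "\<dots> = (\<Sum>r\<in>?G. \<Sum>y\<in>?G. if y = r \<circ> x \<circ> inv' r \<circ> inv' x then g y else 0)"
      by (rule sum.swap)
    finally show "(\<Sum>y\<in>?G. g y * D (y \<circ> x) x) = \<dots>" .
  qed
  also have "\<dots> = (\<Sum>x\<in>?G. \<Sum>r\<in>?G. g (r \<circ> x \<circ> inv' r \<circ> inv' x))"
  proof (intro sum.cong refl)
    fix x r assume "x \<in> ?G" "r \<in> ?G"
    then have "r \<circ> x \<circ> inv' r \<circ> inv' x \<in> ?G"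
      using permutes_inv by (auto intro!: permutes_compose)
    then show "(\<Sum>y\<in>?G. if y = r \<circ> x \<circ> inv' r \<circ> inv' x then g y else 0) = g (r \<circ> x \<circ> inv' r \<circ> inv' x)"
      using finite_sym_carrier[of n] by simp
  qed
  finally show ?thesis by simp
qed

section \<open>Multiplicity-free spectrum and the commutator polynomial\<close>

definition JM_spectrum :: "nat \<Rightarrow> real list set" where
  "JM_spectrum n = {as. \<exists>v. JM_eigenvector n as v}"

lemma JM_spectrum_length: "as \<in> JM_spectrum n \<Longrightarrow> length as = n"
  by (auto simp: JM_spectrum_def JM_eigenvector_def)

lemmas JM_spectrum_ov = okounkov_vershik_JM[folded JM_spectrum_def]

text \<open>Without the content \<open>- 1\<close> the main diagonal has at most one box, so all
  multiplicities are at most one and the diagram is a single row.\<close>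

lemma JM_spectrum_no_minus_one:
  assumes "as \<in> JM_spectrum n" "- 1 \<notin> set as"
  shows "mset as = image_mset real (mset_set {..<n})"
proof (cases "n = 0")
  case False
  then have ne: "as \<noteq> []" using JM_spectrum_length[OF assms(1)] by auto
  note count = ov_count[OF JM_spectrum_ov assms(1) ne]
  obtain l u where lu: "l \<le> 0" "0 \<le> u" "set as = real_of_int ` {l..u}"
    using ov_prefix_interval[OF JM_spectrum_ov[of n], of as "[]"] assms(1) ne by auto
  have "l = 0"
  proof (rule ccontr)
    assume "l \<noteq> 0"
    then have "- 1 \<in> {l..u}" using lu by auto
    then have "real_of_int (- 1) \<in> set as" using lu(3) by blast
    then show False using assms(2) by simp
  qed
  have c0: "count_list as 0 \<le> 1" using count(4) assms(2) by (simp add: count_list_0_iff)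
  have le1: "count_list as (real m) \<le> 1" for m
  proof (induction m)
    case (Suc m)
    have "count_list as (real_of_int (int m + 1)) \<le> count_list as (real_of_int (int m))"
      by (rule count(2)) simp
    then show ?case using Suc by (simp add: add.commute)
  qed (use c0 in simp)
  have set: "set as = real ` {..nat u}"
  proof -
    have "{0..u} = int ` {..nat u}"
      using lu(2) by (auto simp: image_iff intro!: bexI[of _ "nat _"])
    then have "set as = (\<lambda>m. real_of_int (int m)) ` {..nat u}"
      unfolding lu(3) \<open>l = 0\<close> by (simp only: image_image)
    then show ?thesis by simp
  qed
  have "count (mset as) x = (if x \<in> set as then 1 else 0)" for x
  proof (cases "x \<in> set as")
    case True
    then obtain m where m: "x = real m" using set by auto
    have "count_list as x \<noteq> 0" using True by (simp add: count_list_0_iff)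
    then have "count_list as x = 1" using le1[of m] m by simp
    then show ?thesis using True by (simp add: count_mset)
  qed (simp add: count_mset count_list_0_iff)
  then have "distinct as" by (simp add: distinct_count_atmost_1)
  then have "mset as = mset_set (real ` {..nat u})" using set by (metis mset_set_set)
  then have eq: "mset as = image_mset real (mset_set {..nat u})"
    by (simp add: image_mset_mset_set inj_on_def)
  then have "size (mset as) = size (image_mset real (mset_set {..nat u}))" by simp
  then have "n = Suc (nat u)" using JM_spectrum_length[OF assms(1)] by simp
  then show ?thesis using eq by (simp add: lessThan_Suc_atMost)
qed (use assms JM_spectrum_length in auto)

text \<open>\<open>M\<close> collects the content lists of the basis functions except the trivial
  one; injectivity of \<open>mset\<close> on it expresses multiplicity one.\<close>

theorem commutator_cycle_polynomial:
  obtains M where "finite M" "M \<subseteq> JM_spectrum n" "inj_on mset M" "\<forall>as\<in>M. - 1 \<in> set as"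
    "\<And>t. (\<Sum>x\<in>sym_carrier n. \<Sum>r\<in>sym_carrier n. t ^ num_cycles {1..n} (r \<circ> x \<circ> inv' r \<circ> inv' x)) =
       fact n * ((\<Prod>i<n. t + real i) + (\<Sum>as\<in>M. prod_list (map (\<lambda>a. t + a) as)))"
proof -
  let ?X = "sym_carrier n"
  define As where "As = map (JM_psum n) [0..<Suc n]"
  have sym: "symmetric_op ?X (class_functions n) A" if "A \<in> set As" for A
    using that JM_psum_symmetric by (auto simp: As_def simp del: upt_Suc)
  have comm: "A (C f) = C (A f)" 
    if "A \<in> set As" "C \<in> set As" "f \<in> class_functions n" for A C f
    using that JM_psum_commute by (auto simp: As_def simp del: upt_Suc)
  obtain B where B: "finite B" "B \<subseteq> class_functions n" "orthonormal_on ?X B"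
    "\<And>b A. b \<in> B \<Longrightarrow> A \<in> set As \<Longrightarrow> \<exists>a. A b = (\<lambda>x. a * b x)"
    "\<And>w. w \<in> class_functions n \<Longrightarrow> w = (\<lambda>x. \<Sum>b\<in>B. inner_on ?X b w * b x)"
  proof (rule joint_eigenbasis[of ?X "class_functions n" As])
    show "finite ?X" by (rule finite_sym_carrier)
    show "fun_subspace ?X (class_functions n)" by (rule fun_subspace_class_functions)
    show "symmetric_op ?X (class_functions n) A" if "A \<in> set As" for A using that by (rule sym)
    show "A (C f) = C (A f)" if "A \<in> set As" "C \<in> set As" "f \<in> class_functions n" for A C f
      using that by (rule comm)
  qed (rule that)
  have Bp: "b \<in> perm_functions n" "class_function n b" if "b \<in> B" for b
    using B(2) that unfolding class_functions_def by blast+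
  have bb: "inner_on ?X b b = 1" if "b \<in> B" for b using B(3) that by (simp add: orthonormal_on_def)
  have "\<forall>b\<in>B. \<forall>k\<in>{..n}. \<exists>a. JM_psum n k b = (\<lambda>x. a * b x)"
    using B(4) by (simp add: As_def less_Suc_eq_le del: upt_Suc)
  then obtain \<pi> where \<pi>: "\<And>b k. b \<in> B \<Longrightarrow> k \<le> n \<Longrightarrow> JM_psum n k b = (\<lambda>x. \<pi> b k * b x)"
    by (metis atMost_iff)
  have bE: "b \<in> psum_eigenspace n (\<pi> b)" if "b \<in> B" for b
    using Bp \<pi> that by (simp add: psum_eigenspace_def)
  have "\<exists>as v. JM_eigenvector n as v \<and> v \<in> psum_eigenspace n (\<pi> b)" if b: "b \<in> B" for b
  proof -
    have "b \<noteq> (\<lambda>_. 0)" using bb[OF b] by (auto simp: inner_on_def)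
    then show ?thesis using psum_eigenspace_JM_eigenvector[OF bE[OF b]] by blast
  qed
  then obtain L V where LV: "\<And>b. b \<in> B \<Longrightarrow> JM_eigenvector n (L b) (V b)"
      "\<And>b. b \<in> B \<Longrightarrow> V b \<in> psum_eigenspace n (\<pi> b)"
    by metis
  have \<pi>L: "\<pi> b k = sum_list (map (\<lambda>a. a ^ k) (L b))" if "b \<in> B" "k \<le> n" for b k
    using JM_eigenvector_psum LV that by blast
  define g where "g t = (\<lambda>y. t ^ num_cycles {1..n} y)" for t :: real
  have g: "class_function n (g t)" for t unfolding g_def by (rule class_function_num_cycles)
  define c where "c t as = prod_list (map (\<lambda>a. t + a) as)" for t :: real and as
  have conv_g: "conv n (g t) f = (\<lambda>x. c t (L b) * f x)"
    if b: "b \<in> B" and f: "f \<in> psum_eigenspace n (\<pi> b)" for b t f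
  proof -
    obtain e where e: "\<And>f. f \<in> psum_eigenspace n (\<pi> b) \<Longrightarrow> conv n (g t) f = (\<lambda>x. e * f x)"
      using conv_scalar[OF g] by blast
    have "(\<lambda>x. e * V b x) = (\<lambda>x. c t (L b) * V b x)"
      using e[OF LV(2)[OF b]] conv_JM_eigenvector[OF LV(1)[OF b], of t] by (simp add: g_def c_def)
    moreover obtain x where "V b x \<noteq> 0" using LV(1)[OF b] by (auto simp: JM_eigenvector_def)
    ultimately have "e = c t (L b)" by (metis mult_right_cancel)
    then show ?thesis using e[OF f] by simp
  qed
  have id: "id \<in> ?X" by (simp add: permutes_id del: id_apply)
  have conv_id: "conv n f h id = inner_on ?X f h" for f h
    by (simp only: conv_def inner_on_def o_id)
  \<comment> \<open>If \<open>b\<close> and \<open>b'\<close> shared an eigenspace, convolution by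
    either would be scalar on both. At \<open>id\<close> convolution is the inner product, so
    orthonormality makes \<open>b' id\<close> zero through \<open>b\<close> but nonzero through
    \<open>b'\<close>.\<close>
  have inj_mset: "b = b'" if b: "b \<in> B" "b' \<in> B" and m: "mset (L b) = mset (L b')" for b b'
  proof (rule ccontr)
    assume "b \<noteq> b'"
    have "\<pi> b k = \<pi> b' k" if "k \<le> n" for k
    proof -
      have "sum_list (map (\<lambda>a. a ^ k) (L b)) = sum_list (map (\<lambda>a. a ^ k) (L b'))"
        using m by (metis mset_map sum_mset_sum_list)
      then show ?thesis using \<pi>L b that by simp
    qed
    then have b'E: "b' \<in> psum_eigenspace n (\<pi> b)"
      using bE[OF b(2)] by (simp add: psum_eigenspace_def)
    obtain e where e: "\<And>f. f \<in> psum_eigenspace n (\<pi> b) \<Longrightarrow> conv n b f = (\<lambda>x. e * f x)"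
      using conv_scalar[OF Bp(2)[OF b(1)]] by blast
    obtain e' where e': "\<And>f. f \<in> psum_eigenspace n (\<pi> b) \<Longrightarrow> conv n b' f = (\<lambda>x. e' * f x)"
      using conv_scalar[OF Bp(2)[OF b(2)]] by blast
    have "e * b id = 1" using fun_cong[OF e[OF bE[OF b(1)]], of id] conv_id bb[OF b(1)] by metis
    moreover have "e * b' id = 0"
      using fun_cong[OF e[OF b'E], of id] conv_id[of b b'] B(3) b \<open>b \<noteq> b'\<close>
      by (metis orthonormal_on_def)
    moreover have "e' * b' id = 1" using fun_cong[OF e'[OF b'E], of id] conv_id bb[OF b(2)] by metis
    ultimately show False by auto
  qed
  \<comment> \<open>The trivial character, whose eigenvalue under \<open>JM i\<close> is the number
    of terms.\<close>
  define u where "u = (\<lambda>x. if x permutes {1..n} then 1 else 0 :: real)"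
  have JMu: "JM i u = (\<lambda>x. real (i - 1) * u x)" if "i \<le> n" for i
  proof
    fix x
    have "u (exch j i \<circ> x) = u x" if j: "j \<in> {1..<i}" for j
    proof -
      have "exch j i permutes {1..n}" using j \<open>i \<le> n\<close> by (intro exch_permutes) auto
      then show ?thesis by (simp add: u_def permutes_comp_iff)
    qed
    then show "JM i u x = real (i - 1) * u x" by (simp add: JM_def)
  qed
  have u_class: "u \<in> class_functions n"
    by (auto simp: class_functions_def class_function_def perm_functions_def u_def
        intro: permutes_compose permutes_inv)
  have psum_u: "\<exists>a. JM_psum n k u = (\<lambda>x. a * u x)" for k
  proof -
    have "(JM i ^^ k) u = (\<lambda>x. real (i - 1) ^ k * u x)" if "i \<in> {1..n}" for i k
    proof (induction k)
      case (Suc k)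
      have "(JM i ^^ Suc k) u = (\<lambda>x. real (i - 1) ^ k * JM i u x)" using Suc by (simp add: JM_scale)
      then show ?case using JMu[of i] that by (simp add: mult_ac)
    qed simp
    then have "JM_psum n k u = (\<lambda>x. (\<Sum>i\<in>{1..n}. real (i - 1) ^ k) * u x)"
      by (simp add: JM_psum_def sum_distrib_right)
    then show ?thesis by blast
  qed
  have "\<exists>b\<in>B. inner_on ?X b u \<noteq> 0"
  proof (rule ccontr)
    assume "\<not> ?thesis"
    then have "u id = 0" using fun_cong[OF B(5)[OF u_class], of id] by simp
    then show False using id unfolding u_def by (simp only: mem_Collect_eq if_True)
  qed
  then obtain b0 where b0: "b0 \<in> B" "inner_on ?X b0 u \<noteq> 0" by blast
  \<comment> \<open>The power sums are symmetric, so nonorthogonal eigenfunctions have equal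
    eigenvalues.\<close>
  have uE: "u \<in> psum_eigenspace n (\<pi> b0)"
  proof -
    have "JM_psum n k u = (\<lambda>x. \<pi> b0 k * u x)" if k: "k \<le> n" for k
    proof -
      obtain a where a: "JM_psum n k u = (\<lambda>x. a * u x)" using psum_u by blast
      have "a * inner_on ?X b0 u = inner_on ?X b0 (JM_psum n k u)"
        using inner_on_lin_right[of ?X b0 a u 0 u] by (simp add: a)
      also have "\<dots> = inner_on ?X (JM_psum n k b0) u"
        using JM_psum_inner[of b0 n u k] Bp(1)[OF b0(1)] u_class by (simp add: class_functions_def)
      also have "\<dots> = \<pi> b0 k * inner_on ?X b0 u"
        using inner_on_lin_left[of ?X "\<pi> b0 k" b0 0 b0 u] \<pi>[OF b0(1) k] by simp
      finally have "a = \<pi> b0 k" using b0(2) by simp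
      then show ?thesis using a by simp
    qed
    then show ?thesis using u_class by (simp add: psum_eigenspace_def class_functions_def)
  qed
  have c0: "c t (L b0) = (\<Prod>i<n. t + real i)" for t
  proof -
    have "conv n (g t) u id = (\<Prod>i=1..n. t + real (i - 1)) * u id"
      unfolding conv_def g_def by (intro JM_generating_function JMu) simp
    also have "(\<Prod>i=1..n. t + real (i - 1)) = (\<Prod>i<n. t + real i)"
      by (rule prod.reindex_bij_witness[of _ Suc "\<lambda>i. i - 1"]) auto
    finally have 1: "conv n (g t) u id = (\<Prod>i<n. t + real i) * u id" .
    have 2: "conv n (g t) u id = c t (L b0) * u id"
      using fun_cong[OF conv_g[OF b0(1) uE]] .
    have "u id = 1" unfolding u_def using id by (simp only: mem_Collect_eq if_True)
    then show ?thesis using 1 2 by (simp only: mult_1_right)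
  qed
  have LS: "L b \<in> JM_spectrum n" if "b \<in> B" for b using LV(1)[OF that] unfolding JM_spectrum_def by blast
  \<comment> \<open>At \<open>t = 1\<close> the product for \<open>b0\<close> has positive factors
    only, whereas an entry \<open>- 1\<close> would make it vanish.\<close>
  have no0: "- 1 \<notin> set (L b0)"
  proof
    assume "- 1 \<in> set (L b0)"
    then have "c 1 (L b0) = 0" by (force simp: c_def prod_list_zero_iff)
    moreover have "c 1 (L b0) \<noteq> 0" unfolding c0 by (auto simp: prod_zero_iff)
    ultimately show False by contradiction
  qed
  have injL: "inj_on L B"
  proof (rule inj_onI)
    fix b b' assume "b \<in> B" "b' \<in> B" "L b = L b'"
    then show "b = b'" using inj_mset[of b b'] by simp
  qed
  define M where "M = L ` (B - {b0})"
  show thesis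
  proof (rule that[of M])
    show "finite M" using B(1) by (simp add: M_def)
    show "M \<subseteq> JM_spectrum n" using LS by (auto simp: M_def)
    show "inj_on mset M" using inj_mset by (auto simp: M_def inj_on_def)
    show "\<forall>as\<in>M. - 1 \<in> set as"
    proof (rule ballI, rule ccontr)
      fix as assume "as \<in> M" and no: "- 1 \<notin> set as"
      then obtain b where b: "b \<in> B" "b \<noteq> b0" "as = L b" by (auto simp: M_def)
      have "mset (L b) = mset (L b0)"
        using JM_spectrum_no_minus_one[OF LS[OF b(1)]] JM_spectrum_no_minus_one[OF LS[OF b0(1)] no0] no b(3)
        by simp
      then show False using inj_mset b b0 by blast
    qed
    show "(\<Sum>x\<in>?X. \<Sum>r\<in>?X. t ^ num_cycles {1..n} (r \<circ> x \<circ> inv' r \<circ> inv' x)) =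
       fact n * ((\<Prod>i<n. t + real i) + (\<Sum>as\<in>M. prod_list (map (\<lambda>a. t + a) as)))" for t
    proof -
      have "(\<Sum>x\<in>?X. \<Sum>r\<in>?X. g t (r \<circ> x \<circ> inv' r \<circ> inv' x)) = fact n * (\<Sum>b\<in>B. c t (L b))"
        by (rule commutator_sum_eq_trace[OF B(1,2)]) (use B(5) bb conv_g bE in blast)+
      also have "(\<Sum>b\<in>B. c t (L b)) = c t (L b0) + (\<Sum>b\<in>B - {b0}. c t (L b))"
        using B(1) b0(1) by (rule sum.remove)
      also have "(\<Sum>b\<in>B - {b0}. c t (L b)) = (\<Sum>as\<in>M. c t as)"
        unfolding M_def using injL by (subst sum.reindex) (auto intro: inj_on_subset)
      finally show ?thesis by (simp only: c0 g_def, simp only: c_def)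
    qed
  qed
qed

section \<open>Estimates for products over contents\<close>

text \<open>The \<open>d\<close> zero entries shift the degree by \<open>d\<close>. The remaining
  coefficient is the product of the nonzero entries times an elementary symmetric function of degree
  \<open>k - d\<close> in their reciprocals, bounded by a power of the sum of the absolute
  reciprocals.\<close>

lemma coeff_linear_factors_bound:
  fixes bs :: "real list"
  defines "d \<equiv> count_list bs 0"
  shows "\<bar>coeff (prod_list (map (\<lambda>b. [:b, 1:]) bs)) k\<bar> \<le>
    (if k < d then 0 else prod_list (map abs (filter (\<lambda>b. b \<noteq> 0) bs)) *
      sum_list (map (\<lambda>b. 1 / \<bar>b\<bar>) (filter (\<lambda>b. b \<noteq> 0) bs)) ^ (k - d))"
  unfolding d_def
proof (induction bs arbitrary: k)
  case Nil
  then show ?case by (simp add: coeff_1)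
next
  case (Cons b bs)
  let ?q = "prod_list (map (\<lambda>b. [:b, 1:]) bs)"
  define d where "d = count_list bs 0"
  define P where "P = prod_list (map abs (filter (\<lambda>b. b \<noteq> 0) bs))"
  define S where "S = sum_list (map (\<lambda>b. 1 / \<bar>b\<bar>) (filter (\<lambda>b. b \<noteq> 0) bs))"
  have P: "P \<ge> 0" unfolding P_def by (induction bs) auto
  have S: "S \<ge> 0" unfolding S_def by (induction bs) auto
  have IH: "\<bar>coeff ?q k\<bar> \<le> (if k < d then 0 else P * S ^ (k - d))" for k
    using Cons.IH[of k] by (simp only: d_def P_def S_def)
  have coeff: "coeff (prod_list (map (\<lambda>b. [:b, 1:]) (b # bs))) k =
      b * coeff ?q k + (case k of 0 \<Rightarrow> 0 | Suc j \<Rightarrow> coeff ?q j)"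
    by (simp add: coeff_pCons)
  show ?case
  proof (cases "b = 0")
    case True
    show ?thesis
    proof (cases k)
      case 0
      then show ?thesis using True by (simp add: coeff)
    next
      case (Suc j)
      then show ?thesis
        using True IH[of j] by (simp add: coeff flip: d_def P_def S_def split: if_splits)
    qed
  next
    case False
    define u where "u = 1 / \<bar>b\<bar>"
    have u: "u > 0" "\<bar>b\<bar> * u = 1" using False by (auto simp: u_def)
    have "\<bar>b * coeff ?q k + (case k of 0 \<Rightarrow> 0 | Suc j \<Rightarrow> coeff ?q j)\<bar> \<le>
        (if k < d then 0 else \<bar>b\<bar> * P * (u + S) ^ (k - d))"
    proof (cases "k \<le> d")
      case True
      have "(case k of 0 \<Rightarrow> 0 | Suc j \<Rightarrow> coeff ?q j) = 0"
        using IH[of "k - 1"] True by (cases k) auto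
      then show ?thesis
        using IH[of k] True by (auto simp: abs_mult mult.assoc intro!: mult_left_mono)
    next
      case False
      then obtain m where m: "k = Suc (d + m)" using less_imp_Suc_add by (metis not_le)
      have "\<bar>b * coeff ?q k + coeff ?q (d + m)\<bar> \<le> \<bar>b\<bar> * \<bar>coeff ?q k\<bar> + \<bar>coeff ?q (d + m)\<bar>"
        by (simp add: abs_mult[symmetric] abs_triangle_ineq)
      also have "\<dots> \<le> \<bar>b\<bar> * (P * S ^ Suc m) + P * S ^ m"
        using IH[of k] IH[of "d + m"] m by (intro add_mono mult_left_mono) auto
      also have "\<dots> = \<bar>b\<bar> * P * (S ^ Suc m + u * S ^ m)"
        using u(2) by (simp add: algebra_simps)
      also have "\<dots> = \<bar>b\<bar> * P * ((u + S) * S ^ m)"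
        by (simp add: algebra_simps)
      also have "\<dots> \<le> \<bar>b\<bar> * P * ((u + S) * (u + S) ^ m)"
        using u S P by (intro mult_left_mono power_mono) auto
      finally show ?thesis using m by simp
    qed
    then show ?thesis
      using False unfolding coeff
      by (cases "k < d") (simp_all add: u_def flip: d_def P_def S_def)
  qed
qed

text \<open>Passage to the conjugate partition: \<open>f\<close> gives column heights and
  \<open>R\<close> row lengths. A row of length \<open>R j\<close> contributes
  \<open>1 * 2 * ... * R j\<close>, and conjugating twice recovers \<open>f\<close>.\<close>

lemma antitone_level_prod:
  fixes f :: "nat \<Rightarrow> nat"
  assumes "antimono f" "\<And>c. c < N \<Longrightarrow> f c \<le> K"
  defines "R \<equiv> (\<lambda>j. card {c. c < N \<and> j < f c})"
  shows "(\<Prod>c<N. real (Suc c) ^ f c) = (\<Prod>j<K. fact (R j))"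
    and "(\<Sum>c<N. f c) = (\<Sum>j<K. R j)"
    and "\<And>c. c < N \<Longrightarrow> f c = card {j. j < K \<and> c < R j}"
proof -
  \<comment> \<open>As \<open>f\<close> is antitone, each level set is an initial segment and is
    determined by its size.\<close>
  have level: "{c. c < N \<and> j < f c} = {..<R j}" for j
  proof -
    let ?L = "{c. c < N \<and> j < f c}"
    have down: "c' \<in> ?L" if "c \<in> ?L" "c' \<le> c" for c c'
      using that antimonoD[OF assms(1) that(2)] by auto
    show ?thesis
    proof (cases "?L = {}")
      case True
      then have "R j = 0" by (simp only: R_def card.empty)
      then show ?thesis using True by (simp only: lessThan_0)
    next
      case False
      have fin: "finite ?L" by simp
      define m where "m = Max ?L"
      have m: "m \<in> ?L" "\<And>c. c \<in> ?L \<Longrightarrow> c \<le> m"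
        unfolding m_def using Max_in[OF fin False] Max_ge[OF fin] by blast+
      have L: "?L = {..m}"
      proof (intro equalityI subsetI)
        show "c \<in> {..m}" if "c \<in> ?L" for c using m(2)[OF that] by simp
        show "c \<in> ?L" if "c \<in> {..m}" for c using down[OF m(1), of c] that by blast
      qed
      then have "R j = Suc m" by (simp only: R_def card_atMost)
      then show ?thesis using L by (simp only: lessThan_Suc_atMost)
    qed
  qed
  have "(\<Prod>c<N. real (Suc c) ^ f c) = (\<Prod>c<N. \<Prod>j\<in>{j. j < K \<and> j < f c}. real (Suc c))"
  proof (intro prod.cong refl)
    fix c assume "c \<in> {..<N}"
    then have "{j. j < K \<and> j < f c} = {..<f c}" using assms(2)[of c] by auto
    then show "real (Suc c) ^ f c = (\<Prod>j\<in>{j. j < K \<and> j < f c}. real (Suc c))" by simp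
  qed
  also have "\<dots> = (\<Prod>j<K. \<Prod>c\<in>{c. c < N \<and> j < f c}. real (Suc c))"
    using prod.swap_restrict[of "{..<N}" "{..<K}" "\<lambda>c j. real (Suc c)" "\<lambda>c j. j < f c"] by simp
  also have "\<dots> = (\<Prod>j<K. fact (R j))"
    unfolding level by (intro prod.cong refl) (simp add: fact_prod_Suc atLeast0LessThan)
  finally show "(\<Prod>c<N. real (Suc c) ^ f c) = (\<Prod>j<K. fact (R j))" .
  have "(\<Sum>c<N. f c) = (\<Sum>c<N. \<Sum>j\<in>{j. j < K \<and> j < f c}. 1)"
  proof (intro sum.cong refl)
    fix c assume "c \<in> {..<N}"
    then have "{j. j < K \<and> j < f c} = {..<f c}" using assms(2)[of c] by auto
    then show "f c = (\<Sum>j\<in>{j. j < K \<and> j < f c}. 1)" by simp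
  qed
  also have "\<dots> = (\<Sum>j<K. \<Sum>c\<in>{c. c < N \<and> j < f c}. 1)"
    using sum.swap_restrict[of "{..<N}" "{..<K}" "\<lambda>c j. 1::nat" "\<lambda>c j. j < f c"] by simp
  also have "\<dots> = (\<Sum>j<K. R j)" by (simp add: R_def)
  finally show "(\<Sum>c<N. f c) = (\<Sum>j<K. R j)" .
  show "f c = card {j. j < K \<and> c < R j}" if "c < N" for c
  proof -
    have iff: "c < R j \<longleftrightarrow> j < f c" for j
    proof -
      have "c \<in> {..<R j} \<longleftrightarrow> c \<in> {c. c < N \<and> j < f c}" by (simp only: level)
      then show ?thesis using that by (simp only: mem_Collect_eq lessThan_iff simp_thms)
    qed
    have "{j. j < K \<and> c < R j} = {j. j < K \<and> j < f c}" by (simp only: iff)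
    also have "\<dots> = {..<f c}" using assms(2)[OF that] by auto
    finally show ?thesis by (simp only: card_lessThan)
  qed
qed

lemma finite_compositions: "finite {xs :: nat list. length xs = r \<and> sum_list xs = N}"
proof (rule finite_subset)
  show "{xs :: nat list. length xs = r \<and> sum_list xs = N} \<subseteq> {xs. set xs \<subseteq> {..N} \<and> length xs = r}"
    using member_le_sum_list by auto
qed (simp add: finite_lists_length_eq)

text \<open>The two extreme terms give \<open>2 * fact N\<close>. Each of the \<open>N - 1\<close>
  others is at most \<open>fact (N - 1)\<close>, because inner binomial coefficients are at least
  \<open>N\<close>.\<close>

lemma sum_fact_mult_fact: "(\<Sum>x\<le>N. fact x * fact (N - x)) \<le> (3 * fact N :: real)"
proof (cases "N \<le> 1")
  case True
  then have "N = 0 \<or> N = 1" by auto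
  then show ?thesis by auto
next
  case False
  have le: "fact x * fact (N - x) \<le> (fact (N - 1) :: real)" if x: "x \<in> {1..N - 1}" for x
  proof -
    have "N \<le> N choose x"
    proof -
      have "N choose 1 \<le> N choose x"
      proof (cases "2 * x \<le> N")
        case True
        then show ?thesis using x by (intro binomial_mono) auto
      next
        case False
        then have "N choose 1 \<le> N choose (N - x)" using x by (intro binomial_mono) auto
        moreover have "x \<le> N" using x by auto
        ultimately show ?thesis using binomial_symmetric[of x N] by simp
      qed
      then show ?thesis by simp
    qed
    have "fact x * fact (N - x) * N \<le> fact x * fact (N - x) * (N choose x)"
      using \<open>N \<le> N choose x\<close> by (intro mult_left_mono) auto
    also have "\<dots> = fact N" using x by (intro binomial_fact_lemma) auto
    also have "\<dots> = fact (N - 1) * N" using False by (subst fact_reduce) auto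
    finally have "fact x * fact (N - x) \<le> (fact (N - 1) :: nat)" using False by simp
    then show ?thesis by (metis of_nat_fact of_nat_le_iff of_nat_mult)
  qed
  have "{..N} = insert 0 (insert N {1..N - 1})" using False by auto
  then have "(\<Sum>x\<le>N. fact x * fact (N - x)) = 2 * (fact N :: real) + (\<Sum>x\<in>{1..N - 1}. fact x * fact (N - x))"
    using False by simp
  also have "\<dots> \<le> 2 * fact N + (\<Sum>x\<in>{1..N - 1}. fact (N - 1))"
    using le by (intro add_mono sum_mono) auto
  also have "(\<Sum>x\<in>{1..N - 1}. fact (N - 1)) = real (N - 1) * fact (N - 1)" by simp
  also have "\<dots> \<le> real N * fact (N - 1)" by (intro mult_right_mono) auto
  also have "\<dots> = fact N" using False by (subst (2) fact_reduce) auto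
  finally show ?thesis by simp
qed

lemma sum_compositions_fact:
  "(\<Sum>xs | length xs = r \<and> sum_list xs = N. prod_list (map fact xs)) \<le> (3 ^ r * fact N :: real)"
proof (induction r arbitrary: N)
  case 0
  have "{xs :: nat list. length xs = 0 \<and> sum_list xs = N} = (if N = 0 then {[]} else {})" by auto
  then show ?case by simp
next
  case (Suc r)
  let ?C = "\<lambda>r N. {xs :: nat list. length xs = r \<and> sum_list xs = N}"
  have eq: "?C (Suc r) N = (\<lambda>(x, xs). x # xs) ` (SIGMA x:{..N}. ?C r (N - x))"
  proof (intro equalityI subsetI)
    fix ys assume "ys \<in> ?C (Suc r) N"
    then obtain x xs where "ys = x # xs" "length xs = r" "x + sum_list xs = N"
      by (cases ys) auto
    then show "ys \<in> (\<lambda>(x, xs). x # xs) ` (SIGMA x:{..N}. ?C r (N - x))"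
      by (intro image_eqI[of _ _ "(x, xs)"]) auto
  qed auto
  have "(\<Sum>xs\<in>?C (Suc r) N. prod_list (map fact xs)) =
      (\<Sum>(x, xs)\<in>(SIGMA x:{..N}. ?C r (N - x)). fact x * prod_list (map fact xs) :: real)"
    unfolding eq by (subst sum.reindex) (auto simp: inj_on_def intro!: sum.cong)
  also have "\<dots> = (\<Sum>x\<le>N. \<Sum>xs\<in>?C r (N - x). fact x * prod_list (map fact xs))"
    using finite_compositions by (subst sum.Sigma) auto
  also have "\<dots> \<le> (\<Sum>x\<le>N. fact x * (3 ^ r * fact (N - x)))"
    unfolding sum_distrib_left[symmetric] by (intro sum_mono mult_left_mono Suc.IH) auto
  also have "\<dots> = 3 ^ r * (\<Sum>x\<le>N. fact x * fact (N - x))"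
    by (simp add: sum_distrib_left mult_ac)
  also have "\<dots> \<le> 3 ^ r * (3 * fact N)"
    by (intro mult_left_mono sum_fact_mult_fact) auto
  finally show ?case by (simp add: mult_ac)
qed

text \<open>The contents other than \<open>- 1\<close> are indexed by \<open>c\<close> in two halves
  such that \<open>\<bar>1 + a\<bar> = c + 1\<close> in both.\<close>

definition content_range :: "nat \<Rightarrow> real set" where
  "content_range n = real ` {..<n} \<union> {- 1} \<union> (\<lambda>c. - 2 - real c) ` {..<n}"

lemma content_range_cases:
  assumes "a \<in> content_range n"
  obtains "a = - 1" | c where "c < n" "a = real c" | c where "c < n" "a = - 2 - real c"
  using assms by (auto simp: content_range_def)

lemma prod_list_content:
  fixes h :: "real \<Rightarrow> real"
  assumes "set as \<subseteq> content_range n"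
  shows "prod_list (map h (filter (\<lambda>a. a \<noteq> - 1) as)) =
    (\<Prod>c<n. h (real c) ^ count_list as (real c)) *
    (\<Prod>c<n. h (- 2 - real c) ^ count_list as (- 2 - real c))"
proof -
  define I where "I = real ` {..<n} \<union> (\<lambda>c. - 2 - real c) ` {..<n}"
  have I: "finite I" "- 1 \<notin> I" by (auto simp: I_def)
  have "set as \<subseteq> insert (- 1) I" using assms by (auto simp: I_def content_range_def)
  then have "prod_list (map h (filter (\<lambda>a. a \<noteq> - 1) as)) = (\<Prod>x\<in>I. h x ^ count_list as x)"
  proof (induction as)
    case (Cons a as)
    have "(\<Prod>x\<in>I. h x ^ count_list (a # as) x) =
        (\<Prod>x\<in>I. if x = a then h a else 1) * (\<Prod>x\<in>I. h x ^ count_list as x)"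
      unfolding prod.distrib[symmetric] by (intro prod.cong) auto
    then show ?case using Cons I by auto
  qed simp
  also have "\<dots> = (\<Prod>x\<in>real ` {..<n}. h x ^ count_list as x) *
      (\<Prod>x\<in>(\<lambda>c. - 2 - real c) ` {..<n}. h x ^ count_list as x)"
    unfolding I_def by (intro prod.union_disjoint) auto
  finally show ?thesis by (simp add: prod.reindex inj_on_def)
qed

text \<open>The logarithm of \<open>prod_list_content\<close> for the exponential of
  \<open>h\<close>.\<close>

lemma sum_list_content:
  fixes h :: "real \<Rightarrow> real"
  assumes "set as \<subseteq> content_range n"
  shows "sum_list (map h (filter (\<lambda>a. a \<noteq> - 1) as)) =
    (\<Sum>c<n. count_list as (real c) * h (real c)) +
    (\<Sum>c<n. count_list as (- 2 - real c) * h (- 2 - real c))"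
proof -
  have 1: "ln (exp (h a) ^ m) = real m * h a" for m :: nat and a by (simp add: ln_realpow)
  have "exp (sum_list (map h xs)) = prod_list (map (\<lambda>a. exp (h a)) xs)" for xs
    by (induction xs) (auto simp: exp_add)
  then have "exp (sum_list (map h (filter (\<lambda>a. a \<noteq> - 1) as))) =
    (\<Prod>c<n. exp (h (real c)) ^ count_list as (real c)) *
    (\<Prod>c<n. exp (h (- 2 - real c)) ^ count_list as (- 2 - real c))"
    using prod_list_content[OF assms, of "\<lambda>a. exp (h a)"] by simp
  also have "\<dots> = exp ((\<Sum>c<n. count_list as (real c) * h (real c)) +
    (\<Sum>c<n. count_list as (- 2 - real c) * h (- 2 - real c)))"
    by (simp add: exp_add exp_sum exp_of_nat_mult)
  finally show ?thesis by simp
qed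

text \<open>\<open>f1\<close> and \<open>f2\<close> are the diagonal lengths on the two sides of the
  diagonal of content \<open>- 1\<close>. That diagonal bounds them all, up to one more box on the
  side of the main diagonal.\<close>

lemma spectrum_content:
  assumes "as \<in> JM_spectrum n"
  defines "f1 \<equiv> (\<lambda>c. count_list as (real c))" and "f2 \<equiv> (\<lambda>c. count_list as (- 2 - real c))"
  shows "set as \<subseteq> content_range n" "antimono f1" "antimono f2"
    "f1 c \<le> count_list as (- 1) + 1" "f2 c \<le> count_list as (- 1)"
proof -
  have len: "length as = n" using JM_spectrum_length assms by blast
  have *: "set as \<subseteq> content_range n \<and> antimono f1 \<and> antimono f2 \<and>
    f1 0 \<le> count_list as (- 1) + 1 \<and> f2 0 \<le> count_list as (- 1)"
  proof (cases "as = []")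
    case True
    then show ?thesis by (auto simp: f1_def f2_def antimono_def)
  next
    case ne: False
    note count = ov_count[OF JM_spectrum_ov assms(1) ne]
    obtain l u where lu: "l \<le> 0" "0 \<le> u" "set as = real_of_int ` {l..u}"
      using ov_prefix_interval[OF JM_spectrum_ov[of n], of as "[]"] assms(1) ne by auto
    have "card (set as) = nat (u - l + 1)"
      unfolding lu(3) by (subst card_image) (auto simp: inj_on_def)
    then have "nat (u - l + 1) \<le> n" using card_length[of as] len by simp
    then have bounds: "u < int n" "- l < int n" using lu(1,2) by auto
    have "set as \<subseteq> content_range n"
    proof
      fix a assume "a \<in> set as"
      then obtain z where z: "a = real_of_int z" "z \<in> {l..u}" using lu(3) by auto
      consider "z \<ge> 0" | "z = - 1" | "z \<le> - 2" by linarith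
      then show "a \<in> content_range n"
      proof cases
        case 1
        then have "a = real (nat z)" "nat z < n" using z bounds by auto
        then show ?thesis by (auto simp: content_range_def)
      next
        case 3
        then have "a = - 2 - real (nat (- 2 - z))" "nat (- 2 - z) < n" using z bounds by auto
        then show ?thesis by (auto simp: content_range_def)
      qed (use z in \<open>auto simp: content_range_def\<close>)
    qed
    moreover have "antimono f1"
    proof (rule decseq_SucI)
      show "f1 (Suc c) \<le> f1 c" for c
        using count(2)[of "int c"] by (simp add: f1_def add.commute)
    qed
    moreover have "antimono f2"
    proof (rule decseq_SucI)
      show "f2 (Suc c) \<le> f2 c" for c
        using count(3)[of "- 2 - int c"] by (simp add: f2_def algebra_simps)
    qed
    moreover have "f1 0 \<le> count_list as (- 1) + 1" using count(4) by (simp add: f1_def)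
    moreover have "f2 0 \<le> count_list as (- 1)" using count(3)[of "- 1"] by (simp add: f2_def)
    ultimately show ?thesis by blast
  qed
  then show "set as \<subseteq> content_range n" "antimono f1" "antimono f2" by blast+
  show "f1 c \<le> count_list as (- 1) + 1" using * antimonoD[of f1 0 c] by fastforce
  show "f2 c \<le> count_list as (- 1)" using * antimonoD[of f2 0 c] by fastforce
qed

text \<open>
  For the Young diagram with contents \<open>as\<close>: the numbers of boxes of content at least \<open>0\<close> in each
  row, then the numbers of boxes of content at most \<open>- 2\<close> in each column, each padded with zeros.
\<close>

definition content_profile :: "nat \<Rightarrow> nat \<Rightarrow> real list \<Rightarrow> nat list" where
  "content_profile n K as =
     map (\<lambda>j. card {c. c < n \<and> j < count_list as (real c)}) [0..<K] @
     map (\<lambda>j. card {c. c < n \<and> j < count_list as (- 2 - real c)}) [0..<K]"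

lemma length_content_profile [simp]: "length (content_profile n K as) = 2 * K"
  by (simp add: content_profile_def)

lemma prod_list_map_upt: "prod_list (map h [0..<K]) = (\<Prod>j<K. h j :: real)"
  by (induction K) auto

lemma sum_list_map_upt: "sum_list (map h [0..<K]) = (\<Sum>j<K. h j :: nat)"
  by (induction K) auto

text \<open>\<open>K = k + 1\<close> bounds all diagonal lengths other than that of content
  \<open>- 1\<close>: that diagonal has at most \<open>k\<close> boxes, and the others exceed it by
  at most one.\<close>

context
  fixes n k K as
  assumes as: "as \<in> JM_spectrum n" and d: "count_list as (- 1) \<le> k"
  defines "K \<equiv> Suc k"
begin

lemma profile_le: "count_list as (real c) \<le> K" "count_list as (- 2 - real c) \<le> K"
  using spectrum_content(4,5)[OF as, of c] d by (simp_all add: K_def)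

lemma profile_level:
  shows "(\<Prod>c<n. real (Suc c) ^ count_list as (real c)) =
      (\<Prod>j<K. fact (card {c. c < n \<and> j < count_list as (real c)}))"
    and "(\<Sum>c<n. count_list as (real c)) = (\<Sum>j<K. card {c. c < n \<and> j < count_list as (real c)})"
    and "c < n \<Longrightarrow> count_list as (real c) =
      card {j. j < K \<and> c < card {c. c < n \<and> j < count_list as (real c)}}"
    and "(\<Prod>c<n. real (Suc c) ^ count_list as (- 2 - real c)) =
      (\<Prod>j<K. fact (card {c. c < n \<and> j < count_list as (- 2 - real c)}))"
    and "(\<Sum>c<n. count_list as (- 2 - real c)) =
      (\<Sum>j<K. card {c. c < n \<and> j < count_list as (- 2 - real c)})"
    and "c < n \<Longrightarrow> count_list as (- 2 - real c) =
      card {j. j < K \<and> c < card {c. c < n \<and> j < count_list as (- 2 - real c)}}"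
  by (rule antitone_level_prod[OF spectrum_content(2)[OF as] profile_le(1)]
      antitone_level_prod[OF spectrum_content(3)[OF as] profile_le(2)] | assumption)+

lemma prod_list_profile:
  "prod_list (map (\<lambda>a. \<bar>1 + a\<bar>) (filter (\<lambda>a. a \<noteq> - 1) as)) =
     prod_list (map fact (content_profile n K as))"
proof -
  have "prod_list (map fact (content_profile n K as)) =
      (\<Prod>j<K. fact (card {c. c < n \<and> j < count_list as (real c)})) *
      (\<Prod>j<K. fact (card {c. c < n \<and> j < count_list as (- 2 - real c)}) :: real)"
    by (simp add: content_profile_def o_def prod_list_map_upt)
  then show ?thesis
    unfolding prod_list_content[OF spectrum_content(1)[OF as]] profile_level(1,4)[symmetric]
    by (simp add: add.commute)
qed

lemma sum_list_profile: "sum_list (content_profile n K as) = n - count_list as (- 1)"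
proof -
  have "real (length (filter (\<lambda>a. a \<noteq> - 1) as)) =
     real ((\<Sum>c<n. count_list as (real c)) + (\<Sum>c<n. count_list as (- 2 - real c)))"
    using sum_list_content[OF spectrum_content(1)[OF as], of "\<lambda>_. 1"]
    by (simp add: sum_list_triv)
  then have "length (filter (\<lambda>a. a \<noteq> - 1) as) =
      (\<Sum>c<n. count_list as (real c)) + (\<Sum>c<n. count_list as (- 2 - real c))"
    by (simp only: of_nat_eq_iff)
  moreover have "length (filter (\<lambda>a. a \<noteq> - 1) as) = n - count_list as (- 1)"
  proof -
    have "length (filter (\<lambda>a. a \<noteq> - 1) as) + count_list as (- 1) = length as"
      by (induction as) auto
    then show ?thesis using JM_spectrum_length[OF as] by simp
  qed
  ultimately show ?thesis
    unfolding profile_level(2,5)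
    by (simp add: content_profile_def sum_list_map_upt)
qed

text \<open>On each half \<open>1 / (c + 1)\<close> occurs at most \<open>K\<close> times, which
  leaves two harmonic sums.\<close>

lemma sum_list_inverse_content:
  assumes "n \<ge> 1"
  shows "sum_list (map (\<lambda>a. 1 / \<bar>1 + a\<bar>) (filter (\<lambda>a. a \<noteq> - 1) as)) \<le> 2 * K * (1 + ln n)"
proof -
  note sp = spectrum_content[OF as]
  have "sum_list (map (\<lambda>a. 1 / \<bar>1 + a\<bar>) (filter (\<lambda>a. a \<noteq> - 1) as)) =
      (\<Sum>c<n. count_list as (real c) * inverse (real (Suc c))) +
      (\<Sum>c<n. count_list as (- 2 - real c) * inverse (real (Suc c)))"
    unfolding sum_list_content[OF sp(1)]
    by (intro arg_cong2[of _ _ _ _ plus] sum.cong) (auto simp: field_simps abs_if)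
  also have "\<dots> \<le> (\<Sum>c<n. K * inverse (real (Suc c))) + (\<Sum>c<n. K * inverse (real (Suc c)))"
    using profile_le by (intro add_mono sum_mono mult_right_mono) auto
  also have "\<dots> = 2 * real K * harm n"
    by (simp add: harm_altdef sum_distrib_left mult.assoc)
  also have "harm n \<le> 1 + ln n"
    using euler_mascheroni_sequence_decreasing[of 1 n] assms by (simp add: harm_expand)
  then have "2 * real K * harm n \<le> 2 * real K * (1 + ln n)" by (rule mult_left_mono) simp
  finally show ?thesis by simp
qed

lemma coeff_spectrum_bound:
  assumes "n \<ge> 1"
  shows "\<bar>coeff (prod_list (map (\<lambda>a. [:1 + a, 1:]) as)) k\<bar> \<le>
    prod_list (map fact (content_profile n K as)) * (2 * K * (1 + ln n)) ^ k"
proof -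
  define bs where "bs = map (\<lambda>a. 1 + a) as"
  define P where "P = prod_list (map (\<lambda>a. \<bar>1 + a\<bar>) (filter (\<lambda>a. a \<noteq> - 1) as))"
  define S where "S = sum_list (map (\<lambda>a. 1 / \<bar>1 + a\<bar>) (filter (\<lambda>a. a \<noteq> - 1) as))"
  define T where "T = 2 * K * (1 + ln n)"
  have flt: "filter (\<lambda>b. b \<noteq> 0) bs = map (\<lambda>a. 1 + a) (filter (\<lambda>a. a \<noteq> - 1) as)"
    unfolding bs_def filter_map by (intro arg_cong[of _ _ "map _"] filter_cong) (auto simp: o_def add_eq_0_iff)
  have P: "P = prod_list (map fact (content_profile n K as))"
    unfolding P_def by (rule prod_list_profile)
  have P0: "P \<ge> 0" unfolding P_def by (induction as) auto
  have S0: "S \<ge> 0" unfolding S_def by (induction as) auto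
  have ST: "S \<le> T" unfolding S_def T_def by (rule sum_list_inverse_content[OF assms])
  \<comment> \<open>This permits raising the exponent \<open>k - count_list bs 0\<close> to
    \<open>k\<close>.\<close>
  have "T \<ge> 1"
  proof -
    have "1 * 1 \<le> (2 * real K) * (1 + ln n)" using assms by (intro mult_mono) (auto simp: K_def)
    then show ?thesis by (simp add: T_def)
  qed
  have "map (\<lambda>a. [:1 + a, 1:]) as = map (\<lambda>b. [:b, 1:]) bs" by (simp add: bs_def)
  then have "\<bar>coeff (prod_list (map (\<lambda>a. [:1 + a, 1:]) as)) k\<bar> \<le>
      (if k < count_list bs 0 then 0 else P * S ^ (k - count_list bs 0))"
    using coeff_linear_factors_bound[of bs k] unfolding flt
    by (cases "k < count_list bs 0") (simp_all add: P_def S_def o_def)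
  also have "\<dots> \<le> P * T ^ k"
  proof (cases "k < count_list bs 0")
    case False
    have "S ^ (k - count_list bs 0) \<le> T ^ (k - count_list bs 0)" using ST S0 by (intro power_mono) auto
    also have "\<dots> \<le> T ^ k" using \<open>T \<ge> 1\<close> by (intro power_increasing) auto
    finally show ?thesis using P0 False by (auto intro: mult_left_mono)
  qed (use P0 \<open>T \<ge> 1\<close> in auto)
  finally show ?thesis by (simp add: P T_def)
qed

end

lemma coeff_spectrum_eq_0:
  fixes as :: "real list"
  assumes "k < count_list as (- 1)"
  shows "coeff (prod_list (map (\<lambda>a. [:1 + a, 1:]) as)) k = 0"
proof -
  have "1 + a = 0 \<longleftrightarrow> a = - 1" for a :: real by auto
  then have "count_list (map (\<lambda>a. 1 + a) as) 0 = count_list as (- 1)"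
    by (induction as) auto
  then show ?thesis
    using coeff_linear_factors_bound[of "map (\<lambda>a. 1 + a) as" k] assms by (simp add: o_def)
qed

text \<open>The profile determines every diagonal length except that of content \<open>- 1\<close>,
  which the total number of boxes supplies.\<close>

lemma content_profile_inj:
  assumes "as \<in> JM_spectrum n" "count_list as (- 1) \<le> k" "bs \<in> JM_spectrum n" "count_list bs (- 1) \<le> k"
    and eq: "content_profile n (Suc k) as = content_profile n (Suc k) bs"
  shows "mset as = mset bs"
proof -
  have R: "card {c. c < n \<and> j < count_list as (real c)} = card {c. c < n \<and> j < count_list bs (real c)}"
    "card {c. c < n \<and> j < count_list as (- 2 - real c)} = card {c. c < n \<and> j < count_list bs (- 2 - real c)}"
    if "j < Suc k" for j
    using eq that unfolding content_profile_def by (auto simp: map_eq_conv simp del: upt_Suc)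
  have "count_list as x = count_list bs x" for x
  proof (cases "x \<in> content_range n")
    case True
    then show ?thesis
    proof (cases rule: content_range_cases)
      case 1
      have "count_list as (- 1) \<le> n" "count_list bs (- 1) \<le> n"
        using assms(1,3)[THEN JM_spectrum_length] count_le_length by metis+
      then show ?thesis
        using sum_list_profile[OF assms(1,2)] sum_list_profile[OF assms(3,4)] eq 1 by auto
    next
      case (2 c)
      have "{j. j < Suc k \<and> c < card {c. c < n \<and> j < count_list as (real c)}} =
         {j. j < Suc k \<and> c < card {c. c < n \<and> j < count_list bs (real c)}}"
        using R(1) by auto
      then show ?thesis
        using profile_level(3)[OF assms(1,2) 2(1)] profile_level(3)[OF assms(3,4) 2(1)] 2(2) by metis
    next
      case (3 c)
      have "{j. j < Suc k \<and> c < card {c. c < n \<and> j < count_list as (- 2 - real c)}} =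
         {j. j < Suc k \<and> c < card {c. c < n \<and> j < count_list bs (- 2 - real c)}}"
        using R(2) by auto
      then show ?thesis
        using profile_level(6)[OF assms(1,2) 3(1)] profile_level(6)[OF assms(3,4) 3(1)] 3(2) by metis
    qed
  next
    case False
    then have "x \<notin> set as" "x \<notin> set bs" using spectrum_content(1) assms by blast+
    then show ?thesis by (simp add: count_list_0_iff)
  qed
  then show ?thesis by (intro multiset_eqI) (simp add: count_mset)
qed

text \<open>Group the lists by the number \<open>d\<close> of entries \<open>- 1\<close>; only
  \<open>1 \<le> d \<le> k\<close> contributes, whence the factor \<open>k\<close>. For fixed
  \<open>d\<close> the profiles are distinct compositions of \<open>n - d\<close> into
  \<open>2 * Suc k\<close> parts, whence the power of \<open>3\<close>.\<close>

lemma spectrum_coeff_sum_bound: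
  assumes "n \<ge> 1" "finite M" "M \<subseteq> JM_spectrum n" "inj_on mset M" "\<forall>as\<in>M. - 1 \<in> set as"
  shows "(\<Sum>as\<in>M. \<bar>coeff (prod_list (map (\<lambda>a. [:1 + a, 1:]) as)) k\<bar>) \<le>
    real k * 3 ^ (2 * Suc k) * (2 * Suc k * (1 + ln n)) ^ k * fact (n - 1)"
proof -
  define T where "T = (2 * Suc k * (1 + ln n)) ^ k"
  have T: "T \<ge> 0" using assms(1) by (simp add: T_def)
  define M' where "M' = {as\<in>M. count_list as (- 1) \<le> k}"
  define pr where "pr = content_profile n (Suc k)"
  let ?C = "\<lambda>N. {xs :: nat list. length xs = 2 * Suc k \<and> sum_list xs = N}"
  have M': "as \<in> JM_spectrum n" "count_list as (- 1) \<le> k" "count_list as (- 1) \<ge> 1" if "as \<in> M'" for as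
    using that assms(3,5) count_list_0_iff[of as "- 1"] by (auto simp: M'_def)
  have inj: "inj_on pr M'"
  proof (rule inj_onI)
    fix as bs assume "as \<in> M'" "bs \<in> M'" "pr as = pr bs"
    then have "mset as = mset bs"
      unfolding pr_def using content_profile_inj[OF M'(1) M'(2) M'(1) M'(2)] by blast
    moreover have "as \<in> M" "bs \<in> M" using \<open>as \<in> M'\<close> \<open>bs \<in> M'\<close> by (simp_all add: M'_def)
    ultimately show "as = bs" using assms(4) inj_onD by metis
  qed
  define g where "g as = \<bar>coeff (prod_list (map (\<lambda>a. [:1 + a, 1:]) as)) k\<bar>" for as :: "real list"
  define f where "f xs = (prod_list (map fact xs) :: real)" for xs :: "nat list"
  define E where "E = (3 :: real) ^ (2 * Suc k) * fact (n - 1)"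
  define Md where "Md d = {as\<in>M'. count_list as (- 1) = d}" for d
  have finM': "finite M'" using assms(2) by (simp add: M'_def)
  have f0: "f xs \<ge> 0" for xs unfolding f_def by (induction xs) auto
  have g0: "g as = 0" if "as \<in> M - M'" for as
    using that coeff_spectrum_eq_0[of k as] by (simp add: g_def M'_def not_le)
  have gf: "g as \<le> f (pr as) * T" if "as \<in> M'" for as
    unfolding g_def f_def pr_def T_def using coeff_spectrum_bound[OF M'(1)[OF that] M'(2)[OF that] assms(1)] .
  have Md_le: "sum (\<lambda>as. f (pr as)) (Md d) \<le> E" if d: "d \<in> {1..k}" for d
  proof -
    have "inj_on pr (Md d)" using inj by (rule inj_on_subset) (auto simp: Md_def)
    then have "sum (\<lambda>as. f (pr as)) (Md d) = sum f (pr ` Md d)" by (simp add: sum.reindex)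
    also have "\<dots> \<le> sum f (?C (n - d))"
    proof (rule sum_mono2[OF finite_compositions _ f0])
      show "pr ` Md d \<subseteq> ?C (n - d)"
      proof
        fix xs assume "xs \<in> pr ` Md d"
        then obtain as where as: "as \<in> M'" "count_list as (- 1) = d" "xs = pr as"
          unfolding Md_def by blast
        then show "xs \<in> ?C (n - d)"
          using sum_list_profile[OF M'(1)[OF as(1)] M'(2)[OF as(1)]] by (simp add: pr_def)
      qed
    qed
    also have "\<dots> \<le> 3 ^ (2 * Suc k) * fact (n - d)" unfolding f_def by (rule sum_compositions_fact)
    \<comment> \<open>Here \<open>d \<ge> 1\<close> enters: \<open>fact (n - d)\<close> is at most
      \<open>fact (n - 1)\<close>, which saves a factor \<open>n\<close>.\<close>
    also have "\<dots> \<le> E"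
      unfolding E_def using d by (intro mult_left_mono fact_mono) auto
    finally show ?thesis .
  qed
  have "sum g M = sum g M'"
    using assms(2) g0 by (intro sum.mono_neutral_right) (auto simp: M'_def)
  also have "\<dots> \<le> (\<Sum>as\<in>M'. f (pr as) * T)" using gf by (rule sum_mono)
  also have "\<dots> = (\<Sum>as\<in>M'. f (pr as)) * T" by (rule sum_distrib_right[symmetric])
  finally have 1: "sum g M \<le> (\<Sum>as\<in>M'. f (pr as)) * T" .
  have img: "(\<lambda>as. count_list as (- 1)) ` M' \<subseteq> {1..k}" using M'(2,3) by auto
  have "(\<Sum>as\<in>M'. f (pr as)) = (\<Sum>d\<in>{1..k}. sum (\<lambda>as. f (pr as)) (Md d))"
    unfolding Md_def using sum.group[OF finM' _ img, of "\<lambda>as. f (pr as)"] by simp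
  also have "\<dots> \<le> (\<Sum>d\<in>{1..k}. E)" using Md_le by (rule sum_mono)
  also have "\<dots> = real k * E" by simp
  finally have "(\<Sum>as\<in>M'. f (pr as)) * T \<le> real k * E * T" using T by (rule mult_right_mono)
  with 1 have "sum g M \<le> real k * E * T" by (rule order.trans)
  moreover have "(\<Sum>as\<in>M. \<bar>coeff (prod_list (map (\<lambda>a. [:1 + a, 1:]) as)) k\<bar>) = sum g M"
    by (intro sum.cong) (auto simp: g_def)
  ultimately show ?thesis by (simp only: E_def T_def mult_ac)
qed

section \<open>Comparison of the expectations\<close>

text \<open>Every transposition reverses the sign, so the contents are those of the one-column
  diagram.\<close>

lemma JM_eigenvector_sign:
  "JM_eigenvector n (map (\<lambda>i. - real i) [0..<n]) (\<lambda>x. if x permutes {1..n} then of_int (sign x) else 0)"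
    (is "JM_eigenvector n ?as ?v")
  unfolding JM_eigenvector_def
proof (intro conjI ballI)
  show "?v \<noteq> (\<lambda>_. 0)"
    using fun_cong[of ?v "\<lambda>_. 0" id] by (auto simp: permutes_id sign_id simp del: id_apply)
  fix i assume i: "i \<in> {1..n}"
  have tr: "?v (exch j i \<circ> x) = - ?v x" if "j \<in> {1..<i}" for j x
  proof -
    have t: "exch j i permutes {1..n}" using that i by (intro exch_permutes) auto
    have "sign (exch j i \<circ> x) = - sign x" if "x permutes {1..n}"
    proof -
      have "permutation x" using that permutation_permutes by blast
      then show ?thesis using \<open>j \<in> {1..<i}\<close>
        by (simp add: sign_compose permutation_swap_id sign_swap_id)
    qed
    then show ?thesis using permutes_comp_iff[OF t] by auto
  qed
  show "JM i ?v = (\<lambda>x. ?as ! (i - 1) * ?v x)"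
  proof
    fix x
    have "JM i ?v x = (\<Sum>j\<in>{1..<i}. - ?v x)"
      unfolding JM_def by (intro sum.cong refl tr)
    moreover have "?as ! (i - 1) = - real (i - 1)"
      using nth_map_upt[of "i - 1" n 0 "\<lambda>i. - real i"] i by auto
    ultimately show "JM i ?v x = ?as ! (i - 1) * ?v x" by (simp only: sum_constant) simp
  qed
qed (auto simp: perm_functions_def)

lemma poly_eqI_real:
  fixes p q :: "real poly"
  assumes "\<And>t. poly p t = poly q t"
  shows "p = q"
  using assms poly_eq_poly_eq_iff by blast

lemma coeff_shift_power: "coeff ([:1, 1:] ^ m) k = (of_nat (m choose k) :: real)"
proof (induction m arbitrary: k)
  case 0
  then show ?case by (cases k) auto
next
  case (Suc m)
  then show ?case by (cases k) (simp_all add: coeff_pCons)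
qed

text \<open>Compare coefficients of \<open>y ^ k\<close> after substituting
  \<open>t = 1 + y\<close>. One set \<open>M\<close> serves all \<open>k\<close>.\<close>

lemma commutator_choose_sum:
  obtains M where "finite M" "M \<subseteq> JM_spectrum n" "inj_on mset M" "\<forall>as\<in>M. - 1 \<in> set as"
    "\<And>k. (\<Sum>x\<in>sym_carrier n. \<Sum>r\<in>sym_carrier n.
          real (num_cycles {1..n} (r \<circ> x \<circ> inv' r \<circ> inv' x) choose k)) =
       fact n * ((\<Sum>y\<in>sym_carrier n. real (num_cycles {1..n} y choose k))
         + (\<Sum>as\<in>M. coeff (prod_list (map (\<lambda>a. [:1 + a, 1:]) as)) k))"
proof -
  let ?G = "sym_carrier n"
  obtain M where M: "finite M" "M \<subseteq> JM_spectrum n" "inj_on mset M" "\<forall>as\<in>M. - 1 \<in> set as"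
    "\<And>t. (\<Sum>x\<in>?G. \<Sum>r\<in>?G. t ^ num_cycles {1..n} (r \<circ> x \<circ> inv' r \<circ> inv' x)) =
       fact n * ((\<Prod>i<n. t + real i) + (\<Sum>as\<in>M. prod_list (map (\<lambda>a. t + a) as)))"
    by (rule commutator_cycle_polynomial[of n]) (rule that)
  have unif: "(\<Sum>y\<in>?G. t ^ num_cycles {1..n} y) = (\<Prod>i<n. t + real i)" for t :: real
  proof -
    have "(\<Sum>y\<in>?G. t ^ num_cycles {1..n} y * 1) = (\<Prod>i=1..n. t + real (i - 1)) * 1"
      by (rule JM_generating_function[of n "\<lambda>_. 1"]) (simp add: JM_def)
    also have "(\<Prod>i=1..n. t + real (i - 1)) = (\<Prod>i<n. t + real i)"
      by (rule prod.reindex_bij_witness[of _ Suc "\<lambda>i. i - 1"]) auto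
    finally show ?thesis by simp
  qed
  have pl: "poly (prod_list (map (\<lambda>a. [:1 + a, 1:]) as)) t = prod_list (map (\<lambda>a. (1 + t) + a) as)"
    for as and t :: real
    by (induction as) (auto simp: algebra_simps)
  have "(\<Sum>x\<in>?G. \<Sum>r\<in>?G. [:1, 1:] ^ num_cycles {1..n} (r \<circ> x \<circ> inv' r \<circ> inv' x)) =
      smult (fact n) ((\<Sum>y\<in>?G. [:1, 1:] ^ num_cycles {1..n} y)
         + (\<Sum>as\<in>M. prod_list (map (\<lambda>a. [:1 + a, 1:]) as)))"
  proof (rule poly_eqI_real)
    fix t :: real
    have "poly [:1, 1:] t = 1 + t" by simp
    then show "poly (\<Sum>x\<in>?G. \<Sum>r\<in>?G. [:1, 1:] ^ num_cycles {1..n} (r \<circ> x \<circ> inv' r \<circ> inv' x)) t =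
        poly (smult (fact n) ((\<Sum>y\<in>?G. [:1, 1:] ^ num_cycles {1..n} y)
         + (\<Sum>as\<in>M. prod_list (map (\<lambda>a. [:1 + a, 1:]) as)))) t"
      by (simp only: poly_sum poly_power poly_smult poly_add pl M(5) unif)
  qed
  then have "coeff (\<Sum>x\<in>?G. \<Sum>r\<in>?G. [:1, 1:] ^ num_cycles {1..n} (r \<circ> x \<circ> inv' r \<circ> inv' x)) k =
      coeff (smult (fact n) ((\<Sum>y\<in>?G. [:1, 1:] ^ num_cycles {1..n} y)
         + (\<Sum>as\<in>M. prod_list (map (\<lambda>a. [:1 + a, 1:]) as)))) k" for k
    by (simp only:)
  then have "(\<Sum>x\<in>?G. \<Sum>r\<in>?G. real (num_cycles {1..n} (r \<circ> x \<circ> inv' r \<circ> inv' x) choose k)) =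
       fact n * ((\<Sum>y\<in>?G. real (num_cycles {1..n} y choose k))
         + (\<Sum>as\<in>M. coeff (prod_list (map (\<lambda>a. [:1 + a, 1:]) as)) k))" for k
    by (simp only: coeff_sum coeff_smult coeff_add coeff_shift_power)
  with M(1-4) show thesis by (rule that)
qed

lemma sign_choose_sum:
  "(\<Sum>y\<in>sym_carrier n. of_int (sign y) * real (num_cycles {1..n} y choose k)) =
     coeff (prod_list (map (\<lambda>a. [:1 + a, 1:]) (map (\<lambda>i. - real i) [0..<n]))) k"
proof -
  let ?G = "sym_carrier n" and ?as = "map (\<lambda>i. - real i) [0..<n]"
  have pl: "poly (prod_list (map (\<lambda>a. [:1 + a, 1:]) as)) t = prod_list (map (\<lambda>a. (1 + t) + a) as)"
    for as and t :: real
    by (induction as) (auto simp: algebra_simps)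
  have sgn: "(\<Sum>y\<in>?G. t ^ num_cycles {1..n} y * of_int (sign y)) = prod_list (map (\<lambda>a. t + a) ?as)" for t :: real
  proof -
    have "conv n (\<lambda>y. t ^ num_cycles {1..n} y) (\<lambda>x. if x permutes {1..n} then of_int (sign x) else 0) id =
        prod_list (map (\<lambda>a. t + a) ?as) * (if id permutes {1..n} then of_int (sign (id :: nat \<Rightarrow> nat)) else 0)"
      using fun_cong[OF conv_JM_eigenvector[OF JM_eigenvector_sign[of n], of t], of id] .
    moreover have "id permutes {1..n}" by (rule permutes_id)
    moreover have "(\<Sum>y\<in>?G. t ^ num_cycles {1..n} y * (if y permutes {1..n} then of_int (sign y) else 0)) =
        (\<Sum>y\<in>?G. t ^ num_cycles {1..n} y * of_int (sign y))"
      by (intro sum.cong) auto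
    ultimately show ?thesis by (simp only: conv_def o_id sign_id if_True of_int_1 mult_1_right)
  qed
  have "(\<Sum>y\<in>?G. smult (of_int (sign y)) ([:1, 1:] ^ num_cycles {1..n} y)) =
      prod_list (map (\<lambda>a. [:1 + a, 1:]) ?as)"
    by (rule poly_eqI_real) (simp only: poly_sum poly_smult poly_power pl sgn[symmetric], simp add: mult.commute)
  then have "coeff (\<Sum>y\<in>?G. smult (of_int (sign y)) ([:1, 1:] ^ num_cycles {1..n} y)) k =
      coeff (prod_list (map (\<lambda>a. [:1 + a, 1:]) ?as)) k" by (simp only:)
  then show ?thesis by (simp only: coeff_sum coeff_smult coeff_shift_power)
qed

text \<open>From \<open>n = 2\<close> on the one-column diagram has a box of content
  \<open>- 1\<close>, so the signed sum for \<open>k = 0\<close> vanishes.\<close>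

lemma card_alt_group:
  assumes "n \<ge> 2"
  shows "real (card (carrier (alt_group n))) = fact n / 2"
proof -
  let ?G = "sym_carrier n"
  have A: "carrier (alt_group n) = {y\<in>?G. evenperm y}" by (auto simp: alt_group_carrier)
  have "(\<Sum>y\<in>?G. of_int (sign y) * real (num_cycles {1..n} y choose 0)) = (0::real)"
    unfolding sign_choose_sum
    using assms by (intro coeff_spectrum_eq_0) (auto simp: count_list_0_iff image_iff intro!: Suc_leI gr0I bexI[of _ 1])
  then have "(\<Sum>y\<in>?G. of_int (sign y)) = (0::real)" by simp
  moreover have "(\<Sum>y\<in>?G. 1 + of_int (sign y)) = (\<Sum>y\<in>?G. if evenperm y then 2 else 0 :: real)"
    by (intro sum.cong) (auto simp: sign_def)
  moreover have "\<dots> = 2 * real (card (carrier (alt_group n)))"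
    unfolding A using finite_sym_carrier[of n] by (simp add: sum.If_cases Int_def)
  ultimately show ?thesis
    using card_permutations[of "{1..n}" n] by (simp add: sum.distrib)
qed

text \<open>The denominator \<open>fact n / 2\<close> is the order of the alternating group only for
  \<open>n \<ge> 2\<close>.\<close>

definition comm_minus_alt :: "nat \<Rightarrow> (nat \<Rightarrow> real) \<Rightarrow> real" where
  "comm_minus_alt n h =
     (\<Sum>x\<in>sym_carrier n. \<Sum>r\<in>sym_carrier n. h (num_cycles {1..n} (r \<circ> x \<circ> inv' r \<circ> inv' x))) / (fact n)\<^sup>2
     - (\<Sum>y\<in>carrier (alt_group n). h (num_cycles {1..n} y)) / (fact n / 2)"

text \<open>The uniform moment cancels. The sum over \<open>M\<close> and the one-column diagram,
  taken as a singleton, are bounded by the same lemma, whence the factor \<open>2\<close>.\<close>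

lemma comm_minus_alt_choose_bound:
  assumes "n \<ge> 2"
  shows "\<bar>comm_minus_alt n (\<lambda>m. real (m choose k))\<bar> \<le>
    2 * (real k * 3 ^ (2 * Suc k) * (2 * Suc k * (1 + ln n)) ^ k) / n"
proof -
  let ?G = "sym_carrier n"
  define c where "c as = coeff (prod_list (map (\<lambda>a. [:1 + a, 1:]) as)) k" for as :: "real list"
  define as0 where "as0 = map (\<lambda>i. - real i) [0..<n]"
  define U where "U = (\<Sum>y\<in>?G. real (num_cycles {1..n} y choose k))"
  define E where "E = real k * 3 ^ (2 * Suc k) * (2 * Suc k * (1 + ln n)) ^ k"
  obtain M where M: "finite M" "M \<subseteq> JM_spectrum n" "inj_on mset M" "\<forall>as\<in>M. - 1 \<in> set as"
    "\<And>k. (\<Sum>x\<in>?G. \<Sum>r\<in>?G. real (num_cycles {1..n} (r \<circ> x \<circ> inv' r \<circ> inv' x) choose k)) =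
       fact n * ((\<Sum>y\<in>?G. real (num_cycles {1..n} y choose k))
         + (\<Sum>as\<in>M. coeff (prod_list (map (\<lambda>a. [:1 + a, 1:]) as)) k))"
    by (rule commutator_choose_sum[of n]) (rule that)
  have A: "carrier (alt_group n) = {y\<in>?G. evenperm y}" by (auto simp: alt_group_carrier)
  have "U + c as0 = (\<Sum>y\<in>?G. (1 + of_int (sign y)) * real (num_cycles {1..n} y choose k))"
    unfolding U_def c_def as0_def sign_choose_sum[symmetric] by (simp add: sum.distrib algebra_simps)
  also have "\<dots> = (\<Sum>y\<in>?G. if evenperm y then 2 * real (num_cycles {1..n} y choose k) else 0)"
    by (intro sum.cong) (auto simp: sign_def)
  also have "\<dots> = 2 * (\<Sum>y\<in>carrier (alt_group n). real (num_cycles {1..n} y choose k))"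
    unfolding A using finite_sym_carrier[of n] by (simp add: sum.If_cases Int_def sum_distrib_left)
  finally have alt: "U + c as0 = 2 * (\<Sum>y\<in>carrier (alt_group n). real (num_cycles {1..n} y choose k))" .
  have "comm_minus_alt n (\<lambda>m. real (m choose k)) = ((U + (\<Sum>as\<in>M. c as)) - (U + c as0)) / fact n"
    unfolding comm_minus_alt_def M(5) alt by (simp add: U_def c_def power2_eq_square field_simps)
  also have "\<dots> = ((\<Sum>as\<in>M. c as) - c as0) / fact n" by simp
  finally have "\<bar>comm_minus_alt n (\<lambda>m. real (m choose k))\<bar> = \<bar>(\<Sum>as\<in>M. c as) - c as0\<bar> / fact n"
    by (simp add: abs_divide)
  also have "\<dots> \<le> ((\<Sum>as\<in>M. \<bar>c as\<bar>) + (\<Sum>as\<in>{as0}. \<bar>c as\<bar>)) / fact n"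
  proof (rule divide_right_mono)
    have "\<bar>sum c M - c as0\<bar> \<le> (\<Sum>as\<in>M. \<bar>c as\<bar>) + \<bar>c as0\<bar>"
      using order.trans[OF abs_triangle_ineq4 add_right_mono[OF sum_abs]] .
    then show "\<bar>sum c M - c as0\<bar> \<le> (\<Sum>as\<in>M. \<bar>c as\<bar>) + (\<Sum>as\<in>{as0}. \<bar>c as\<bar>)" by simp
  qed simp
  also have "\<dots> \<le> (E * fact (n - 1) + E * fact (n - 1)) / fact n"
  proof (intro divide_right_mono add_mono)
    show "(\<Sum>as\<in>M. \<bar>c as\<bar>) \<le> E * fact (n - 1)"
      unfolding c_def E_def using assms by (intro spectrum_coeff_sum_bound[OF _ M(1-4)]) simp
    have "as0 \<in> JM_spectrum n"
      unfolding JM_spectrum_def as0_def using JM_eigenvector_sign by blast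
    moreover have "- 1 \<in> set as0" unfolding as0_def using assms by (auto simp: image_iff intro!: bexI[of _ 1])
    ultimately show "(\<Sum>as\<in>{as0}. \<bar>c as\<bar>) \<le> E * fact (n - 1)"
      unfolding c_def E_def using assms by (intro spectrum_coeff_sum_bound) simp_all
  qed auto
  also have "\<dots> = 2 * E / n"
    using assms by (subst (3) fact_reduce) (auto simp: field_simps)
  finally show ?thesis by (simp only: E_def)
qed

text \<open>Multiplication by \<open>m\<close> maps \<open>m choose k\<close> to a combination of
  \<open>m choose k\<close> and \<open>m choose Suc k\<close>.\<close>

lemma poly_binomial_basis:
  fixes p :: "real poly"
  assumes "degree p \<le> l"
  shows "\<exists>c. \<forall>m. poly p (real m) = (\<Sum>k\<le>l. c k * real (m choose k))"
  using assms
proof (induction p arbitrary: l)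
  case 0
  show ?case by (intro exI[of _ "\<lambda>_. 0"]) simp
next
  case (pCons a p)
  show ?case
  proof (cases "p = 0")
    case True
    show ?thesis
    proof (intro exI[of _ "\<lambda>k. if k = 0 then a else 0"] allI)
      fix m
      have "(\<Sum>k\<le>l. (if k = 0 then a else 0) * real (m choose k)) = (\<Sum>k\<le>l. if k = 0 then a else 0)"
        by (intro sum.cong) auto
      then show "poly (pCons a p) (real m) = (\<Sum>k\<le>l. (if k = 0 then a else 0) * real (m choose k))"
        using True by simp
    qed
  next
    case False
    then obtain j where j: "l = Suc j" "degree p \<le> j" using pCons.prems by (cases l) auto
    obtain c where c: "\<And>m. poly p (real m) = (\<Sum>k\<le>j. c k * real (m choose k))"
      using pCons.IH[OF j(2)] by blast
    have step: "real m * real (m choose k) = real (Suc k) * real (m choose Suc k) + real k * real (m choose k)" for m k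
    proof -
      have "Suc k * (m choose Suc k) + k * (m choose k) = m * (m choose k)"
      proof (cases "k \<le> m")
        case True
        have "Suc k * (m choose Suc k) = (m - k) * (m choose k)"
          by (simp only: binomial_absorption binomial_absorb_comp)
        then have "Suc k * (m choose Suc k) + k * (m choose k) = ((m - k) + k) * (m choose k)"
          by (simp only: add_mult_distrib)
        then show ?thesis using True by (simp only: le_add_diff_inverse2)
      qed (simp add: binomial_eq_0)
      then show ?thesis by (metis of_nat_add of_nat_mult)
    qed
    \<comment> \<open>The constant \<open>a\<close>, then the two parts of \<open>step\<close>: the
      shifted one and the unshifted one.\<close>
    define e where "e k = (if k = 0 then a else 0) + (if k = 0 then 0 else real k * c (k - 1)) +
        (if k \<le> j then real k * c k else 0)" for k
    have "poly (pCons a p) (real m) = (\<Sum>k\<le>l. e k * real (m choose k))" for m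
    proof -
      have "poly (pCons a p) (real m) = a + (\<Sum>k\<le>j. c k * (real m * real (m choose k)))"
        by (simp add: c sum_distrib_left mult_ac)
      then have "poly (pCons a p) (real m) = a + (\<Sum>k\<le>j. real (Suc k) * c k * real (m choose Suc k)) + (\<Sum>k\<le>j. real k * c k * real (m choose k))"
        unfolding step by (simp add: distrib_left sum.distrib mult_ac del: of_nat_Suc)
      moreover have "a = (\<Sum>k\<le>l. (if k = 0 then a else 0) * real (m choose k))"
      proof -
        have "(\<Sum>k\<le>l. (if k = 0 then a else 0) * real (m choose k)) = (\<Sum>k\<le>l. if k = 0 then a else 0)"
          by (intro sum.cong) auto
        then show ?thesis by simp
      qed
      moreover have "(\<Sum>k\<le>j. real (Suc k) * c k * real (m choose Suc k)) =
          (\<Sum>k\<le>l. (if k = 0 then 0 else real k * c (k - 1)) * real (m choose k))"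
        unfolding j(1) by (subst sum.atMost_Suc_shift) (simp add: mult_ac del: of_nat_Suc)
      moreover have "(\<Sum>k\<le>j. real k * c k * real (m choose k)) =
          (\<Sum>k\<le>l. (if k \<le> j then real k * c k else 0) * real (m choose k))"
        unfolding j(1) by simp
      ultimately show ?thesis unfolding e_def distrib_right sum.distrib by linarith
    qed
    then show ?thesis by blast
  qed
qed

lemma comm_minus_alt_lin:
  "comm_minus_alt n (\<lambda>m. \<Sum>k\<in>K. c k * h k m) = (\<Sum>k\<in>K. c k * comm_minus_alt n (h k))"
proof -
  let ?G = "sym_carrier n"
  have "(\<Sum>x\<in>?G. \<Sum>r\<in>?G. \<Sum>k\<in>K. c k * h k (num_cycles {1..n} (r \<circ> x \<circ> inv' r \<circ> inv' x))) =
      (\<Sum>k\<in>K. c k * (\<Sum>x\<in>?G. \<Sum>r\<in>?G. h k (num_cycles {1..n} (r \<circ> x \<circ> inv' r \<circ> inv' x))))"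
    (is "?L = ?R")
  proof -
    have "?L = (\<Sum>x\<in>?G. \<Sum>k\<in>K. \<Sum>r\<in>?G. c k * h k (num_cycles {1..n} (r \<circ> x \<circ> inv' r \<circ> inv' x)))"
      by (rule sum.cong[OF refl]) (rule sum.swap)
    also have "\<dots> = (\<Sum>k\<in>K. \<Sum>x\<in>?G. \<Sum>r\<in>?G. c k * h k (num_cycles {1..n} (r \<circ> x \<circ> inv' r \<circ> inv' x)))"
      by (rule sum.swap)
    finally show ?thesis by (simp only: sum_distrib_left)
  qed
  moreover have "(\<Sum>y\<in>carrier (alt_group n). \<Sum>k\<in>K. c k * h k (num_cycles {1..n} y)) =
      (\<Sum>k\<in>K. c k * (\<Sum>y\<in>carrier (alt_group n). h k (num_cycles {1..n} y)))"
    by (subst sum.swap) (simp only: sum_distrib_left)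
  moreover have "(\<Sum>k\<in>K. c k * a k) / F - (\<Sum>k\<in>K. c k * b k) / F' = (\<Sum>k\<in>K. c k * (a k / F - b k / F'))"
    for a b :: "'a \<Rightarrow> real" and F F' :: real
    by (simp add: sum_divide_distrib sum_subtractf right_diff_distrib)
  ultimately show ?thesis unfolding comm_minus_alt_def by (simp only:)
qed

text \<open>\<open>\<tau>\<close> plays the part of \<open>x\<close> and \<open>\<sigma>\<close>
  that of the conjugator \<open>r\<close>, hence the order of the sums.\<close>

lemma expectation_commutator:
  fixes h :: "nat \<Rightarrow> real"
  shows "measure_pmf.expectation (pmf_of_set (carrier (sym_group n) \<times> carrier (sym_group n)))
      (\<lambda>(\<sigma>, \<tau>). h (num_cycles {1..n} (\<sigma> \<otimes>\<^bsub>sym_group n\<^esub> \<tau>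
        \<otimes>\<^bsub>sym_group n\<^esub> inv\<^bsub>sym_group n\<^esub> \<sigma> \<otimes>\<^bsub>sym_group n\<^esub> inv\<^bsub>sym_group n\<^esub> \<tau>))) =
    (\<Sum>\<tau>\<in>sym_carrier n. \<Sum>\<sigma>\<in>sym_carrier n. h (num_cycles {1..n} (\<sigma> \<circ> \<tau> \<circ> inv' \<sigma> \<circ> inv' \<tau>))) / (fact n)\<^sup>2"
  (is "measure_pmf.expectation _ ?f = _")
proof -
  let ?G = "sym_carrier n"
  have car: "carrier (sym_group n) = ?G" by (auto simp: sym_group_carrier)
  have ne: "?G \<noteq> {}" using permutes_id by blast
  have cG: "card ?G = fact n" using card_permutations[of "{1..n}" n] by simp
  have "measure_pmf.expectation (pmf_of_set (?G \<times> ?G)) ?f = sum ?f (?G \<times> ?G) / card (?G \<times> ?G)"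
    using finite_sym_carrier ne by (intro integral_pmf_of_set) auto
  also have "sum ?f (?G \<times> ?G) = (\<Sum>(\<sigma>, \<tau>)\<in>?G \<times> ?G. h (num_cycles {1..n} (\<sigma> \<circ> \<tau> \<circ> inv' \<sigma> \<circ> inv' \<tau>)))"
    by (intro sum.cong refl)
      (clarsimp simp: sym_group_mult sym_group_inv_equality sym_group_carrier simp del: o_apply)
  also have "\<dots> = (\<Sum>\<tau>\<in>?G. \<Sum>\<sigma>\<in>?G. h (num_cycles {1..n} (\<sigma> \<circ> \<tau> \<circ> inv' \<sigma> \<circ> inv' \<tau>)))"
    by (subst sum.swap) (rule sum.cartesian_product[symmetric])
  also have "real (card (?G \<times> ?G)) = (fact n)\<^sup>2"
    by (simp only: card_cartesian_product cG) (simp add: power2_eq_square)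
  finally show ?thesis unfolding car .
qed

lemma expectation_alt_group:
  fixes f :: "(nat \<Rightarrow> nat) \<Rightarrow> real"
  assumes "n \<ge> 2"
  shows "measure_pmf.expectation (pmf_of_set (carrier (alt_group n))) f =
    (\<Sum>y\<in>carrier (alt_group n). f y) / (fact n / 2)"
proof -
  have "finite (carrier (alt_group n))"
    using finite_sym_carrier[of n] by (rule rev_finite_subset) (auto simp: alt_group_carrier)
  moreover have "carrier (alt_group n) \<noteq> {}"
  proof
    assume "carrier (alt_group n) = {}"
    then have "(fact n :: real) / 2 = 0" using card_alt_group[OF assms] by (simp only: card.empty)
    then show False by simp
  qed
  ultimately show ?thesis
    unfolding card_alt_group[OF assms, symmetric] by (intro integral_pmf_of_set)
qed

theorem theorem2p4:
  fixes p :: "real poly" and l :: nat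
  assumes "degree p = l"
    and "\<And>x. x \<ge> 0 \<Longrightarrow> poly p x \<ge> 0"
    and "mono_on {0..} (poly p)"
  shows "(\<lambda>n::nat.
      measure_pmf.expectation (pmf_of_set (carrier (sym_group n) \<times> carrier (sym_group n)))
        (\<lambda>(\<sigma>, \<tau>). poly p (real (num_cycles {1..n}
          (\<sigma> \<otimes>\<^bsub>sym_group n\<^esub> \<tau> \<otimes>\<^bsub>sym_group n\<^esub> inv\<^bsub>sym_group n\<^esub> \<sigma> \<otimes>\<^bsub>sym_group n\<^esub> inv\<^bsub>sym_group n\<^esub> \<tau>))))
    - measure_pmf.expectation (pmf_of_set (carrier (alt_group n)))
        (\<lambda>\<eta>. poly p (real (num_cycles {1..n} \<eta>))))
    \<in> O(\<lambda>n. ln (real n) ^ l / real n)"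
  (is "?E \<in> _")
proof -
  obtain c where c: "\<And>m. poly p (real m) = (\<Sum>k\<le>l. c k * real (m choose k))"
    using poly_binomial_basis[of p l] assms(1) by blast
  \<comment> \<open>The \<open>4\<close> is the \<open>2\<close> of the binomial bound times the
    \<open>2\<close> from replacing \<open>1 + ln n\<close> by \<open>2 * ln n\<close>.\<close>
  define D where "D k = 2 * (real k * 3 ^ (2 * Suc k) * (4 * Suc k) ^ k)" for k
  have "\<bar>comm_minus_alt n (\<lambda>m. poly p (real m))\<bar> \<le> (\<Sum>k\<le>l. \<bar>c k\<bar> * D k) * (ln n ^ l / n)"
    if n: "n \<ge> 3" for n :: nat
  proof -
    \<comment> \<open>From \<open>n = 3\<close> on, \<open>ln n \<ge> 1\<close>: this allows that
      replacement and raising the exponent from \<open>k\<close> to \<open>l\<close>.\<close>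
    have "exp 1 \<le> (3 :: real)" using exp_le by simp
    then have "exp 1 \<le> real n" using n by linarith
    then have ln1: "ln n \<ge> 1" using n by (subst ln_ge_iff) auto
    have "comm_minus_alt n (\<lambda>m. poly p (real m)) =
        (\<Sum>k\<le>l. c k * comm_minus_alt n (\<lambda>m. real (m choose k)))"
      unfolding c by (rule comm_minus_alt_lin)
    also have "\<bar>\<dots>\<bar> \<le> (\<Sum>k\<le>l. \<bar>c k * comm_minus_alt n (\<lambda>m. real (m choose k))\<bar>)" by (rule sum_abs)
    also have "\<dots> \<le> (\<Sum>k\<le>l. \<bar>c k\<bar> * (D k * (ln n ^ l / n)))"
    proof (rule sum_mono)
      fix k assume "k \<in> {..l}"
      have "\<bar>comm_minus_alt n (\<lambda>m. real (m choose k))\<bar> \<le>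
          2 * (real k * 3 ^ (2 * Suc k) * (2 * Suc k * (1 + ln n)) ^ k) / n"
        using n by (intro comm_minus_alt_choose_bound) auto
      also have "\<dots> \<le> 2 * (real k * 3 ^ (2 * Suc k) * ((4 * Suc k) ^ k * ln n ^ l)) / n"
      proof (intro divide_right_mono mult_left_mono)
        have "2 * Suc k * (1 + ln n) \<le> 2 * Suc k * (2 * ln n)"
          using ln1 by (intro mult_left_mono) auto
        then have "(2 * Suc k * (1 + ln n)) ^ k \<le> (2 * Suc k * (2 * ln n)) ^ k"
          using ln1 by (intro power_mono) auto
        also have "2 * Suc k * (2 * ln n) = 4 * Suc k * ln n" by simp
        also have "(4 * Suc k * ln n) ^ k = (4 * Suc k) ^ k * ln n ^ k" by (simp add: power_mult_distrib)
        also have "\<dots> \<le> (4 * Suc k) ^ k * ln n ^ l"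
          using ln1 \<open>k \<in> {..l}\<close> by (intro mult_left_mono power_increasing) auto
        finally show "(2 * Suc k * (1 + ln n)) ^ k \<le> (4 * Suc k) ^ k * ln n ^ l" .
      qed auto
      also have "\<dots> = D k * (ln n ^ l / n)" by (simp add: D_def)
      finally show "\<bar>c k * comm_minus_alt n (\<lambda>m. real (m choose k))\<bar> \<le> \<bar>c k\<bar> * (D k * (ln n ^ l / n))"
        unfolding abs_mult by (intro mult_left_mono) auto
    qed
    also have "\<dots> = (\<Sum>k\<le>l. \<bar>c k\<bar> * D k) * (ln n ^ l / n)" by (simp only: sum_distrib_right mult.assoc)
    finally show ?thesis .
  qed
  then have "(\<lambda>n. comm_minus_alt n (\<lambda>m. poly p (real m))) \<in> O(\<lambda>n. ln (real n) ^ l / real n)"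
    by (intro bigoI[of _ "\<Sum>k\<le>l. \<bar>c k\<bar> * D k"] eventually_sequentiallyI[of 3])
      (auto simp: abs_mult intro: order.trans)
  \<comment> \<open>Equality holds from \<open>n = 2\<close> on, where the order of the alternating
    group is \<open>fact n / 2\<close>.\<close>
  moreover have "eventually (\<lambda>n. ?E n = comm_minus_alt n (\<lambda>m. poly p (real m))) sequentially"
    using expectation_commutator[of _ "\<lambda>m. poly p (real m)"] expectation_alt_group
    by (intro eventually_sequentiallyI[of 2]) (simp only: comm_minus_alt_def)
  ultimately show ?thesis using landau_o.big.in_cong by fast
qed

end
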